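(* Let $n\ge3$. (1) For $a\neq 0$, the space $\mathcal{C}_a$ of $n$-gons with prescribed oriented area $a$ is a $(2n-4)$-dimensional manifold and has the homotopy type of a cell complex with even-dimensional cells only. The dimensions of the cells range from $0$ to $2\left[\frac{n+1}{2}\right]-4$, with one cell in each even dimension in this range. (2) The space $\mathcal{C}_0$ of $n$-gons with zero oriented area is homeomorphic to $\mathcal{C}_{\pi,0}\times\mathbb{R}_{>0}$ for any $\pi>0$, where $\mathcal{C}_{\pi,0}$ is the space of $n$-gons with perimeter $\pi$ and oriented area $0$. Consequently its homology groups are $$H_j(\mathcal{C}_0,\mathbb{Z})=H_j(\mathcal{C}_{\pi,0},\mathbb{Z})=\begin{cases}\mathbb{Z}, & j \text{ even and } 0\le j\le n-2;\\ \mathbb{Z}, & j \text{ odd and } 2n-5\ge j\ge n-2;\\ 0,&\text{otherwise.}\end{cases}$$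
   Context: An $n$-gon is an $n$-tuple of points $(p_1,\dots,p_n)\in(\mathbb{R}^2)^n$, not all equal (but some may coincide), modulo the diagonal action of orientation-preserving isometries of the plane; $\mathcal{C}$ is the space of all $n$-gons. Perimeter: $\mathcal{P}(p_1,\dots,p_n)=|p_1p_2|+|p_2p_3|+\dots+|p_np_1|>0$. Oriented area: $2\mathcal{A}(p_1,\dots,p_n)=x_1y_2-x_2y_1+\dots+x_ny_1-x_1y_n$, $p_i=(x_i,y_i)$. $\mathcal{C}_a=\{\mathcal{A}=a\}\subset\mathcal{C}$ and $\mathcal{C}_{\pi,a}=\{\mathcal{P}=\pi,\ \mathcal{A}=a\}\subset\mathcal{C}$, where $\pi>0$ denotes a perimeter value, not the number $3.14\ldots$. $[x]$ denotes the integer part of $x$. *)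

theory Defs
  imports "HOL-Analysis.Analysis" "HOL-Homology.Homology"
begin

section \<open>Quotient spaces and manifolds\<close>

definition quotient_topology :: "'a topology \<Rightarrow> ('a \<times> 'a) set \<Rightarrow> 'a set topology" where
  "quotient_topology X R =
     topology (\<lambda>\<U>. \<U> \<subseteq> topspace X // R \<and> openin X {x \<in> topspace X. R `` {x} \<in> \<U>})"

lemma openin_quotient_topology:
  "openin (quotient_topology X R) \<U> \<longleftrightarrow>
     \<U> \<subseteq> topspace X // R \<and> openin X {x \<in> topspace X. R `` {x} \<in> \<U>}"
proof -
  have "istopology (\<lambda>\<U>. \<U> \<subseteq> topspace X // R \<and> openin X {x \<in> topspace X. R `` {x} \<in> \<U>})"
    (is "istopology ?P")
    unfolding istopology_def
  proof (intro conjI allI impI)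
    fix S T
    assume S: "?P S" and T: "?P T"
    have "{x \<in> topspace X. R `` {x} \<in> S \<inter> T}
        = {x \<in> topspace X. R `` {x} \<in> S} \<inter> {x \<in> topspace X. R `` {x} \<in> T}"
      by blast
    with S T show "openin X {x \<in> topspace X. R `` {x} \<in> S \<inter> T}"
      by auto
    show "S \<inter> T \<subseteq> topspace X // R"
      using S by blast
  next
    fix \<K>
    assume K: "\<forall>K\<in>\<K>. ?P K"
    have "{x \<in> topspace X. R `` {x} \<in> \<Union>\<K>} = (\<Union>K\<in>\<K>. {x \<in> topspace X. R `` {x} \<in> K})"
      by blast
    with K show "openin X {x \<in> topspace X. R `` {x} \<in> \<Union>\<K>}"
      by auto
    show "\<Union>\<K> \<subseteq> topspace X // R"
      using K by blast
  qed
  then show ?thesis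
    by (simp add: quotient_topology_def topology_inverse')
qed

lemma topspace_quotient_topology [simp]:
  "topspace (quotient_topology X R) = topspace X // R"
proof -
  have "{x \<in> topspace X. R `` {x} \<in> topspace X // R} = topspace X"
    by (auto intro: quotientI)
  then have "openin (quotient_topology X R) (topspace X // R)"
    by (simp add: openin_quotient_topology)
  then show ?thesis
    by (metis openin_quotient_topology openin_subset openin_topspace subset_antisym)
qed

lemma quotient_map_quotient_topology:
  "quotient_map X (quotient_topology X R) (\<lambda>x. R `` {x})"
  unfolding quotient_map_def by (auto simp: openin_quotient_topology quotient_def)

definition topological_manifold :: "nat \<Rightarrow> 'a topology \<Rightarrow> bool" where
  "topological_manifold d X \<longleftrightarrow>
     Hausdorff_space X \<and> second_countable X \<and>
     (\<forall>x \<in> topspace X. \<exists>U V. openin X U \<and> x \<in> U \<and> openin (Euclidean_space d) V \<and>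
        subtopology X U homeomorphic_space subtopology (Euclidean_space d) V)"

section \<open>Cell complexes\<close>

definition unit_disk :: "nat \<Rightarrow> (nat \<Rightarrow> real) set" where
  "unit_disk d = {x \<in> topspace (Euclidean_space d). (\<Sum>i<d. (x i)\<^sup>2) \<le> 1}"

definition open_disk :: "nat \<Rightarrow> (nat \<Rightarrow> real) set" where
  "open_disk d = {x \<in> topspace (Euclidean_space d). (\<Sum>i<d. (x i)\<^sup>2) < 1}"

text \<open>
  A CW structure on \<open>X\<close>: \<open>I\<close> indexes the cells, \<open>d i\<close> is the dimension of the cell \<open>i\<close> and \<open>\<Phi> i\<close>
  its characteristic map. The last two conditions are closure finiteness and the weak topology.
  For \<open>d i = 0\<close> both disks are a single point and the boundary is empty.
\<close>

definition cw_structure ::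
    "'a topology \<Rightarrow> 'i set \<Rightarrow> ('i \<Rightarrow> nat) \<Rightarrow> ('i \<Rightarrow> (nat \<Rightarrow> real) \<Rightarrow> 'a) \<Rightarrow> bool" where
  "cw_structure X I d \<Phi> \<longleftrightarrow>
     Hausdorff_space X \<and>
     (\<forall>i\<in>I. continuous_map (subtopology (Euclidean_space (d i)) (unit_disk (d i))) X (\<Phi> i)) \<and>
     (\<forall>i\<in>I. homeomorphic_map (subtopology (Euclidean_space (d i)) (open_disk (d i)))
              (subtopology X (\<Phi> i ` open_disk (d i))) (\<Phi> i)) \<and>
     disjoint_family_on (\<lambda>i. \<Phi> i ` open_disk (d i)) I \<and>
     (\<Union>i\<in>I. \<Phi> i ` open_disk (d i)) = topspace X \<and>
     (\<forall>i\<in>I. \<exists>F. finite F \<and> F \<subseteq> {j \<in> I. d j < d i} \<and>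
        \<Phi> i ` (unit_disk (d i) - open_disk (d i)) \<subseteq> (\<Union>j\<in>F. \<Phi> j ` open_disk (d j))) \<and>
     (\<forall>A. A \<subseteq> topspace X \<and> (\<forall>i\<in>I. closedin X (A \<inter> \<Phi> i ` unit_disk (d i))) \<longrightarrow> closedin X A)"

section \<open>Spaces of polygons\<close>

definition orientation_preserving_isometry :: "(real^2 \<Rightarrow> real^2) \<Rightarrow> bool" where
  "orientation_preserving_isometry f \<longleftrightarrow>
     (\<forall>x y. dist (f x) (f y) = dist x y) \<and> 0 < det (matrix (\<lambda>x. f x - f 0))"

text \<open>
  The vertices are numbered \<open>0, \<dots>, n - 1\<close>, and the tuples are extensional functions on
  \<open>{..<n}\<close>, so that they form a subspace of the product topology.
\<close>

definition vertex_tuples :: "nat \<Rightarrow> (nat \<Rightarrow> real^2) set" where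
  "vertex_tuples n = {p \<in> {..<n} \<rightarrow>\<^sub>E UNIV. \<exists>i<n. \<exists>j<n. p i \<noteq> p j}"

definition polygon_rel :: "nat \<Rightarrow> ((nat \<Rightarrow> real^2) \<times> (nat \<Rightarrow> real^2)) set" where
  "polygon_rel n = {(p, q). p \<in> vertex_tuples n \<and> q \<in> vertex_tuples n \<and>
     (\<exists>f. orientation_preserving_isometry f \<and> (\<forall>i<n. q i = f (p i)))}"

definition polygon_space :: "nat \<Rightarrow> (nat \<Rightarrow> real^2) set topology" where
  "polygon_space n =
     quotient_topology (subtopology (product_topology (\<lambda>_. euclidean) {..<n}) (vertex_tuples n))
       (polygon_rel n)"

definition perimeter :: "nat \<Rightarrow> (nat \<Rightarrow> real^2) \<Rightarrow> real" where
  "perimeter n p = (\<Sum>i<n. dist (p i) (p (Suc i mod n)))"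

definition oriented_area :: "nat \<Rightarrow> (nat \<Rightarrow> real^2) \<Rightarrow> real" where
  "oriented_area n p =
     (\<Sum>i<n. p i $ 1 * p (Suc i mod n) $ 2 - p (Suc i mod n) $ 1 * p i $ 2) / 2"

text \<open>
  Perimeter and oriented area are invariant under orientation-preserving isometries, so the
  classes below may be described by any of their representatives.
\<close>

definition area_space :: "nat \<Rightarrow> real \<Rightarrow> (nat \<Rightarrow> real^2) set topology" where
  "area_space n a = subtopology (polygon_space n)
     {polygon_rel n `` {p} |p. p \<in> vertex_tuples n \<and> oriented_area n p = a}"

definition perimeter_area_space :: "nat \<Rightarrow> real \<Rightarrow> real \<Rightarrow> (nat \<Rightarrow> real^2) set topology" where
  "perimeter_area_space n \<pi> a = subtopology (polygon_space n)
     {polygon_rel n `` {p} |p. p \<in> vertex_tuples n \<and> perimeter n p = \<pi> \<and> oriented_area n p = a}"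

text \<open>The asserted homology of the space of polygons with zero oriented area.\<close>

definition zero_area_homology :: "nat \<Rightarrow> int \<Rightarrow> int monoid" where
  "zero_area_homology n j =
     (if even j \<and> 0 \<le> j \<and> j \<le> int n - 2 then integer_group
      else if odd j \<and> int n - 2 \<le> j \<and> j \<le> 2 * int n - 5 then integer_group
      else singleton_group 0)"

lemma orientation_preserving_isometry_linear:
  assumes "orientation_preserving_isometry f"
  shows "linear (\<lambda>x. f x - f 0)"
  using assms orthogonal_transformation_isometry[of "\<lambda>x. f x - f 0"]
  by (auto simp: orientation_preserving_isometry_def orthogonal_transformation_def dist_norm)

lemma equiv_polygon_rel: "equiv (vertex_tuples n) (polygon_rel n)"
proof (rule equivI)
  show "polygon_rel n \<subseteq> vertex_tuples n \<times> vertex_tuples n"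
    by (auto simp: polygon_rel_def)
  have "orientation_preserving_isometry (\<lambda>x::real^2. x)"
    by (simp add: orientation_preserving_isometry_def matrix_id_mat_1[unfolded id_def])
  then show "refl_on (vertex_tuples n) (polygon_rel n)"
    by (auto simp: polygon_rel_def refl_on_def)
  show "sym (polygon_rel n)"
  proof (rule symI)
    fix p q assume "(p, q) \<in> polygon_rel n"
    then obtain f where pq: "p \<in> vertex_tuples n" "q \<in> vertex_tuples n"
      and f: "orientation_preserving_isometry f" and q: "\<forall>i<n. q i = f (p i)"
      by (auto simp: polygon_rel_def)
    define L where "L = (\<lambda>x. f x - f 0)"
    have linL: "linear L"
      unfolding L_def by (rule orientation_preserving_isometry_linear[OF f])
    have iso: "dist (f x) (f y) = dist x y" for x y
      using f by (simp add: orientation_preserving_isometry_def)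
    have "inj L"
      by (rule injI) (metis L_def diff_add_cancel dist_eq_0_iff iso)
    then obtain M where linM: "linear M" and left_inv: "\<And>x. M (L x) = x" and right_inv: "\<And>x. L (M x) = x"
      using linear_injective_isomorphism[OF linL] by blast
    define g where "g = (\<lambda>y. M (y - f 0))"
    have gf: "g (f x) = x" and fg: "f (g x) = x" for x
      using left_inv[of x] right_inv[of "x - f 0"] by (auto simp: g_def L_def algebra_simps)
    have "(\<lambda>x. g x - g 0) = M"
      using linear_diff[OF linM] linear_0[OF linM] by (auto simp: g_def fun_eq_iff)
    moreover have "det (matrix L) * det (matrix M) = 1"
    proof -
      have "L \<circ> M = id"
        using right_inv by auto
      then have "matrix L ** matrix M = mat 1"
        by (metis linL linM matrix_compose matrix_id_mat_1)
      then show ?thesis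
        by (metis det_I det_mul)
    qed
    moreover have "0 < det (matrix L)"
      using f by (simp add: orientation_preserving_isometry_def L_def)
    ultimately have "0 < det (matrix (\<lambda>x. g x - g 0))"
      by (metis zero_less_mult_pos zero_less_one)
    moreover have "dist (g x) (g y) = dist x y" for x y
      by (metis fg iso)
    ultimately have "orientation_preserving_isometry g"
      by (simp add: orientation_preserving_isometry_def)
    with pq q gf show "(q, p) \<in> polygon_rel n"
      by (auto simp: polygon_rel_def)
  qed
  show "trans (polygon_rel n)"
  proof (rule transI)
    fix p q r assume "(p, q) \<in> polygon_rel n" "(q, r) \<in> polygon_rel n"
    then obtain f g where pr: "p \<in> vertex_tuples n" "r \<in> vertex_tuples n"
      and f: "orientation_preserving_isometry f" and g: "orientation_preserving_isometry g"
      and r: "\<forall>i<n. r i = g (f (p i))"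
      by (auto simp: polygon_rel_def)
    define L where "L = (\<lambda>x. f x - f 0)"
    define M where "M = (\<lambda>x. g x - g 0)"
    have linL: "linear L" and linM: "linear M"
      unfolding L_def M_def
      by (rule orientation_preserving_isometry_linear[OF f],
          rule orientation_preserving_isometry_linear[OF g])
    have "g (f x) - g (f 0) = M (L x)" for x
      using linear_diff[OF linM, of "f x" "f 0"] by (simp add: L_def M_def)
    then have "(\<lambda>x. g (f x) - g (f 0)) = M \<circ> L"
      by auto
    then have "det (matrix (\<lambda>x. g (f x) - g (f 0))) = det (matrix M) * det (matrix L)"
      by (simp add: matrix_compose[OF linL linM] det_mul)
    then have "orientation_preserving_isometry (\<lambda>x. g (f x))"
      using f g by (simp add: orientation_preserving_isometry_def L_def M_def)
    with pr r show "(p, r) \<in> polygon_rel n"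
      by (auto simp: polygon_rel_def)
  qed
qed

end

theory Submission
  imports Defs
begin

text \<open>
  In suitably scaled Fourier coordinates the oriented area is the Hermitian form
  \<open>|u|\<^sup>2 - |v|\<^sup>2\<close>, where \<open>u\<close> and \<open>v\<close> collect the modes \<open>k < n/2\<close> and \<open>k > n/2\<close>; for even \<open>n\<close> the mode
  \<open>n/2\<close> contributes one further coordinate \<open>w\<close> on which the form vanishes. The space of polygons is
  the quotient of the nonzero vectors by the unit circle.

  A level \<open>a \<noteq> 0\<close> is a manifold, with charts obtained by normalizing a nonzero coordinate to be
  positive. Shrinking \<open>v\<close> and \<open>w\<close> (or \<open>u\<close> and \<open>w\<close>) retracts it to a complex projective space.

  The homology of the zero level is found by adding the coordinates of \<open>u\<close> one at a time. Adding
  \<open>u\<^sub>k\<close> changes the space, up to excision and deformation, by a product of a Euclidean space with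
  the sphere \<open>|v| = 1\<close>, so the relative homology is that of the sphere, shifted. As long as \<open>u\<close> has
  no more coordinates than \<open>v\<close>, the new degrees do not interact with the old ones and all boundary
  homomorphisms vanish. Finally, the perimeter is positive and homogeneous, which splits off the
  factor of positive reals.
\<close>

text \<open>The area pairs the vertex sequence with its cyclic shift, and the shift is diagonal in
  the Fourier basis; the weights are \<open>sin (2 * pi * k / n)\<close>, whence the three kinds of
  modes. The two signs occur equally often, so even the last coordinate added to \<open>u\<close>
  meets the condition that keeps the degrees apart.

  The obstacle to removing \<open>u_k\<close> outright is the set of points where all coordinates
  other than \<open>u_k\<close> and those of \<open>v\<close> vanish: shrinking \<open>u_k\<close>
  to 0 would push them into the excluded origin. This set is closed and \<open>u_k\<close> is
  nonzero on it, so a neighbourhood of it is a product, and its contribution is a Thom isomorphism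
  for a trivial bundle.

  Orbits are replaced by Hermitian matrices so that every space becomes a subset of one product of
  real lines. Maps are written down on vectors, and their continuity on orbits follows from local
  sections that turn a nonzero coordinate positive. The same sections show that the replacement
  carries the quotient topology.\<close>

lemma prod_topology_top_of_set: "prod_topology (top_of_set A) (top_of_set B) = top_of_set (A \<times> B)"
  by (simp add: euclidean_product_topology flip: subtopology_Times)

lemma continuous_on_Pair_const: "continuous_on S (Pair c)"
  by (intro continuous_intros)

text \<open>The predicate makes this a homotopy of pairs. It must not depend on values outside the
  space, which is what \<open>S \<subseteq> X\<close> secures.\<close>

lemma homotopic_with_top_of_setI:
  fixes X :: "'a::topological_space set" and Y :: "'b::topological_space set"
  assumes "continuous_on ({0..1::real} \<times> X) h" "h ` ({0..1} \<times> X) \<subseteq> Y"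
    and "\<And>x. x \<in> X \<Longrightarrow> h (0, x) = f x" "\<And>x. x \<in> X \<Longrightarrow> h (1, x) = g x"
    and "\<And>t x. t \<in> {0..1} \<Longrightarrow> x \<in> S \<Longrightarrow> h (t, x) \<in> T" "S \<subseteq> X"
  shows "homotopic_with (\<lambda>k. k \<in> S \<rightarrow> T) (top_of_set X) (top_of_set Y) f g"
proof -
  have 1: "\<And>h k. (\<And>x. x \<in> topspace (top_of_set X) \<Longrightarrow> h x = k x) \<Longrightarrow> (h \<in> S \<rightarrow> T) = (k \<in> S \<rightarrow> T)"
    using assms(6) by (auto simp: Pi_iff subset_iff)
  have 2: "continuous_map (prod_topology (top_of_set {0..1}) (top_of_set X)) (top_of_set Y) h"
    using assms(1,2) by (simp add: prod_topology_top_of_set image_subset_iff_funcset)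
  show ?thesis
  proof (rule iffD2[OF homotopic_with])
    show "(h \<in> S \<rightarrow> T) = (k \<in> S \<rightarrow> T)" if "\<And>x. x \<in> topspace (top_of_set X) \<Longrightarrow> h x = k x"
      for h k :: "'a \<Rightarrow> 'b"
      using 1 that by blast
    show "\<exists>h. continuous_map (prod_topology (top_of_set {0..1::real}) (top_of_set X)) (top_of_set Y) h \<and>
       (\<forall>x\<in>topspace (top_of_set X). h (0, x) = f x) \<and> (\<forall>x\<in>topspace (top_of_set X). h (1, x) = g x) \<and>
       (\<forall>t\<in>{0..1}. (\<lambda>x. h (t, x)) \<in> S \<rightarrow> T)"
      by (rule exI[of _ h]) (use assms(3-5) 2 in \<open>simp add: Pi_iff\<close>)
  qed
qed

lemma isomorphic_relative_homology_homotopy_equivalence: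
  fixes X :: "'a::topological_space set" and Y :: "'b::topological_space set"
  assumes f: "continuous_on X f" "f ` X \<subseteq> Y" "f ` S \<subseteq> T"
    and g: "continuous_on Y g" "g ` Y \<subseteq> X" "g ` T \<subseteq> S"
    and ST: "S \<subseteq> X" "T \<subseteq> Y"
    and h: "continuous_on ({0..1::real} \<times> X) h" "h ` ({0..1} \<times> X) \<subseteq> X" "h ` ({0..1} \<times> S) \<subseteq> S"
       "\<And>x. x \<in> X \<Longrightarrow> h (0, x) = g (f x)" "\<And>x. x \<in> X \<Longrightarrow> h (1, x) = x"
    and k: "continuous_on ({0..1::real} \<times> Y) k" "k ` ({0..1} \<times> Y) \<subseteq> Y" "k ` ({0..1} \<times> T) \<subseteq> T"
       "\<And>y. y \<in> Y \<Longrightarrow> k (0, y) = f (g y)" "\<And>y. y \<in> Y \<Longrightarrow> k (1, y) = y"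
  shows "relative_homology_group p (top_of_set X) S \<cong> relative_homology_group p (top_of_set Y) T"
proof (rule homotopy_equivalent_space_imp_isomorphic_relative_homology_groups)
  show "homotopic_with (\<lambda>h. h \<in> S \<rightarrow> S) (top_of_set X) (top_of_set X) (g \<circ> f) id"
    by (rule homotopic_with_top_of_setI[of _ h]) (use h ST in auto)
  show "homotopic_with (\<lambda>k. k \<in> T \<rightarrow> T) (top_of_set Y) (top_of_set Y) (f \<circ> g) id"
    by (rule homotopic_with_top_of_setI[of _ k]) (use k ST in auto)
qed (use f g in \<open>auto simp: image_subset_iff_funcset\<close>)

lemma isomorphic_homology_homotopy_equivalence:
  fixes X :: "'a::topological_space set" and Y :: "'b::topological_space set"
  assumes f: "continuous_on X f" "f ` X \<subseteq> Y"
    and g: "continuous_on Y g" "g ` Y \<subseteq> X"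
    and h: "continuous_on ({0..1::real} \<times> X) h" "h ` ({0..1} \<times> X) \<subseteq> X"
       "\<And>x. x \<in> X \<Longrightarrow> h (0, x) = g (f x)" "\<And>x. x \<in> X \<Longrightarrow> h (1, x) = x"
    and k: "continuous_on ({0..1::real} \<times> Y) k" "k ` ({0..1} \<times> Y) \<subseteq> Y"
       "\<And>y. y \<in> Y \<Longrightarrow> k (0, y) = f (g y)" "\<And>y. y \<in> Y \<Longrightarrow> k (1, y) = y"
  shows "homology_group p (top_of_set X) \<cong> homology_group p (top_of_set Y)"
  by (rule isomorphic_relative_homology_homotopy_equivalence[where f = f and g = g and h = h and k = k])
     (use assms in auto)

lemma homeomorphism_imp_homeomorphic_map:
  assumes "homeomorphism X Y f g"
  shows "homeomorphic_map (top_of_set X) (top_of_set Y) f"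
  unfolding homeomorphic_map_maps homeomorphic_maps_def
  by (rule exI[of _ g]) (use assms in \<open>simp add: homeomorphism_def Pi_iff image_subset_iff set_eq_subset\<close>)

lemma isomorphic_relative_homology_homeomorphism:
  assumes "homeomorphism X Y f g" "S \<subseteq> X" "f ` S = T"
  shows "relative_homology_group p (top_of_set X) S \<cong> relative_homology_group p (top_of_set Y) T"
proof -
  have "homeomorphic_map (top_of_set X) (top_of_set Y) f"
    using assms(1) by (rule homeomorphism_imp_homeomorphic_map)
  from homeomorphic_map_relative_homology_iso[OF this, of S T] assms
  show ?thesis by (auto simp: is_iso_def)
qed

section \<open>Suspension\<close>

text \<open>Pulling the real coordinate along a straight line to -1 deforms the pair onto one whose
  subset is the whole space: negative numbers stay negative on the way, and the second component,
  hence membership in \<open>V\<close>, does not move.\<close>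

lemma trivial_relative_homology_half_line:
  fixes W V :: "'w::topological_space set"
  assumes "V \<subseteq> W"
  shows "trivial_group (relative_homology_group p (top_of_set ((UNIV::real set) \<times> W))
     {(t, w). w \<in> W \<and> (t < 0 \<or> w \<in> V)})"
proof -
  let ?X = "(UNIV::real set) \<times> W" and ?P = "{(t::real, w). w \<in> W \<and> (t < 0 \<or> w \<in> V)}"
  let ?Y = "{-1::real} \<times> W"
  have neg: "s - 1 + s * t < 0" if "0 \<le> s" "s \<le> 1" "t < 0" for s t :: real
    using that mult_pos_neg[of s t] by (cases "s = 0") auto
  have "relative_homology_group p (top_of_set ?X) ?P \<cong> relative_homology_group p (top_of_set ?Y) ?Y"
    by (rule isomorphic_relative_homology_homotopy_equivalence
        [where f = "\<lambda>(t, w). (-1, w)" and g = id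
           and h = "\<lambda>(s, (t, w)). (s - 1 + s * t, w)" and k = "\<lambda>(s, y). y"])
       (auto simp: neg case_prod_unfold intro!: continuous_intros continuous_on_Pair_const)
  moreover have "trivial_group (relative_homology_group p (top_of_set ?Y) ?Y)"
    using trivial_relative_homology_group_topspace[of p "top_of_set ?Y"] by simp
  ultimately show ?thesis
    by (subst isomorphic_group_triviality) simp_all
qed

text \<open>
  The exact sequence of the triple obtained by inserting the half line pair, whose total homology
  vanishes, followed by excision of the closed lower half.
\<close>

proposition relative_homology_suspension:
  fixes W V :: "'w::topological_space set"
  assumes V: "openin (top_of_set W) V"
  shows "relative_homology_group p (top_of_set ((UNIV::real set) \<times> W))
           {(t, w). w \<in> W \<and> (t \<noteq> 0 \<or> w \<in> V)}
         \<cong> relative_homology_group (p - 1) (top_of_set W) V"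
proof -
  let ?X = "(UNIV::real set) \<times> W"
  let ?Q = "{(t::real, w). w \<in> W \<and> (t \<noteq> 0 \<or> w \<in> V)}"
  let ?P = "{(t::real, w). w \<in> W \<and> (t < 0 \<or> w \<in> V)}"
  let ?E = "?Q \<inter> {..0} \<times> UNIV"
  have VW: "V \<subseteq> W"
    using V openin_imp_subset by blast
  have PQ: "?P \<subseteq> ?Q" by auto
  have QX: "subtopology (top_of_set ?X) ?Q = top_of_set ?Q"
    by (simp add: subtopology_subtopology, rule arg_cong[where f = top_of_set]) auto
  have "hom_relboundary p (top_of_set ?X) ?Q ?P \<in>
    iso (relative_homology_group p (top_of_set ?X) ?Q)
        (relative_homology_group (p - 1) (subtopology (top_of_set ?X) ?Q) ?P)"
  proof (rule very_short_exact_sequence)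
    show "exact_seq
     ([relative_homology_group (p - 1) (top_of_set ?X) ?P,
       relative_homology_group (p - 1) (subtopology (top_of_set ?X) ?Q) ?P,
       relative_homology_group p (top_of_set ?X) ?Q, relative_homology_group p (top_of_set ?X) ?P],
      [hom_induced (p - 1) (subtopology (top_of_set ?X) ?Q) ?P (top_of_set ?X) ?P id,
       hom_relboundary p (top_of_set ?X) ?Q ?P,
       hom_induced p (top_of_set ?X) ?P (top_of_set ?X) ?Q id])"
      using homology_exactness_triple_1[OF PQ, of p "top_of_set ?X"] homology_exactness_triple_2[OF PQ, of p "top_of_set ?X"]
      by simp
  qed (use trivial_relative_homology_half_line[OF VW] in auto)
  then have 1: "relative_homology_group p (top_of_set ?X) ?Q \<cong>
      relative_homology_group (p - 1) (top_of_set ?Q) ?P"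
    unfolding QX by (rule is_isoI)
  \<comment> \<open>A point of \<open>?Q\<close> with real coordinate 0 has its other component in
    \<open>V\<close>, so \<open>?E\<close> lies in \<open>?P\<close>. For excision it then suffices
    that \<open>?E\<close> is closed and \<open>?P\<close> is open; the latter rests on the openness
    of \<open>V\<close>.\<close>
  have E: "closedin (top_of_set ?Q) ?E"
    by (intro closedin_closed_Int closed_Times closed_UNIV closed_atMost)
  obtain O' where O': "open O'" "V = W \<inter> O'"
    using V by (auto simp: openin_open)
  have "?P = ?Q \<inter> ({..<0} \<times> UNIV \<union> UNIV \<times> O')"
    using O' by auto
  moreover have "open ({..<0::real} \<times> UNIV \<union> UNIV \<times> O')"
    using O' by (intro open_Un open_Times) auto
  ultimately have P: "openin (top_of_set ?Q) ?P"
    unfolding openin_open by blast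
  have "hom_induced (p - 1) (subtopology (top_of_set ?Q) (?Q - ?E)) (?P - ?E)
       (subtopology (top_of_set ?Q) ?Q) ?P id
     \<in> iso (relative_homology_group (p - 1) (subtopology (top_of_set ?Q) (?Q - ?E)) (?P - ?E))
           (relative_homology_group (p - 1) (subtopology (top_of_set ?Q) ?Q) ?P)"
  proof (rule homology_excision_axiom)
    show "top_of_set ?Q closure_of ?E \<subseteq> top_of_set ?Q interior_of ?P"
      using E P by (auto simp: closure_of_closedin interior_of_openin)
  qed auto
  moreover have "?Q - ?E = {0<..} \<times> W" and PE: "?P - ?E = {0<..} \<times> V" and "?Q \<inter> {0<..} \<times> W = {0<..} \<times> W"
    using VW by auto
  then have "subtopology (top_of_set ?Q) (?Q - ?E) = top_of_set ({0::real<..} \<times> W)"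
    by (simp add: subtopology_subtopology)
  moreover have "subtopology (top_of_set ?Q) ?Q = top_of_set ?Q"
    by (simp add: subtopology_subtopology)
  ultimately have "relative_homology_group (p - 1) (top_of_set ({0::real<..} \<times> W)) ({0<..} \<times> V)
        \<cong> relative_homology_group (p - 1) (top_of_set ?Q) ?P"
    unfolding PE by (intro is_isoI) simp
  then have 2: "relative_homology_group (p - 1) (top_of_set ?Q) ?P \<cong>
     relative_homology_group (p - 1) (top_of_set ({0::real<..} \<times> W)) ({0<..} \<times> V)"
    by (rule group.iso_sym[OF group_relative_homology_group])
  \<comment> \<open>After excision only positive real coordinates are left, and they contract to
    1.\<close>
  have pos: "0 < 1 - s + s * t" if "0 \<le> s" "s \<le> 1" "0 < t" for s t :: real
    using that by (cases "s = 0") (auto intro!: add_nonneg_pos)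
  have 3: "relative_homology_group (p - 1) (top_of_set ({0::real<..} \<times> W)) ({0<..} \<times> V)
      \<cong> relative_homology_group (p - 1) (top_of_set W) V"
    by (rule isomorphic_relative_homology_homotopy_equivalence
        [where f = snd and g = "\<lambda>w. (1, w)"
           and h = "\<lambda>(s, (t, w)). (1 - s + s * t, w)" and k = "\<lambda>(s, y). y"])
       (use VW in \<open>auto simp: pos case_prod_unfold intro!: continuous_intros continuous_on_Pair_const\<close>)
  show ?thesis
    using 1 2 3 iso_trans by blast
qed

section \<open>Products with a Euclidean space\<close>

definition rspace :: "nat \<Rightarrow> (nat \<Rightarrow> real) set" where
  "rspace m = {x. \<forall>i\<ge>m. x i = 0}"

lemma Euclidean_space_eq_top_of_set: "Euclidean_space m = top_of_set (rspace m)"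
  by (simp add: Euclidean_space_def rspace_def euclidean_product_topology)

lemma continuous_on_coordinate:
  "continuous_on S f \<Longrightarrow> continuous_on S (\<lambda>x. f x i)"
  by (rule continuous_on_product_then_coordinatewise)

lemma continuous_on_fun_upd [continuous_intros]:
  fixes f :: "'a::topological_space \<Rightarrow> 'b \<Rightarrow> 'c::topological_space"
  assumes "continuous_on S f" "continuous_on S g"
  shows "continuous_on S (\<lambda>x. (f x)(i := g x))"
proof (rule continuous_on_coordinatewise_then_product)
  fix j show "continuous_on S (\<lambda>x. ((f x)(i := g x)) j)"
    using assms by (cases "i = j") (auto intro: continuous_on_coordinate)
qed

lemma open_coordinate_nonzero: "open {x :: 'a \<Rightarrow> 'b::{t1_space,zero}. x i \<noteq> 0}"
proof -
  have "{x :: 'a \<Rightarrow> 'b. x i \<noteq> 0} = (\<lambda>x. x i) -` (- {0})" by auto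
  then show ?thesis
    by (simp only:) (intro open_vimage open_Compl closed_singleton continuous_on_product_coordinates)
qed

text \<open>This is the Thom isomorphism of a trivial bundle, obtained by \<open>m\<close>-fold
  relative suspension: a vector extended by one entry is nonzero iff the new entry or the old vector
  is, which is the shape of the subset in \<open>relative_homology_suspension\<close>. Keeping
  \<open>W\<close> arbitrary makes a Kuenneth formula unnecessary.\<close>

proposition relative_homology_Thom:
  fixes W :: "'w::topological_space set"
  shows "relative_homology_group p (top_of_set (rspace m \<times> W)) ((rspace m - {\<lambda>_. 0}) \<times> W)
         \<cong> homology_group (p - int m) (top_of_set W)"
proof (induction m arbitrary: p)
  case 0
  have 0: "rspace 0 = {\<lambda>_. 0}" by (auto simp: rspace_def)
  have "relative_homology_group p (top_of_set ({\<lambda>_. 0} \<times> W)) {} \<cong> relative_homology_group p (top_of_set W) {}"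
  proof (rule isomorphic_relative_homology_homeomorphism)
    show "homeomorphism ({\<lambda>_. 0} \<times> W) W snd (Pair (\<lambda>_. 0))"
      by (rule homeomorphismI) (simp_all add: continuous_on_Pair_const continuous_on_snd image_subset_iff mem_Times_iff prod_eq_iff)
  qed auto
  then show ?case by (simp add: 0)
next
  case (Suc m)
  let ?W = "rspace m \<times> W" and ?V = "(rspace m - {\<lambda>_. 0}) \<times> W"
  have "openin (top_of_set ?W) ?V"
  proof -
    have "?V = ?W \<inter> (\<Union>i. {x. x i \<noteq> 0}) \<times> UNIV" by auto
    moreover have "open ((\<Union>i. {x :: nat \<Rightarrow> real. x i \<noteq> 0}) \<times> (UNIV :: 'w set))"
      by (intro open_Times open_UN) (auto intro: open_coordinate_nonzero)
    ultimately show ?thesis by (metis openin_open)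
  qed
  from relative_homology_suspension[OF this, of p] Suc.IH[of "p - 1"]
  have "relative_homology_group p (top_of_set ((UNIV::real set) \<times> ?W)) {(t, w). w \<in> ?W \<and> (t \<noteq> 0 \<or> w \<in> ?V)}
      \<cong> homology_group (p - 1 - int m) (top_of_set W)"
    using iso_trans by blast
  moreover have "relative_homology_group p (top_of_set ((UNIV::real set) \<times> ?W)) {(t, w). w \<in> ?W \<and> (t \<noteq> 0 \<or> w \<in> ?V)}
     \<cong> relative_homology_group p (top_of_set (rspace (Suc m) \<times> W)) ((rspace (Suc m) - {\<lambda>_. 0}) \<times> W)"
  proof (rule isomorphic_relative_homology_homeomorphism)
    let ?f = "\<lambda>(t::real, (x::nat \<Rightarrow> real, w)). (x(m := t), w)"
    let ?g = "\<lambda>(x::nat \<Rightarrow> real, w). (x m, (x(m := 0), w))"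
    have up: "x(m := t) \<in> rspace (Suc m)" if "x \<in> rspace m" for x t
      using that by (auto simp: rspace_def)
    have dn: "x(m := 0) \<in> rspace m" if "x \<in> rspace (Suc m)" for x
      using that by (auto simp: rspace_def not_less_eq_eq le_Suc_eq)
    have xm: "x m = 0" if "x \<in> rspace m" for x
      using that by (auto simp: rspace_def)
    show hom: "homeomorphism (UNIV \<times> ?W) (rspace (Suc m) \<times> W) ?f ?g"
    proof (rule homeomorphismI)
      show "continuous_on (UNIV \<times> ?W) ?f"
        unfolding case_prod_unfold
        by (intro continuous_on_Pair continuous_on_fun_upd continuous_on_fst continuous_on_snd continuous_on_id)
      have m: "continuous_on (rspace (Suc m) \<times> W) (\<lambda>p. fst p m)"
        by (rule continuous_on_coordinate) (intro continuous_on_fst continuous_on_id)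
      show "continuous_on (rspace (Suc m) \<times> W) ?g"
        unfolding case_prod_unfold
        by (intro m continuous_on_Pair continuous_on_fun_upd continuous_on_fst continuous_on_snd
            continuous_on_id continuous_on_const)
      show "?f ` (UNIV \<times> ?W) \<subseteq> rspace (Suc m) \<times> W" using up by auto
      show "?g ` (rspace (Suc m) \<times> W) \<subseteq> UNIV \<times> ?W" using dn by auto
    qed (simp_all add: case_prod_unfold fun_upd_idem xm mem_Times_iff prod_eq_iff)
    have nz: "x(m := t) = (\<lambda>_. 0) \<longleftrightarrow> t = 0 \<and> x = (\<lambda>_. 0)" if "x \<in> rspace m" for x t
      using xm[OF that] by (auto simp: fun_eq_iff)
    show "?f ` {(t, w). w \<in> ?W \<and> (t \<noteq> 0 \<or> w \<in> ?V)} = (rspace (Suc m) - {\<lambda>_. 0}) \<times> W" (is "?f ` ?A = ?B")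
    proof
      show "?f ` ?A \<subseteq> ?B" by (auto simp: up nz)
      show "?B \<subseteq> ?f ` ?A"
      proof
        fix y assume y: "y \<in> ?B"
        then obtain x w where xw: "y = (x, w)" "x \<in> rspace (Suc m)" "x \<noteq> (\<lambda>_. 0)" "w \<in> W"
          by auto
        have "x m \<noteq> 0 \<or> x(m := 0) \<noteq> (\<lambda>_. 0)"
          using nz[OF dn[OF xw(2)], of "x m"] xw(3) by auto
        then have "(x m, (x(m := 0), w)) \<in> ?A"
          using dn[OF xw(2)] xw(4) by simp
        moreover have "?f (x m, (x(m := 0), w)) = y" by (simp add: xw(1))
        ultimately show "y \<in> ?f ` ?A" by (rule rev_image_eqI[OF _ sym])
      qed
    qed
  qed auto
  moreover have "p - 1 - int m = p - int (Suc m)" by simp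
  ultimately show ?case
    by (simp only:) (rule iso_trans[OF group.iso_sym[OF group_relative_homology_group]])
qed

section \<open>Groups that are infinite cyclic or trivial\<close>

text \<open>The flag is meant to be a condition on the degree, so that one formula describes a whole
  graded group.\<close>

definition Z_or_trivial :: "bool \<Rightarrow> ('a, 'b) monoid_scheme \<Rightarrow> bool" where
  "Z_or_trivial b G \<longleftrightarrow> (if b then G \<cong> integer_group else trivial_group G)"

lemma Z_or_trivial_iso:
  assumes "G \<cong> H" "Z_or_trivial b H" "group G" "group H"
  shows "Z_or_trivial b G"
  using assms iso_trans isomorphic_group_triviality unfolding Z_or_trivial_def by metis

lemma Z_or_trivial_imp_iso:
  assumes "Z_or_trivial b G" "group G"
  shows "G \<cong> (if b then integer_group else singleton_group 0)"
proof (cases b)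
  case False
  then have "trivial_group G" using assms by (simp add: Z_or_trivial_def)
  then obtain x where x: "carrier G = {x}" "\<one>\<^bsub>G\<^esub> = x" by (auto simp: trivial_group_def)
  have "(\<lambda>_. 0) \<in> iso G (singleton_group (0::int))"
    using x by (auto simp: iso_def hom_def bij_betw_def singleton_group_def)
  then show ?thesis using False by (simp add: is_isoI)
qed (use assms in \<open>simp add: Z_or_trivial_def\<close>)

lemma homology_unit: "Z_or_trivial (p = 0) (homology_group p (top_of_set {0::real}))"
proof (cases "p = 0")
  case True
  then show ?thesis
    using isomorphic_integer_zeroth_homology_group[of "top_of_set {0::real}"]
    by (simp add: Z_or_trivial_def path_connected_space_topspace_empty flip: path_connectedin_topspace)
next
  case False
  then show ?thesis
    using homology_dimension_axiom[of "top_of_set {0::real}" "0::real" p] by (simp add: Z_or_trivial_def)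
qed

lemma relative_homology_rspace:
  "Z_or_trivial (p = int m) (relative_homology_group p (top_of_set (rspace m)) (rspace m - {\<lambda>_. 0}))"
proof -
  have "relative_homology_group p (top_of_set (rspace m)) (rspace m - {\<lambda>_. 0})
     \<cong> relative_homology_group p (top_of_set (rspace m \<times> {0::real})) ((rspace m - {\<lambda>_. 0}) \<times> {0::real})"
  proof (rule isomorphic_relative_homology_homeomorphism)
    show "homeomorphism (rspace m) (rspace m \<times> {0::real}) (\<lambda>x. (x, 0)) fst"
      by (rule homeomorphismI)
         (auto intro!: continuous_on_Pair continuous_on_id continuous_on_const continuous_on_fst)
  qed auto
  also have "\<dots> \<cong> homology_group (p - int m) (top_of_set {0::real})"
    by (rule relative_homology_Thom)
  finally show ?thesis
    by (rule Z_or_trivial_iso) (use homology_unit[of "p - int m"] in auto)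
qed

text \<open>In the exact sequence of the pair the ambient space is contractible and the relative
  homology sits in degree \<open>m\<close> alone. For \<open>m \<ge> 2\<close> this leaves degree 0
  unaffected by the puncture; in the other degrees the boundary homomorphism is an
  isomorphism.\<close>

lemma homology_punctured_rspace:
  assumes "m \<ge> 2"
  shows "Z_or_trivial (p = 0 \<or> p = int m - 1) (homology_group p (top_of_set (rspace m - {\<lambda>_. 0})))"
proof -
  let ?X = "top_of_set (rspace m)" and ?S = "rspace m - {\<lambda>_. 0 :: real}"
  have con: "contractible_space ?X"
    by (metis Euclidean_space_eq_top_of_set contractible_Euclidean_space)
  have sub: "subtopology ?X ?S = top_of_set ?S"
    by (simp add: subtopology_subtopology Int_absorb1)
  have "(\<lambda>i. if i = 0 then 1 else 0) \<in> ?S"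
    using assms by (auto simp: rspace_def fun_eq_iff)
  then have ne: "topspace ?X \<inter> ?S \<noteq> {}" by auto
  show ?thesis
  proof (cases "p = 0")
    case True
    have "hom_induced 0 (subtopology ?X ?S) {} ?X {} id \<in>
        iso (homology_group 0 (subtopology ?X ?S)) (homology_group 0 ?X)"
    proof (rule very_short_exact_sequence)
      show "exact_seq ([relative_homology_group 0 ?X ?S, homology_group 0 ?X,
           homology_group 0 (subtopology ?X ?S), relative_homology_group 1 ?X ?S],
          [hom_induced 0 ?X {} ?X ?S id, hom_induced 0 (subtopology ?X ?S) {} ?X {} id, hom_boundary 1 ?X ?S])"
        using homology_exactness_axiom_2[of 1 ?X ?S] homology_exactness_axiom_3[of 0 ?X ?S]
        by simp
      show "trivial_group (relative_homology_group 0 ?X ?S)" "trivial_group (relative_homology_group 1 ?X ?S)"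
        using relative_homology_rspace[of 0 m] relative_homology_rspace[of 1 m] assms
        by (auto simp: Z_or_trivial_def)
    qed
    moreover have "homology_group 0 ?X \<cong> integer_group"
      using con ne by (intro isomorphic_integer_zeroth_homology_group contractible_imp_path_connected_space) auto
    ultimately show ?thesis
      using True iso_trans by (auto simp: Z_or_trivial_def is_iso_def sub)
  next
    case False
    have "homology_group p (top_of_set ?S) \<cong> relative_homology_group (p + 1) ?X ?S"
      using isomorphic_group_reduced_homology_of_contractible[OF con ne, of p] False
      by (simp add: sub un_reduced_homology_group)
    moreover have "Z_or_trivial (p = 0 \<or> p = int m - 1) (relative_homology_group (p + 1) ?X ?S)"
      using relative_homology_rspace[of "p + 1" m] False by (simp add: eq_diff_eq)
    ultimately show ?thesis
      by (rule Z_or_trivial_iso) auto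
  qed
qed

text \<open>By \<open>sep\<close>, every boundary homomorphism of the pair has trivial source or
  trivial target, and no degree receives contributions from both the subset and the relative group.
  So each group of \<open>X\<close> is isomorphic to one of its two neighbours and no extension
  problem arises.\<close>

lemma homology_separated_degrees:
  fixes h :: "int \<Rightarrow> bool" and r :: "int \<Rightarrow> bool"
  assumes S: "\<And>j. Z_or_trivial (h j) (homology_group j (subtopology X S))"
    and R: "\<And>j. Z_or_trivial (r j) (relative_homology_group j X S)"
    and sep: "\<And>j. r j \<Longrightarrow> \<not> h j \<and> \<not> h (j - 1)"
  shows "Z_or_trivial (h j \<or> r j) (homology_group j X)"
proof (cases "r j")
  case True
  have "hom_induced j X {} X S id \<in> iso (homology_group j X) (relative_homology_group j X S)"
  proof (rule very_short_exact_sequence)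
    show "exact_seq ([homology_group (j - 1) (subtopology X S), relative_homology_group j X S,
        homology_group j X, homology_group j (subtopology X S)],
        [hom_boundary j X S, hom_induced j X {} X S id, hom_induced j (subtopology X S) {} X {} id])"
      using homology_exactness_axiom_1[of j X S] homology_exactness_axiom_3[of j X S]
      by simp
    show "trivial_group (homology_group j (subtopology X S))"
      using S[of j] sep[OF True] by (simp add: Z_or_trivial_def)
    show "trivial_group (homology_group (j - 1) (subtopology X S))"
      using S[of "j - 1"] sep[OF True] by (simp add: Z_or_trivial_def)
  qed
  then have "homology_group j X \<cong> relative_homology_group j X S"
    by (auto simp: is_iso_def)
  then have "Z_or_trivial (r j) (homology_group j X)"
    by (rule Z_or_trivial_iso) (use R[of j] in auto)
  then show ?thesis using True by simp
next
  case False
  let ?i = "hom_induced j (subtopology X S) {} X {} id"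
  let ?A = "homology_group j (subtopology X S)" and ?B = "homology_group j X"
  let ?R = "\<lambda>j. relative_homology_group j X S"
  interpret i: group_hom ?A ?B ?i
    using homology_exactness_axiom_3[of j X S] by simp
  interpret d: group_hom "?R (j + 1)" ?A "hom_boundary (j + 1) X S"
    using homology_exactness_axiom_2[of "j + 1" X S] by simp
  interpret q: group_hom ?B "?R j" "hom_induced j X {} X S id"
    using homology_exactness_axiom_3[of j X S] by (simp add: group_hom_def group_hom_axioms_def)
  have im: "kernel ?A ?B ?i = hom_boundary (j + 1) X S ` carrier (?R (j + 1))"
    using homology_exactness_axiom_2[of "j + 1" X S] by simp
  \<comment> \<open>The kernel is the image of the boundary homomorphism from degree
    \<open>j + 1\<close>. Its source is trivial unless \<open>r (j + 1)\<close> holds, and then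
    \<open>sep\<close> makes its target trivial.\<close>
  have "kernel ?A ?B ?i = {\<one>\<^bsub>?A\<^esub>}"
  proof (cases "r (j + 1)")
    case True
    then have "carrier ?A = {\<one>\<^bsub>?A\<^esub>}"
      using S[of j] sep[OF True] by (simp add: Z_or_trivial_def trivial_group_def)
    then show ?thesis
      using i.subgroup_kernel subgroup.one_closed unfolding kernel_def by auto
  next
    case False
    then have "carrier (?R (j + 1)) = {\<one>\<^bsub>?R (j + 1)\<^esub>}"
      using R[of "j + 1"] by (simp add: Z_or_trivial_def trivial_group_def)
    then show ?thesis
      using im by simp
  qed
  moreover have "?i ` carrier ?A = carrier ?B"
  proof -
    have "carrier (?R j) = {\<one>\<^bsub>?R j\<^esub>}"
      using R[of j] False by (simp add: Z_or_trivial_def trivial_group_def)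
    then have "kernel ?B (?R j) (hom_induced j X {} X S id) = carrier ?B"
      using q.hom_closed unfolding kernel_def by blast
    then show ?thesis
      using homology_exactness_axiom_3[of j X S] by simp
  qed
  ultimately have "?i \<in> iso ?A ?B"
    by (simp only: i.iso_iff) (auto simp: kernel_def)
  then have "?A \<cong> ?B" by (auto simp: is_iso_def)
  then have "?B \<cong> ?A" by (simp add: group.iso_sym)
  then have "Z_or_trivial (h j) ?B"
    by (rule Z_or_trivial_iso) (use S[of j] in auto)
  then show ?thesis using False by simp
qed

section \<open>Orbit spaces of the circle action\<close>

definition rot :: "complex \<Rightarrow> (nat \<Rightarrow> complex) \<Rightarrow> nat \<Rightarrow> complex" where
  "rot c z = (\<lambda>i. c * z i)"

text \<open>Excluding 0 makes the action free and gives every point a nonzero coordinate, on which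
  the local sections depend.\<close>

definition circle_invariant :: "(nat \<Rightarrow> complex) set \<Rightarrow> bool" where
  "circle_invariant A \<longleftrightarrow> (\<lambda>_. 0) \<notin> A \<and> (\<forall>c z. cmod c = 1 \<longrightarrow> z \<in> A \<longrightarrow> rot c z \<in> A)"

text \<open>
  The orbit of \<open>z\<close> is encoded by the Hermitian matrix \<open>z z\<^sup>*\<close>. Adding real and imaginary part of an
  entry loses no information, since the real parts are symmetric and the imaginary parts
  antisymmetric.
\<close>

definition outer :: "(nat \<Rightarrow> complex) \<Rightarrow> nat \<Rightarrow> real" where
  "outer z m = (case prod_decode m of (i, j) \<Rightarrow> Re (z i * cnj (z j)) + Im (z i * cnj (z j)))"

definition entry :: "(nat \<Rightarrow> real) \<Rightarrow> nat \<Rightarrow> nat \<Rightarrow> complex" where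
  "entry h i j = Complex ((h (prod_encode (i, j)) + h (prod_encode (j, i))) / 2)
                         ((h (prod_encode (i, j)) - h (prod_encode (j, i))) / 2)"

lemma entry_outer [simp]: "entry (outer z) i j = z i * cnj (z j)"
  by (simp add: entry_def outer_def complex_eq_iff field_simps)

lemma continuous_on_coord [continuous_intros]:
  "continuous_on S (\<lambda>z :: 'a \<Rightarrow> 'b::topological_space. z i)"
  "continuous_on T (\<lambda>p :: 'c::topological_space \<times> ('a \<Rightarrow> 'b). snd p i)"
  "continuous_on U (\<lambda>p :: ('a \<Rightarrow> 'b) \<times> 'c. fst p i)"
  by (rule continuous_on_coordinate, intro continuous_on_id continuous_on_fst continuous_on_snd)+

lemma continuous_on_entry: "continuous_on S (\<lambda>h. entry h i j)"
  unfolding entry_def Complex_eq by (intro continuous_intros) auto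

lemma continuous_on_outer: "continuous_on S outer"
proof (rule continuous_on_coordinatewise_then_product)
  fix m
  obtain i j where ij: "prod_decode m = (i, j)" by (cases "prod_decode m")
  show "continuous_on S (\<lambda>z. outer z m)"
    unfolding outer_def ij by (auto intro!: continuous_intros)
qed

lemma outer_rot: "cmod c = 1 \<Longrightarrow> outer (rot c z) = outer z"
proof -
  assume "cmod c = 1"
  then have "c * cnj c = 1" by (simp add: complex_norm_square[symmetric])
  then have "rot c z i * cnj (rot c z j) = z i * cnj (z j)" for i j
    by (simp add: rot_def mult_ac flip: mult.assoc[of c "cnj c"])
  then show ?thesis
    by (simp add: outer_def fun_eq_iff)
qed

text \<open>Column \<open>k\<close> of the matrix, divided by the modulus of the coordinate
  \<open>z k\<close>: the representative of the orbit whose coordinate \<open>k\<close> is real and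
  positive, defined where that coordinate is nonzero.\<close>

definition local_section :: "nat \<Rightarrow> (nat \<Rightarrow> real) \<Rightarrow> nat \<Rightarrow> complex" where
  "local_section k h = (\<lambda>i. entry h i k / of_real (sqrt (cmod (entry h k k))))"

lemma local_section_outer:
  "local_section k (outer z) = rot (cnj (z k) / of_real (cmod (z k))) z"
  by (simp add: local_section_def rot_def norm_mult fun_eq_iff)

lemma cmod_phase: "z \<noteq> 0 \<Longrightarrow> cmod (cnj z / of_real (cmod z)) = 1"
  by (simp add: norm_divide)

text \<open>The diagonal of the matrix determines the moduli of the coordinates, and the column of a
  nonzero coordinate determines all the others up to a single phase.\<close>

lemma outer_eq_iff: "outer z = outer z' \<longleftrightarrow> (\<exists>c. cmod c = 1 \<and> z' = rot c z)"
proof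
  assume eq: "outer z = outer z'"
  have e: "z i * cnj (z j) = z' i * cnj (z' j)" for i j
    using eq entry_outer by metis
  have m: "cmod (z i) = cmod (z' i)" for i
  proof -
    have "(cmod (z i))\<^sup>2 = (cmod (z' i))\<^sup>2"
      using e[of i i] by (metis complex_norm_square of_real_eq_iff)
    then show ?thesis by simp
  qed
  show "\<exists>c. cmod c = 1 \<and> z' = rot c z"
  proof (cases "\<exists>k. z k \<noteq> 0")
    case True
    then obtain k where k: "z k \<noteq> 0" by blast
    then have k': "z' k \<noteq> 0" using m[of k] by auto
    let ?c = "cnj (z k) / cnj (z' k)"
    have "z' i = ?c * z i" for i
      using e[of i k] k' by (simp add: field_simps)
    moreover have "cmod ?c = 1"
      using k' m[of k] by (simp add: norm_divide)
    ultimately show ?thesis by (metis rot_def ext)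
  next
    case False
    then have "z' = rot 1 z" using m by (simp add: rot_def fun_eq_iff)
    then show ?thesis by (metis norm_one)
  qed
qed (auto simp: outer_rot)

lemma circle_invariant_rot: "circle_invariant A \<Longrightarrow> cmod c = 1 \<Longrightarrow> rot c z \<in> A \<longleftrightarrow> z \<in> A"
proof -
  assume A: "circle_invariant A" and c: "cmod c = 1"
  then have "c \<noteq> 0" by auto
  then have "cmod (inverse c) = 1" "rot (inverse c) (rot c z) = z"
    using c by (auto simp: norm_inverse rot_def fun_eq_iff)
  then show ?thesis
    using A c unfolding circle_invariant_def by metis
qed

lemma outer_in_image_iff: "circle_invariant A \<Longrightarrow> outer z \<in> outer ` A \<longleftrightarrow> z \<in> A"
  by (metis (no_types, lifting) circle_invariant_rot image_iff outer_eq_iff)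

lemma circle_invariant_Collect:
  assumes "circle_invariant A" "\<And>c z. cmod c = 1 \<Longrightarrow> z \<in> A \<Longrightarrow> P z \<Longrightarrow> P (rot c z)"
  shows "circle_invariant {z \<in> A. P z}"
  using assms by (auto simp: circle_invariant_def)

lemma open_entry_nonzero: "open {h. entry h k k \<noteq> 0}"
proof -
  have "{h. entry h k k \<noteq> 0} = (\<lambda>h. entry h k k) -` (- {0})" by auto
  then show ?thesis
    by (simp only:) (intro open_vimage open_Compl closed_singleton continuous_on_entry)
qed

lemma continuous_on_local_section: "continuous_on {h. entry h k k \<noteq> 0} (local_section k)"
proof (rule continuous_on_coordinatewise_then_product)
  fix i
  show "continuous_on {h. entry h k k \<noteq> 0} (\<lambda>h. local_section k h i)"
    unfolding local_section_def
    by (intro continuous_on_divide continuous_on_of_real continuous_on_real_sqrt continuous_on_norm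
        continuous_on_entry) auto
qed

text \<open>Near an orbit with a nonzero coordinate \<open>k\<close>, the map \<open>g\<close> is
  the composite of its lift with \<open>local_section k\<close>, so continuity can be checked on
  vectors. The parameter \<open>t\<close> is there for homotopies, where it replaces an argument
  about products of quotient maps.\<close>

lemma continuous_on_descend_param:
  fixes g :: "'t::t2_space \<times> (nat \<Rightarrow> real) \<Rightarrow> 'y::topological_space"
  assumes A: "circle_invariant A" and g: "continuous_on (T \<times> A) (\<lambda>p. g (fst p, outer (snd p)))"
  shows "continuous_on (T \<times> outer ` A) g"
  unfolding continuous_on_eq_continuous_within
proof
  fix x assume "x \<in> T \<times> outer ` A"
  then obtain t z where x: "x = (t, outer z)" and tz: "t \<in> T" "z \<in> A" by auto
  have "z \<noteq> (\<lambda>_. 0)" using A tz by (auto simp: circle_invariant_def)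
  then obtain k where k: "z k \<noteq> 0" by (auto simp: fun_eq_iff)
  define N where "N = (UNIV :: 't set) \<times> {h. entry h k k \<noteq> 0}"
  have N: "open N" unfolding N_def by (intro open_Times open_UNIV open_entry_nonzero)
  let ?s = "\<lambda>p :: 't \<times> (nat \<Rightarrow> real). (fst p, local_section k (snd p))"
  have s: "continuous_on ((T \<times> outer ` A) \<inter> N) ?s"
  proof (intro continuous_on_Pair continuous_on_fst continuous_on_id)
    show "continuous_on (T \<times> outer ` A \<inter> N) (\<lambda>p. local_section k (snd p))"
      by (rule continuous_on_compose2[OF continuous_on_local_section])
         (auto simp: N_def intro!: continuous_on_snd continuous_on_id)
  qed
  have sec: "local_section k (outer z) \<in> A" "outer (local_section k (outer z)) = outer z"
    if "z \<in> A" "z k \<noteq> 0" for z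
    using that A cmod_phase[of "z k"] by (auto simp: local_section_outer circle_invariant_rot outer_rot)
  have "continuous_on ((T \<times> outer ` A) \<inter> N) (\<lambda>p. (\<lambda>p. g (fst p, outer (snd p))) (?s p))"
    by (rule continuous_on_compose2[OF g s]) (auto simp: N_def sec)
  then have "continuous_on ((T \<times> outer ` A) \<inter> N) g"
    by (rule continuous_on_eq) (auto simp: N_def sec)
  moreover have xN: "x \<in> N" using k by (simp add: x N_def)
  ultimately have "continuous (at x within (T \<times> outer ` A) \<inter> N) g"
    using x tz by (auto simp: continuous_on_eq_continuous_within)
  then show "continuous (at x within T \<times> outer ` A) g"
    using at_within_nhd[OF xN N, of "T \<times> outer ` A \<inter> N" "T \<times> outer ` A"]
    by (simp add: continuous_within Int_assoc)
qed

lemma continuous_on_descend: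
  fixes g :: "(nat \<Rightarrow> real) \<Rightarrow> 'y::topological_space"
  assumes A: "circle_invariant A" and g: "continuous_on A (\<lambda>z. g (outer z))"
  shows "continuous_on (outer ` A) g"
proof -
  have "continuous_on ({0::real} \<times> outer ` A) (\<lambda>p. g (snd p))"
  proof (rule continuous_on_descend_param[OF A])
    show "continuous_on ({0::real} \<times> A) (\<lambda>p. g (snd (fst p, outer (snd p))))"
      using continuous_on_compose2[OF g, of "{0::real} \<times> A" snd] continuous_on_snd[OF continuous_on_id, of "{0::real} \<times> A"]
      by (simp add: subset_iff)
  qed
  from continuous_on_compose2[OF this, of "outer ` A" "Pair 0"]
  show ?thesis by (simp add: continuous_on_Pair_const image_subset_iff)
qed

text \<open>An arbitrary, discontinuous choice; it is only applied to elements of the range of \<open>outer\<close>.\<close>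

definition representative :: "(nat \<Rightarrow> real) \<Rightarrow> nat \<Rightarrow> complex" where
  "representative h = (SOME z. outer z = h)"

lemma outer_representative [simp]: "outer (representative (outer z)) = outer z"
  unfolding representative_def by (rule someI[of _ z]) simp

lemma representative_outer:
  obtains c where "cmod c = 1" "representative (outer z) = rot c z"
  using outer_representative[of z] outer_eq_iff by metis

text \<open>Equivariance lets maps and homotopy pass to orbits. Since \<open>f\<close> is an exact
  left inverse of \<open>g\<close>, only the other composite needs a homotopy.\<close>

lemma homotopy_equivalent_orbit_spaces:
  assumes A: "circle_invariant A" and B: "circle_invariant B"
    and f: "continuous_on A f" "f ` A \<subseteq> B" "\<And>c z. cmod c = 1 \<Longrightarrow> z \<in> A \<Longrightarrow> f (rot c z) = rot c (f z)"
    and g: "continuous_on B g" "g ` B \<subseteq> A" "\<And>c z. cmod c = 1 \<Longrightarrow> z \<in> B \<Longrightarrow> g (rot c z) = rot c (g z)"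
    and fg: "\<And>z. z \<in> B \<Longrightarrow> f (g z) = z"
    and h: "continuous_on ({0..1::real} \<times> A) h" "h ` ({0..1} \<times> A) \<subseteq> A"
      "\<And>c t z. cmod c = 1 \<Longrightarrow> t \<in> {0..1} \<Longrightarrow> z \<in> A \<Longrightarrow> h (t, rot c z) = rot c (h (t, z))"
      "\<And>z. z \<in> A \<Longrightarrow> h (0, z) = g (f z)" "\<And>z. z \<in> A \<Longrightarrow> h (1, z) = z"
  shows "top_of_set (outer ` A) homotopy_equivalent_space top_of_set (outer ` B)"
proof -
  define F where "F x = outer (f (representative x))" for x
  define G where "G x = outer (g (representative x))" for x
  define K where "K p = outer (h (fst p, representative (snd p)))" for p :: "real \<times> (nat \<Rightarrow> real)"
  have F: "F (outer z) = outer (f z)" if "z \<in> A" for z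
    by (metis F_def f(3) outer_rot representative_outer that)
  have G: "G (outer z) = outer (g z)" if "z \<in> B" for z
    by (metis G_def g(3) outer_rot representative_outer that)
  have K: "K (t, outer z) = outer (h (t, z))" if "z \<in> A" "t \<in> {0..1}" for z t
    by (metis K_def fst_conv h(3) outer_rot representative_outer snd_conv that)
  have contF: "continuous_on (outer ` A) F"
  proof (rule continuous_on_descend[OF A])
    have "continuous_on A (\<lambda>z. outer (f z))"
      by (rule continuous_on_compose2[OF continuous_on_outer[of UNIV] f(1)]) simp
    then show "continuous_on A (\<lambda>z. F (outer z))"
      by (rule continuous_on_eq) (simp add: F)
  qed
  have contG: "continuous_on (outer ` B) G"
  proof (rule continuous_on_descend[OF B])
    have "continuous_on B (\<lambda>z. outer (g z))"
      by (rule continuous_on_compose2[OF continuous_on_outer[of UNIV] g(1)]) simp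
    then show "continuous_on B (\<lambda>z. G (outer z))"
      by (rule continuous_on_eq) (simp add: G)
  qed
  have contK: "continuous_on ({0..1} \<times> outer ` A) K"
  proof (rule continuous_on_descend_param[OF A])
    have "continuous_on ({0..1} \<times> A) (\<lambda>p. outer (h p))"
      by (rule continuous_on_compose2[OF continuous_on_outer[of UNIV] h(1)]) simp
    then show "continuous_on ({0..1} \<times> A) (\<lambda>p. K (fst p, outer (snd p)))"
      by (rule continuous_on_eq) (auto simp: K)
  qed
  have "homotopic_with (\<lambda>k. k \<in> {} \<rightarrow> {}) (top_of_set (outer ` A)) (top_of_set (outer ` A)) (G \<circ> F) id"
    by (rule homotopic_with_top_of_setI[OF contK])
       (use f(2) g(2) h in \<open>auto simp: F G K image_subset_iff\<close>)
  moreover have "homotopic_with (\<lambda>k. k \<in> {} \<rightarrow> {}) (top_of_set (outer ` B)) (top_of_set (outer ` B)) (F \<circ> G) id"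
  proof (rule homotopic_with_top_of_setI)
    show "continuous_on ({0..1::real} \<times> outer ` B) snd"
      by (intro continuous_on_snd continuous_on_id)
  qed (use f(2) g(2) fg in \<open>auto simp: F G image_subset_iff\<close>)
  ultimately show ?thesis
    unfolding homotopy_equivalent_space_def
    using contF contG f(2) g(2) by (intro exI[of _ F] exI[of _ G]) (auto simp: F G image_subset_iff)
qed

text \<open>The source of all charts and cells below: \<open>f\<close> is an invariant normal form
  and \<open>g\<close> a continuous choice of representatives, so \<open>g \<circ> f\<close> moves
  points only within their orbits.\<close>

lemma homeomorphism_orbit_space:
  assumes A: "circle_invariant A"
    and f: "continuous_on A f" "f ` A \<subseteq> Y" "\<And>c z. cmod c = 1 \<Longrightarrow> z \<in> A \<Longrightarrow> f (rot c z) = f z"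
    and g: "continuous_on Y g" "g ` Y \<subseteq> A" "\<And>y. y \<in> Y \<Longrightarrow> f (g y) = y"
    and gf: "\<And>z. z \<in> A \<Longrightarrow> \<exists>c. cmod c = 1 \<and> g (f z) = rot c z"
  shows "homeomorphism (outer ` A) Y (\<lambda>h. f (representative h)) (\<lambda>y. outer (g y))"
    and "\<And>z. z \<in> A \<Longrightarrow> f (representative (outer z)) = f z"
proof -
  show F: "\<And>z. z \<in> A \<Longrightarrow> f (representative (outer z)) = f z"
    by (metis f(3) representative_outer)
  show "homeomorphism (outer ` A) Y (\<lambda>h. f (representative h)) (\<lambda>y. outer (g y))"
  proof (rule homeomorphismI)
    show "continuous_on (outer ` A) (\<lambda>h. f (representative h))"
      by (rule continuous_on_descend[OF A]) (use f(1) F in \<open>auto elim: continuous_on_eq\<close>)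
    show "continuous_on Y (\<lambda>y. outer (g y))"
      by (rule continuous_on_compose2[OF continuous_on_outer[of UNIV] g(1)]) simp
    show "(\<lambda>h. f (representative h)) ` outer ` A \<subseteq> Y"
      using f(2) F by auto
    show "(\<lambda>y. outer (g y)) ` Y \<subseteq> outer ` A"
      using g(2) by auto
    show "outer (g (f (representative x))) = x" if "x \<in> outer ` A" for x
    proof -
      from that obtain z where z: "z \<in> A" "x = outer z" by blast
      then show ?thesis using gf[OF z(1)] F[OF z(1)] outer_rot by metis
    qed
    show "f (representative (outer (g y))) = y" if "y \<in> Y" for y
      using that F g by (simp add: image_subset_iff)
  qed
qed

section \<open>Complex coordinates as real coordinates\<close>

definition cspace :: "nat set \<Rightarrow> (nat \<Rightarrow> complex) set" where
  "cspace D = {z. \<forall>i. i \<notin> D \<longrightarrow> z i = 0}"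

definition sqn :: "nat set \<Rightarrow> (nat \<Rightarrow> complex) \<Rightarrow> real" where
  "sqn D z = (\<Sum>i\<in>D. (cmod (z i))\<^sup>2)"

lemma sqn_nonneg: "0 \<le> sqn D z"
  by (simp add: sqn_def sum_nonneg)

lemma sqn_eq_0: "finite D \<Longrightarrow> sqn D z = 0 \<longleftrightarrow> (\<forall>i\<in>D. z i = 0)"
  by (simp add: sqn_def sum_nonneg_eq_0_iff)

lemma sqn_pos: "finite D \<Longrightarrow> 0 < sqn D z \<longleftrightarrow> (\<exists>i\<in>D. z i \<noteq> 0)"
  using sqn_eq_0[of D z] sqn_nonneg[of D z] by (metis less_eq_real_def less_irrefl)

lemma sqn_rot: "cmod c = 1 \<Longrightarrow> sqn D (rot c z) = sqn D z"
  by (simp add: sqn_def rot_def norm_mult)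

lemma sqn_scale: "(\<And>i. i \<in> D \<Longrightarrow> cmod (w i) = r * cmod (z i)) \<Longrightarrow> sqn D w = r\<^sup>2 * sqn D z"
  by (simp add: sqn_def power_mult_distrib sum_distrib_left)

lemma sqn_cong: "(\<And>i. i \<in> D \<Longrightarrow> cmod (w i) = cmod (z i)) \<Longrightarrow> sqn D w = sqn D z"
  by (simp add: sqn_def)

lemma sqn_insert: "finite D \<Longrightarrow> k \<notin> D \<Longrightarrow> sqn (insert k D) z = (cmod (z k))\<^sup>2 + sqn D z"
  by (simp add: sqn_def)

lemma continuous_on_sqn [continuous_intros]:
  "continuous_on S (\<lambda>z. sqn D z)" "continuous_on T (\<lambda>p. sqn D (snd p))" "continuous_on U (\<lambda>p. sqn D (fst p))"
  unfolding sqn_def by (intro continuous_intros)+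

definition realify :: "(nat \<Rightarrow> nat) \<Rightarrow> nat \<Rightarrow> (nat \<Rightarrow> complex) \<Rightarrow> nat \<Rightarrow> real" where
  "realify \<beta> d z = (\<lambda>m. if m < 2 * d then if even m then Re (z (\<beta> (m div 2))) else Im (z (\<beta> (m div 2))) else 0)"

definition complexify :: "(nat \<Rightarrow> nat) \<Rightarrow> nat \<Rightarrow> (nat \<Rightarrow> real) \<Rightarrow> nat \<Rightarrow> complex" where
  "complexify \<beta> d x = (\<lambda>i. if i \<in> \<beta> ` {..<d}
     then Complex (x (2 * inv_into {..<d} \<beta> i)) (x (Suc (2 * inv_into {..<d} \<beta> i))) else 0)"

lemma homeomorphism_realify:
  assumes \<beta>: "bij_betw \<beta> {..<d} D"
  shows "homeomorphism (cspace D) (rspace (2 * d)) (realify \<beta> d) (complexify \<beta> d)"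
proof (rule homeomorphismI)
  have im: "\<beta> ` {..<d} = D" and inj: "inj_on \<beta> {..<d}"
    using \<beta> by (auto simp: bij_betw_def)
  show "continuous_on (cspace D) (realify \<beta> d)"
  proof (rule continuous_on_coordinatewise_then_product)
    fix m show "continuous_on (cspace D) (\<lambda>z. realify \<beta> d z m)"
      unfolding realify_def
      by (cases "m < 2 * d"; cases "even m") (simp_all add: continuous_intros)
  qed
  show "continuous_on (rspace (2 * d)) (complexify \<beta> d)"
  proof (rule continuous_on_coordinatewise_then_product)
    fix i show "continuous_on (rspace (2 * d)) (\<lambda>x. complexify \<beta> d x i)"
      unfolding complexify_def Complex_eq
      by (cases "i \<in> \<beta> ` {..<d}") (simp_all add: continuous_intros)
  qed
  show "realify \<beta> d ` cspace D \<subseteq> rspace (2 * d)"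
    by (auto simp: realify_def rspace_def)
  show "complexify \<beta> d ` rspace (2 * d) \<subseteq> cspace D"
    using im by (auto simp: complexify_def cspace_def)
  show "complexify \<beta> d (realify \<beta> d z) = z" if "z \<in> cspace D" for z
  proof
    fix i
    show "complexify \<beta> d (realify \<beta> d z) i = z i"
    proof (cases "i \<in> D")
      case True
      then have j: "inv_into {..<d} \<beta> i < d" "\<beta> (inv_into {..<d} \<beta> i) = i"
        using im inv_into_into[of i \<beta> "{..<d}"] f_inv_into_f[of i \<beta> "{..<d}"] by auto
      then have "Suc (2 * inv_into {..<d} \<beta> i) < 2 * d" by simp
      then show ?thesis using True j im
        by (simp add: complexify_def realify_def complex_eq_iff)
    next
      case False
      then show ?thesis using that im by (simp add: complexify_def cspace_def)
    qed
  qed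
  show "realify \<beta> d (complexify \<beta> d x) = x" if "x \<in> rspace (2 * d)" for x
  proof
    fix m
    show "realify \<beta> d (complexify \<beta> d x) m = x m"
    proof (cases "m < 2 * d")
      case True
      then have "m div 2 < d" by auto
      then have "inv_into {..<d} \<beta> (\<beta> (m div 2)) = m div 2"
        using inj by simp
      then show ?thesis using True \<open>m div 2 < d\<close>
        by (auto simp: realify_def complexify_def)
    next
      case False
      then show ?thesis using that by (simp add: realify_def rspace_def)
    qed
  qed
qed

lemma realify_eq_0_iff:
  assumes "bij_betw \<beta> {..<d} D" "z \<in> cspace D"
  shows "realify \<beta> d z = (\<lambda>_. 0) \<longleftrightarrow> z = (\<lambda>_. 0)"
proof -
  have "realify \<beta> d (\<lambda>_. 0) = (\<lambda>_. 0)" by (auto simp: realify_def)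
  moreover have "(\<lambda>_. 0) \<in> cspace D" by (simp add: cspace_def)
  ultimately show ?thesis
    using homeomorphism_realify[OF assms(1)] assms(2) unfolding homeomorphism_def by metis
qed

lemma sum_squares_realify:
  assumes \<beta>: "bij_betw \<beta> {..<d} D"
  shows "(\<Sum>m<2 * d. (realify \<beta> d z m)\<^sup>2) = sqn D z"
proof -
  have "(\<Sum>m<2 * e. (realify \<beta> d z m)\<^sup>2) = (\<Sum>j<e. (cmod (z (\<beta> j)))\<^sup>2)" if "e \<le> d" for e
    using that
  proof (induction e)
    case (Suc e)
    have "2 * Suc e = Suc (Suc (2 * e))" by simp
    with Suc show ?case
      by (simp add: realify_def cmod_power2 del: mult_Suc_right)
  qed simp
  then have "(\<Sum>m<2 * d. (realify \<beta> d z m)\<^sup>2) = (\<Sum>j<d. (cmod (z (\<beta> j)))\<^sup>2)" by simp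
  also have "\<dots> = sqn D z"
    unfolding sqn_def by (rule sum.reindex_bij_betw[OF \<beta>])
  finally show ?thesis .
qed

lemma obtain_enumeration:
  assumes "finite (D :: nat set)"
  obtains \<beta> where "bij_betw \<beta> {..<card D} D"
  using ex_bij_betw_nat_finite[OF assms] by (auto simp: lessThan_atLeast0)

section \<open>Level sets of a Hermitian form\<close>

text \<open>\<open>C\<close> holds the coordinates on which the form vanishes. At
  \<open>a = 0\<close> the last condition removes the apex of the cone.\<close>

definition quadric :: "nat set \<Rightarrow> nat set \<Rightarrow> nat set \<Rightarrow> real \<Rightarrow> (nat \<Rightarrow> complex) set" where
  "quadric A B C a = {z \<in> cspace (A \<union> B \<union> C). sqn A z = sqn B z + a \<and> z \<noteq> (\<lambda>_. 0)}"

lemma quadric_swap: "quadric A B C (- a) = quadric B A C a"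
  by (auto simp: quadric_def Un_commute)

lemma cspace_rot: "z \<in> cspace D \<Longrightarrow> rot c z \<in> cspace D"
  by (simp add: cspace_def rot_def)

lemma rot_eq_0: "cmod c = 1 \<Longrightarrow> rot c z = (\<lambda>_. 0) \<longleftrightarrow> z = (\<lambda>_. 0)"
  by (auto simp: rot_def fun_eq_iff)

lemma circle_invariant_quadric: "circle_invariant (quadric A B C a)"
  by (auto simp: circle_invariant_def quadric_def cspace_rot sqn_rot rot_eq_0)

lemma circle_invariant_coordinates:
  assumes "circle_invariant A"
  shows "circle_invariant {z \<in> A. \<exists>i\<in>D. z i \<noteq> 0}" "circle_invariant {z \<in> A. z k \<noteq> 0}"
  by (rule circle_invariant_Collect[OF assms], force simp: rot_def)+

lemma outer_image_coordinate:
  assumes "circle_invariant A"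
  shows "outer ` {z \<in> A. z k \<noteq> 0} = outer ` A \<inter> {h. entry h k k \<noteq> 0}"
  by (auto simp: entry_outer)

lemma openin_outer_coordinates:
  assumes "circle_invariant A"
  shows "openin (top_of_set (outer ` A)) (outer ` {z \<in> A. z k \<noteq> 0})"
    and "openin (top_of_set (outer ` A)) (outer ` {z \<in> A. \<exists>i\<in>D. z i \<noteq> 0})"
proof -
  show 1: "openin (top_of_set (outer ` A)) (outer ` {z \<in> A. z k \<noteq> 0})" for k
    unfolding outer_image_coordinate[OF assms] by (intro openin_open_Int open_entry_nonzero)
  have "outer ` {z \<in> A. \<exists>i\<in>D. z i \<noteq> 0} = (\<Union>i\<in>D. outer ` {z \<in> A. z i \<noteq> 0})" by auto
  then show "openin (top_of_set (outer ` A)) (outer ` {z \<in> A. \<exists>i\<in>D. z i \<noteq> 0})"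
    using 1 by auto
qed

text \<open>At a zero of \<open>g\<close> the bound on \<open>r\<close> forces the product to 0, so
  the continuity of \<open>r\<close> is required only where \<open>g\<close> is nonzero. This serves
  factors that are quotients with a denominator vanishing together with \<open>g\<close>.\<close>

lemma continuous_on_bounded_mult:
  fixes g :: "'a::t2_space \<Rightarrow> complex" and r :: "'a \<Rightarrow> real"
  assumes g: "continuous_on S g" and r: "continuous_on {x \<in> S. g x \<noteq> 0} r"
    and b: "\<And>x. x \<in> S \<Longrightarrow> \<bar>r x\<bar> \<le> 1"
  shows "continuous_on S (\<lambda>x. of_real (r x) * g x)"
  unfolding continuous_on_def
proof
  fix x assume x: "x \<in> S"
  have gx: "(g \<longlongrightarrow> g x) (at x within S)"
    using g x by (auto simp: continuous_on_def)
  show "((\<lambda>x. of_real (r x) * g x) \<longlongrightarrow> of_real (r x) * g x) (at x within S)"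
  proof (cases "g x = 0")
    case True
    have "((\<lambda>x. of_real (r x) * g x) \<longlongrightarrow> 0) (at x within S)"
    proof (rule Lim_null_comparison)
      show "\<forall>\<^sub>F x in at x within S. norm (of_real (r x) * g x) \<le> norm (g x)"
        unfolding eventually_at_topological
        by (rule exI[of _ UNIV]) (use b in \<open>auto simp: norm_mult intro!: mult_left_le_one_le\<close>)
      show "((\<lambda>x. norm (g x)) \<longlongrightarrow> 0) (at x within S)"
        using tendsto_norm[OF gx] True by simp
    qed
    then show ?thesis using True by simp
  next
    case False
    obtain O' where O': "open O'" "{x \<in> S. g x \<noteq> 0} = S \<inter> O'"
    proof -
      have "openin (top_of_set S) (S \<inter> g -` (- {0}))"
        using g by (rule continuous_openin_preimage_gen) (simp add: open_Compl)
      moreover have "S \<inter> g -` (- {0}) = {x \<in> S. g x \<noteq> 0}" by auto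
      ultimately show ?thesis using that by (auto simp: openin_open)
    qed
    have "(r \<longlongrightarrow> r x) (at x within S \<inter> O')"
      using r x False O' by (auto simp: continuous_on_def)
    moreover have "at x within S \<inter> O' = at x within S"
      by (rule at_within_nhd[of _ O']) (use O' x False in auto)
    ultimately show ?thesis
      using gx by (auto intro!: tendsto_intros)
  qed
qed

section \<open>Deformation that removes one positive coordinate\<close>

locale disjoint_index_sets =
  fixes A B C :: "nat set" and k :: nat
  assumes finite: "finite A" "finite B" "finite C"
    and disjoint: "A \<inter> B = {}" "A \<inter> C = {}" "B \<inter> C = {}" "k \<notin> A" "k \<notin> B" "k \<notin> C"
begin

text \<open>
  Killing the coordinate \<open>k\<close> decreases the positive part of the form; the coordinates in \<open>B\<close> are
  shrunk by the same ratio.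
\<close>

definition ratio :: "real \<times> (nat \<Rightarrow> complex) \<Rightarrow> real" where
  "ratio p = sqrt ((sqn A (snd p) + (fst p)\<^sup>2 * (cmod (snd p k))\<^sup>2) / (sqn A (snd p) + (cmod (snd p k))\<^sup>2))"

definition squash :: "real \<times> (nat \<Rightarrow> complex) \<Rightarrow> nat \<Rightarrow> complex" where
  "squash p i = (if i = k then of_real (fst p) * snd p k
     else if i \<in> B then of_real (ratio p) * snd p i else snd p i)"

text \<open>The part of the cone where \<open>squash (0, z)\<close> stays nonzero: once coordinate
  \<open>k\<close> is killed, the form forces the coordinates in \<open>B\<close> to vanish if those
  in \<open>A\<close> do, so some coordinate in \<open>A\<close> or \<open>C\<close> has to
  survive.\<close>

abbreviation "source \<equiv> {z \<in> quadric (insert k A) B C 0. \<exists>i\<in>A \<union> C. z i \<noteq> 0}"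
abbreviation "target \<equiv> quadric A B C 0"

lemma squash_rot: "cmod c = 1 \<Longrightarrow> squash (t, rot c z) = rot c (squash (t, z))"
  by (auto simp: squash_def ratio_def rot_def sqn_rot[unfolded rot_def] norm_mult fun_eq_iff)

lemma quadric_insert: "z \<in> quadric (insert k A) B C 0 \<Longrightarrow> sqn B z = sqn A z + (cmod (z k))\<^sup>2"
  using finite disjoint by (simp add: quadric_def sqn_insert)

lemma ratio_bounds:
  assumes "t \<in> {0..1}" shows "0 \<le> ratio (t, z)" "ratio (t, z) \<le> 1"
proof -
  have t: "t\<^sup>2 * (cmod (z k))\<^sup>2 \<le> (cmod (z k))\<^sup>2"
    using assms by (intro mult_left_le_one_le) (auto simp: power_le_one)
  show "0 \<le> ratio (t, z)" by (simp add: ratio_def sqn_nonneg)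
  have "(sqn A z + t\<^sup>2 * (cmod (z k))\<^sup>2) / (sqn A z + (cmod (z k))\<^sup>2) \<le> 1"
    using t by (intro divide_le_eq_1[THEN iffD2]) (smt (verit) sqn_nonneg zero_le_power2)
  then show "ratio (t, z) \<le> 1"
    by (simp add: ratio_def)
qed

text \<open>Where the denominator of \<open>ratio\<close> vanishes, both sides are 0, so the
  identity holds for the value that division by zero produces as well.\<close>

lemma ratio_sq:
  "(ratio (t, z))\<^sup>2 * (sqn A z + (cmod (z k))\<^sup>2) = sqn A z + t\<^sup>2 * (cmod (z k))\<^sup>2"
proof (cases "sqn A z + (cmod (z k))\<^sup>2 = 0")
  case True
  then have "cmod (z k) = 0" "sqn A z = 0" using sqn_nonneg[of A z]
    by (auto simp: add_nonneg_eq_0_iff)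
  then show ?thesis by simp
next
  case False
  then show ?thesis by (simp add: ratio_def sqn_nonneg)
qed

lemma ratio_1: "z i \<noteq> 0 \<Longrightarrow> i \<in> B \<Longrightarrow> z \<in> quadric (insert k A) B C 0 \<Longrightarrow> ratio (1, z) = 1"
proof -
  assume z: "z i \<noteq> 0" "i \<in> B" "z \<in> quadric (insert k A) B C 0"
  then have "0 < sqn B z" using finite by (auto simp: sqn_pos)
  then show ?thesis using quadric_insert[OF z(3)] by (simp add: ratio_def)
qed

lemma squash_1: "z \<in> quadric (insert k A) B C 0 \<Longrightarrow> squash (1, z) = z"
proof
  fix i assume z: "z \<in> quadric (insert k A) B C 0"
  show "squash (1, z) i = z i"
    using ratio_1[of z i] z by (cases "z i = 0") (auto simp: squash_def)
qed

text \<open>If the coordinates in \<open>A\<close> and \<open>C\<close> all vanished, the equation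
  of the cone would make those in \<open>B\<close> vanish too, leaving only the excluded
  apex.\<close>

lemma target_subset_source: "target \<subseteq> source"
proof
  fix z assume z: "z \<in> target"
  then have zk: "z k = 0" using disjoint by (auto simp: quadric_def cspace_def)
  have "\<exists>i\<in>A \<union> C. z i \<noteq> 0"
  proof (rule ccontr)
    assume *: "\<not> ?thesis"
    then have "sqn A z = 0" by (simp add: sqn_def)
    then have "sqn B z = 0" using z by (simp add: quadric_def)
    then have "z i = 0" for i
      using * z finite by (cases "i \<in> A \<union> B \<union> C") (auto simp: sqn_eq_0 quadric_def cspace_def)
    then show False using z by (auto simp: quadric_def)
  qed
  moreover have "z \<in> quadric (insert k A) B C 0"
    using z zk finite disjoint by (auto simp: quadric_def cspace_def sqn_insert)
  ultimately show "z \<in> source" by blast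
qed

lemma squash_0_target: "z \<in> target \<Longrightarrow> squash (0, z) = z"
proof
  fix i assume z: "z \<in> target"
  have zk: "z k = 0" using z disjoint by (auto simp: quadric_def cspace_def)
  have "ratio (0, z) = ratio (1, z)" by (simp add: ratio_def zk)
  moreover have "z \<in> quadric (insert k A) B C 0" using z target_subset_source by auto
  ultimately show "squash (0, z) i = z i"
    using ratio_1[of z i] zk by (cases "z i = 0") (auto simp: squash_def)
qed

lemma sqn_squash:
  assumes z: "z \<in> quadric (insert k A) B C 0"
  shows "sqn A (squash (t, z)) = sqn A z"
    "sqn B (squash (t, z)) = sqn A z + t\<^sup>2 * (cmod (z k))\<^sup>2"
proof -
  show "sqn A (squash (t, z)) = sqn A z"
    by (rule sqn_cong) (use disjoint in \<open>auto simp: squash_def\<close>)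
  have "sqn B (squash (t, z)) = (ratio (t, z))\<^sup>2 * sqn B z"
  proof (rule sqn_scale)
    fix i assume "i \<in> B"
    moreover have "0 \<le> ratio (t, z)" by (simp add: ratio_def sqn_nonneg)
    ultimately show "cmod (squash (t, z) i) = ratio (t, z) * cmod (z i)"
      using disjoint by (auto simp: squash_def norm_mult)
  qed
  then show "sqn B (squash (t, z)) = sqn A z + t\<^sup>2 * (cmod (z k))\<^sup>2"
    using quadric_insert[OF z] ratio_sq by simp
qed

lemma squash_in:
  assumes z: "z \<in> source"
  shows "squash (t, z) \<in> source" "squash (0, z) \<in> target"
proof -
  have zq: "z \<in> quadric (insert k A) B C 0" using z by simp
  obtain i where i: "i \<in> A \<union> C" "z i \<noteq> 0" using z by auto
  \<comment> \<open>Coordinates in \<open>A\<close> and \<open>C\<close> are not moved, so a nonzero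
    one among them keeps the image off the apex at every time, including 0.\<close>
  then have i': "squash (t, z) i \<noteq> 0" for t using disjoint by (auto simp: squash_def)
  have nz: "squash (t, z) \<noteq> (\<lambda>_. 0)" for t using i'[of t] by (auto simp: fun_eq_iff)
  have c: "squash (t, z) \<in> cspace (insert k A \<union> B \<union> C)" for t
    using zq by (auto simp: quadric_def cspace_def squash_def)
  moreover have "squash (0, z) k = 0" by (simp add: squash_def)
  ultimately have c0: "squash (0, z) \<in> cspace (A \<union> B \<union> C)"
    by (auto simp: cspace_def) (metis)
  have "sqn (insert k A) (squash (t, z)) = t\<^sup>2 * (cmod (z k))\<^sup>2 + sqn A z"
    using sqn_squash[OF zq] finite disjoint by (simp add: sqn_insert) (simp add: squash_def norm_mult power_mult_distrib)
  then show "squash (t, z) \<in> source"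
    using c nz i' i(1) sqn_squash[OF zq] by (auto simp: quadric_def)
  show "squash (0, z) \<in> target"
    using c0 nz sqn_squash[OF zq, of 0] by (auto simp: quadric_def)
qed

text \<open>Only the coordinates in \<open>B\<close> are delicate. On the cone the denominator of
  \<open>ratio\<close> equals \<open>sqn B\<close>, so it is nonzero wherever one of them is; at
  their zeros the bound of \<open>ratio\<close> by 1 suffices.\<close>

lemma continuous_on_squash: "continuous_on ({0..1} \<times> source) squash"
proof (rule continuous_on_coordinatewise_then_product)
  fix i
  show "continuous_on ({0..1} \<times> source) (\<lambda>p. squash p i)"
  proof (cases "i = k \<or> i \<notin> B")
    case True
    then show ?thesis
      unfolding squash_def by (cases "i = k") (auto intro!: continuous_intros)
  next
    case False
    then have i: "i \<noteq> k" "i \<in> B" by auto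
    have "continuous_on ({0..1} \<times> source) (\<lambda>p. of_real (ratio p) * snd p i)"
    proof (rule continuous_on_bounded_mult)
      have "continuous_on {p \<in> {0..1} \<times> source. snd p i \<noteq> 0}
         (\<lambda>p. sqrt ((sqn A (snd p) + (fst p)\<^sup>2 * (cmod (snd p k))\<^sup>2) / (sqn A (snd p) + (cmod (snd p k))\<^sup>2)))"
      proof (intro continuous_intros ballI)
        fix p assume "p \<in> {p \<in> {0..1::real} \<times> source. snd p i \<noteq> 0}"
        then have "0 < sqn B (snd p)" "snd p \<in> quadric (insert k A) B C 0" using i finite by (auto simp: sqn_pos)
        then show "sqn A (snd p) + (cmod (snd p k))\<^sup>2 \<noteq> 0" using quadric_insert by simp
      qed
      then show "continuous_on {p \<in> {0..1} \<times> source. snd p i \<noteq> 0} ratio"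
        by (rule continuous_on_eq) (simp add: ratio_def)
      show "\<bar>ratio p\<bar> \<le> 1" if "p \<in> {0..1} \<times> source" for p
        using that ratio_bounds[of "fst p" "snd p"] by auto
    qed (intro continuous_intros)
    then show ?thesis unfolding squash_def using i by simp
  qed
qed

lemma homotopy_equivalent_source_target:
  "top_of_set (outer ` source) homotopy_equivalent_space top_of_set (outer ` target)"
proof (rule homotopy_equivalent_orbit_spaces[where f = "\<lambda>z. squash (0, z)" and g = "\<lambda>z. z" and h = squash])
  show "circle_invariant source"
    by (intro circle_invariant_coordinates circle_invariant_quadric)
  show "circle_invariant target" by (rule circle_invariant_quadric)
  show "continuous_on source (\<lambda>z. squash (0, z))"
    by (rule continuous_on_compose2[OF continuous_on_squash]) (auto simp: continuous_on_Pair_const)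
  show "continuous_on ({0..1} \<times> source) squash" by (rule continuous_on_squash)
qed (use squash_in squash_rot squash_1 squash_0_target target_subset_source in \<open>auto simp: image_subset_iff\<close>)

end

section \<open>Homology of the zero level\<close>

lemma homeomorphism_Times:
  assumes "homeomorphism X X' f f'" "homeomorphism Y Y' g g'"
  shows "homeomorphism (X \<times> Y) (X' \<times> Y') (map_prod f g) (map_prod f' g')"
proof (rule homeomorphismI)
  show "continuous_on (X \<times> Y) (map_prod f g)" "continuous_on (X' \<times> Y') (map_prod f' g')"
    unfolding map_prod_def case_prod_unfold
    using assms by (auto simp: homeomorphism_def intro!: continuous_on_Pair
        continuous_on_compose2[of X f _ fst] continuous_on_compose2[of Y g _ snd]
        continuous_on_compose2[of X' f' _ fst] continuous_on_compose2[of Y' g' _ snd]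
        continuous_on_fst continuous_on_snd continuous_on_id)
qed (use assms in \<open>auto simp: homeomorphism_def\<close>)

section \<open>Relative homology of adding one coordinate\<close>

context disjoint_index_sets
begin

abbreviation "whole \<equiv> quadric (insert k A) B C 0"
text \<open>Together with \<open>source\<close> this covers \<open>whole\<close>: a point with
  vanishing coordinate \<open>k\<close> lies in \<open>target\<close>.\<close>

abbreviation "patch \<equiv> {z \<in> whole. z k \<noteq> 0}"

text \<open>Both components are invariant under rotation, but only the first is divided by the
  modulus of \<open>z k\<close> as well. This makes the image a full product: the first component
  ranges over a vector space, and the second over the nonzero vectors, because on the cone
  \<open>sqn B\<close> is at least the squared modulus of \<open>z k\<close>.\<close>

definition chart :: "(nat \<Rightarrow> complex) \<Rightarrow> (nat \<Rightarrow> complex) \<times> (nat \<Rightarrow> complex)" where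
  "chart z = (\<lambda>i. if i \<in> A \<union> C then z i / z k else 0,
              \<lambda>i. if i \<in> B then z i * cnj (z k) / of_real (cmod (z k)) else 0)"

text \<open>The modulus of the lost coordinate \<open>k\<close>: the solution \<open>r\<close> of
  \<open>r\<^sup>2 * (1 + sqn A y) = sqn B w\<close>, which is the equation of the cone with
  \<open>r\<close> factored out of the coordinates in \<open>A\<close> and \<open>k\<close>.\<close>

definition unchart_scale :: "(nat \<Rightarrow> complex) \<times> (nat \<Rightarrow> complex) \<Rightarrow> real" where
  "unchart_scale p = sqrt (sqn B (snd p)) / sqrt (1 + sqn A (fst p))"

definition unchart :: "(nat \<Rightarrow> complex) \<times> (nat \<Rightarrow> complex) \<Rightarrow> nat \<Rightarrow> complex" where
  "unchart p = (\<lambda>i. if i = k then of_real (unchart_scale p) else if i \<in> B then snd p i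
     else of_real (unchart_scale p) * fst p i)"

lemma one_plus_sqn_pos: "0 < 1 + sqn A y"
  using sqn_nonneg[of A y] by simp

lemma homeomorphism_chart:
  "homeomorphism (outer ` patch) (cspace (A \<union> C) \<times> (cspace B - {\<lambda>_. 0}))
     (\<lambda>h. chart (representative h)) (\<lambda>p. outer (unchart p))"
  and chart_representative: "\<And>z. z \<in> patch \<Longrightarrow> chart (representative (outer z)) = chart z"
proof -
  let ?Y = "cspace (A \<union> C) \<times> (cspace B - {\<lambda>_. 0})"
  have inv: "circle_invariant patch"
    by (intro circle_invariant_coordinates circle_invariant_quadric)
  have cont: "continuous_on patch chart"
    unfolding chart_def
  proof (intro continuous_on_Pair continuous_on_coordinatewise_then_product)
    fix i
    show "continuous_on patch (\<lambda>z. if i \<in> A \<union> C then z i / z k else 0)"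
      by (cases "i \<in> A \<union> C") (simp_all add: continuous_on_divide continuous_on_coord)
    have "continuous_on patch (\<lambda>z. z i * cnj (z k) / of_real (cmod (z k)))"
      by (intro continuous_intros) auto
    then show "continuous_on patch (\<lambda>z. if i \<in> B then z i * cnj (z k) / of_real (cmod (z k)) else 0)"
      by (cases "i \<in> B") simp_all
  qed
  have im: "chart ` patch \<subseteq> ?Y"
  proof (rule image_subsetI)
    fix z assume z: "z \<in> patch"
    then have "0 < sqn B z" using quadric_insert[of z] sqn_nonneg[of A z]
      by (simp add: add_nonneg_pos)
    then obtain i where "i \<in> B" "z i \<noteq> 0" using finite by (auto simp: sqn_pos)
    then have "snd (chart z) i \<noteq> 0" using z by (simp add: chart_def)
    then have "snd (chart z) \<noteq> (\<lambda>_. 0)" by auto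
    then show "chart z \<in> ?Y"
      by (auto simp: mem_Times_iff cspace_def chart_def)
  qed
  have rotc: "chart (rot c z) = chart z" if "cmod c = 1" for c z
  proof -
    have "c * cnj c = 1" using that by (simp add: complex_norm_square[symmetric])
    moreover have "c \<noteq> 0" using that by auto
    ultimately show ?thesis
      using that by (simp add: chart_def rot_def norm_mult fun_eq_iff mult_ac
          flip: mult.assoc[of c "cnj c"])
  qed
  have pos: "0 < unchart_scale p" if "p \<in> ?Y" for p
  proof -
    have "\<exists>i\<in>B. snd p i \<noteq> 0"
    proof (rule ccontr)
      assume "\<not> ?thesis"
      then have "snd p i = 0" for i using that by (cases "i \<in> B") (auto simp: cspace_def)
      then show False using that by auto
    qed
    then show ?thesis using finite one_plus_sqn_pos by (simp add: unchart_scale_def sqn_pos)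
  qed
  have contg: "continuous_on ?Y unchart"
  proof (rule continuous_on_coordinatewise_then_product)
    have r: "continuous_on ?Y unchart_scale"
      unfolding unchart_scale_def
      by (intro continuous_intros) (metis less_irrefl one_plus_sqn_pos real_sqrt_gt_zero)
    fix i show "continuous_on ?Y (\<lambda>p. unchart p i)"
      unfolding unchart_def
      by (cases "i = k"; cases "i \<in> B") (auto intro!: continuous_intros r)
  qed
  have img: "unchart ` ?Y \<subseteq> patch"
  proof (rule image_subsetI)
    fix p assume p: "p \<in> ?Y"
    have r: "(unchart_scale p)\<^sup>2 * (1 + sqn A (fst p)) = sqn B (snd p)"
      using one_plus_sqn_pos[of "fst p"] sqn_nonneg[of B "snd p"]
      by (simp add: unchart_scale_def power_divide)
    have "sqn A (unchart p) = (unchart_scale p)\<^sup>2 * sqn A (fst p)"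
    proof (rule sqn_scale)
      fix i assume "i \<in> A"
      moreover have "i \<notin> B" "i \<noteq> k" using disjoint \<open>i \<in> A\<close> by auto
      ultimately show "cmod (unchart p i) = unchart_scale p * cmod (fst p i)"
        using pos[OF p] by (simp add: unchart_def norm_mult)
    qed
    moreover have "sqn B (unchart p) = sqn B (snd p)"
      by (rule sqn_cong) (use disjoint in \<open>auto simp: unchart_def\<close>)
    moreover have k: "unchart p k = of_real (unchart_scale p)" by (simp add: unchart_def)
    ultimately have "sqn (insert k A) (unchart p) = sqn B (unchart p)"
      using r finite disjoint by (simp add: sqn_insert algebra_simps)
    moreover have "unchart p \<in> cspace (insert k A \<union> B \<union> C)"
      using p by (auto simp: cspace_def unchart_def)
    moreover have "unchart p k \<noteq> 0" using pos[OF p] by (simp add: k)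
    ultimately show "unchart p \<in> patch"
      by (auto simp: quadric_def)
  qed
  have fg: "chart (unchart p) = p" if p: "p \<in> ?Y" for p
  proof (rule prod_eqI; rule ext)
    fix i
    show "fst (chart (unchart p)) i = fst p i"
      using p pos[OF p] disjoint by (auto simp: chart_def unchart_def cspace_def)
    show "snd (chart (unchart p)) i = snd p i"
      using p pos[OF p] disjoint by (auto simp: chart_def unchart_def cspace_def)
  qed
  have gf: "\<exists>c. cmod c = 1 \<and> unchart (chart z) = rot c z" if z: "z \<in> patch" for z
  proof (intro exI conjI)
    let ?c = "cnj (z k) / of_real (cmod (z k))"
    have zk: "z k \<noteq> 0" using z by simp
    show c: "cmod ?c = 1" using cmod_phase[OF zk] .
    have "sqn B (snd (chart z)) = sqn B z"
      by (rule sqn_cong) (use zk in \<open>simp add: chart_def norm_mult norm_divide\<close>)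
    moreover have "sqn A (fst (chart z)) = (1 / cmod (z k))\<^sup>2 * sqn A z"
      by (rule sqn_scale) (simp add: chart_def norm_divide)
    then have "1 + sqn A (fst (chart z)) = (sqn A z + (cmod (z k))\<^sup>2) / (cmod (z k))\<^sup>2"
      using zk by (simp add: field_simps)
    moreover have "0 < sqn B z" using z zk quadric_insert[of z] sqn_nonneg[of A z]
      by (simp add: add_nonneg_pos)
    ultimately have s: "unchart_scale (chart z) = cmod (z k)"
      using quadric_insert[of z] z by (simp add: unchart_scale_def real_sqrt_divide)
    have kk: "z k * cnj (z k) = of_real (cmod (z k)) * of_real (cmod (z k))"
      by (metis complex_norm_square of_real_mult power2_eq_square)
    show "unchart (chart z) = rot ?c z"
    proof
      fix i
      consider "i = k" | "i \<in> B" "i \<noteq> k" | "i \<in> A \<union> C" "i \<notin> B" "i \<noteq> k" | "i \<notin> A \<union> C" "i \<notin> B" "i \<noteq> k" by blast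
      then show "unchart (chart z) i = rot ?c z i"
      proof cases
        case 1
        then show ?thesis using s kk zk by (simp add: unchart_def rot_def mult.commute)
      next
        case 2
        then show ?thesis by (simp add: unchart_def rot_def chart_def mult.commute)
      next
        case 3
        then show ?thesis using s kk zk by (simp add: unchart_def rot_def chart_def field_simps)
      next
        case 4
        then show ?thesis using z by (simp add: unchart_def rot_def chart_def quadric_def cspace_def)
      qed
    qed
  qed
  from homeomorphism_orbit_space[OF inv cont im rotc contg img fg gf]
  show "homeomorphism (outer ` patch) ?Y (\<lambda>h. chart (representative h)) (\<lambda>p. outer (unchart p))"
    "\<And>z. z \<in> patch \<Longrightarrow> chart (representative (outer z)) = chart z"
    by auto
qed

lemma chart_source_iff: "z \<in> patch \<Longrightarrow> z \<in> source \<longleftrightarrow> fst (chart z) \<noteq> (\<lambda>_. 0)"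
  by (auto simp: chart_def fun_eq_iff)

lemma chart_image: "(\<lambda>h. chart (representative h)) ` outer ` (patch \<inter> source)
    = (cspace (A \<union> C) - {\<lambda>_. 0}) \<times> (cspace B - {\<lambda>_. 0})"
proof -
  let ?Y = "cspace (A \<union> C) \<times> (cspace B - {\<lambda>_. 0})"
  have "chart ` patch = ?Y"
  proof -
    have "(\<lambda>h. chart (representative h)) ` outer ` patch = ?Y"
      using homeomorphism_chart by (rule homeomorphism_image1)
    then show ?thesis using chart_representative by (simp add: image_image)
  qed
  moreover have "(\<lambda>h. chart (representative h)) ` outer ` (patch \<inter> source) = chart ` (patch \<inter> source)"
    using chart_representative by (simp add: image_image)
  moreover have "chart ` (patch \<inter> source) = chart ` patch \<inter> {p. fst p \<noteq> (\<lambda>_. 0)}"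
  proof -
    have "patch \<inter> source = {z \<in> patch. fst (chart z) \<noteq> (\<lambda>_. 0)}"
    proof (rule Set.set_eqI)
      fix z show "z \<in> patch \<inter> source \<longleftrightarrow> z \<in> {z \<in> patch. fst (chart z) \<noteq> (\<lambda>_. 0)}"
        using chart_source_iff[of z] by blast
    qed
    then show ?thesis by (simp only:) blast
  qed
  ultimately show ?thesis by auto
qed

text \<open>Excision of the points with vanishing coordinate \<open>k\<close>. They form a closed
  set, and it is contained in the open set \<open>source\<close> because they all lie in
  \<open>target\<close>.\<close>

lemma isomorphic_relative_homology_patch:
  "relative_homology_group p (top_of_set (outer ` whole)) (outer ` source)
   \<cong> relative_homology_group p (top_of_set (outer ` patch)) (outer ` (patch \<inter> source))"
proof -
  let ?S = "outer ` whole" and ?T = "outer ` source" and ?E = "outer ` whole - outer ` patch"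
  have inv: "circle_invariant whole" "circle_invariant patch" "circle_invariant source"
    by (intro circle_invariant_coordinates circle_invariant_quadric)+
  have E: "closedin (top_of_set ?S) ?E"
    using openin_outer_coordinates(1)[OF inv(1), of k] by (simp add: closedin_diff openin_closedin_eq)
  have T: "openin (top_of_set ?S) ?T"
    using openin_outer_coordinates(2)[OF inv(1), of "A \<union> C"] .
  have ET: "?E \<subseteq> ?T"
  proof
    fix h assume "h \<in> ?E"
    then obtain z where z: "z \<in> whole" "h = outer z" "z k = 0" by auto
    have "z \<in> target"
      using z finite disjoint by (auto simp: quadric_def cspace_def sqn_insert)
    then show "h \<in> ?T" using z target_subset_source by auto
  qed
  have "hom_induced p (subtopology (top_of_set ?S) (?S - ?E)) (?T - ?E)
       (subtopology (top_of_set ?S) ?S) ?T id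
     \<in> iso (relative_homology_group p (subtopology (top_of_set ?S) (?S - ?E)) (?T - ?E))
           (relative_homology_group p (subtopology (top_of_set ?S) ?S) ?T)"
  proof (rule homology_excision_axiom)
    show "top_of_set ?S closure_of ?E \<subseteq> top_of_set ?S interior_of ?T"
      using E T ET by (simp add: closure_of_closedin interior_of_openin)
  qed auto
  moreover have SE: "?S - ?E = outer ` patch" by auto
  moreover have TE: "?T - ?E = outer ` (patch \<inter> source)"
    using outer_in_image_iff[OF inv(2)] outer_in_image_iff[OF inv(3)] by auto
  moreover have "subtopology (top_of_set ?S) ?S = top_of_set ?S"
    by (simp add: subtopology_subtopology)
  moreover have "subtopology (top_of_set ?S) (outer ` patch) = top_of_set (outer ` patch)"
    by (simp add: subtopology_subtopology Int_absorb1 image_mono)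
  ultimately have "relative_homology_group p (top_of_set (outer ` patch)) (outer ` (patch \<inter> source))
     \<cong> relative_homology_group p (top_of_set ?S) ?T"
    by (simp only: is_isoI)
  then show ?thesis by (rule group.iso_sym[OF group_relative_homology_group])
qed

text \<open>In the chart the pair becomes a Euclidean space and its complement of the origin, times
  the punctured space of the coordinates in \<open>B\<close>. The Thom isomorphism shifts the
  homology of the latter, a sphere of dimension \<open>2 * card B - 1\<close> up to homotopy, by
  \<open>2 * card (A \<union> C)\<close>.\<close>

proposition relative_homology_whole_source:
  assumes "B \<noteq> {}"
  shows "Z_or_trivial (p = 2 * int (card (A \<union> C)) \<or> p = 2 * int (card (A \<union> C)) + 2 * int (card B) - 1)
     (relative_homology_group p (top_of_set (outer ` whole)) (outer ` source))"
proof -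
  let ?d = "card (A \<union> C)" and ?b = "card B"
  have "finite (A \<union> C)" using finite by simp
  then obtain \<beta> where \<beta>: "bij_betw \<beta> {..<?d} (A \<union> C)" by (rule obtain_enumeration)
  obtain \<beta>' where \<beta>': "bij_betw \<beta>' {..<?b} B" using finite(2) by (rule obtain_enumeration)
  let ?R = "rspace (2 * ?d)" and ?W = "rspace (2 * ?b) - {\<lambda>_. 0}"
  have pd: "realify \<beta> ?d ` (cspace (A \<union> C) - {\<lambda>_. 0}) = ?R - {\<lambda>_. 0}"
    using homeomorphism_image1[OF homeomorphism_realify[OF \<beta>]] realify_eq_0_iff[OF \<beta>]
    by (auto simp: set_eq_iff image_iff)
  have pb: "realify \<beta>' ?b ` (cspace B - {\<lambda>_. 0}) = ?W"
    using homeomorphism_image1[OF homeomorphism_realify[OF \<beta>']] realify_eq_0_iff[OF \<beta>']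
    by (auto simp: set_eq_iff image_iff)
  have hb: "homeomorphism (cspace B - {\<lambda>_. 0}) ?W (realify \<beta>' ?b) (complexify \<beta>' ?b)"
    by (rule homeomorphism_of_subsets[OF homeomorphism_realify[OF \<beta>'] _ _ pb]) auto
  note hom = homeomorphism_compose[OF homeomorphism_chart
      homeomorphism_Times[OF homeomorphism_realify[OF \<beta>] hb]]
  have "relative_homology_group p (top_of_set (outer ` patch)) (outer ` (patch \<inter> source))
     \<cong> relative_homology_group p (top_of_set (?R \<times> ?W)) ((?R - {\<lambda>_. 0}) \<times> ?W)"
  proof (rule isomorphic_relative_homology_homeomorphism[OF hom])
    show "(map_prod (realify \<beta> ?d) (realify \<beta>' ?b) \<circ> (\<lambda>h. chart (representative h))) ` outer ` (patch \<inter> source)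
       = (?R - {\<lambda>_. 0}) \<times> ?W"
      unfolding image_comp[symmetric] chart_image map_prod_image pd pb ..
  qed auto
  also have "\<dots> \<cong> homology_group (p - int (2 * ?d)) (top_of_set ?W)"
    by (rule relative_homology_Thom)
  finally have "relative_homology_group p (top_of_set (outer ` whole)) (outer ` source)
      \<cong> homology_group (p - int (2 * ?d)) (top_of_set ?W)"
    using isomorphic_relative_homology_patch iso_trans by blast
  moreover have "2 * ?b \<ge> 2" using assms finite by (simp add: Suc_le_eq card_gt_0_iff)
  then have "Z_or_trivial (p - int (2 * ?d) = 0 \<or> p - int (2 * ?d) = int (2 * ?b) - 1)
     (homology_group (p - int (2 * ?d)) (top_of_set ?W))"
    by (rule homology_punctured_rspace)
  ultimately have "Z_or_trivial (p - int (2 * ?d) = 0 \<or> p - int (2 * ?d) = int (2 * ?b) - 1)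
     (relative_homology_group p (top_of_set (outer ` whole)) (outer ` source))"
    by (rule Z_or_trivial_iso) auto
  moreover have "(p - int (2 * ?d) = 0 \<or> p - int (2 * ?d) = int (2 * ?b) - 1)
     \<longleftrightarrow> (p = 2 * int ?d \<or> p = 2 * int ?d + 2 * int ?b - 1)" by auto
  ultimately show ?thesis by simp
qed

end

lemma homology_half_line: "Z_or_trivial (p = 0) (homology_group p (top_of_set {0::real<..}))"
proof -
  have pos: "0 < 1 - t + t * x" if "0 \<le> t" "t \<le> 1" "0 < x" for t x :: real
    using that by (cases "t = 0") (auto intro!: add_nonneg_pos)
  have "homology_group p (top_of_set {0::real<..}) \<cong> homology_group p (top_of_set {0::real})"
    by (rule isomorphic_homology_homotopy_equivalence[where f = "\<lambda>_. 0" and g = "\<lambda>_. 1"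
          and h = "\<lambda>(t, x). 1 - t + t * x" and k = snd])
       (auto intro!: continuous_intros simp: case_prod_unfold pos)
  then show ?thesis
    by (rule Z_or_trivial_iso) (use homology_unit in auto)
qed

text \<open>For \<open>c = 0\<close> and \<open>1 \<le> a \<le> b\<close> the cone, modulo scaling
  and rotation, is a bundle with fibre the sphere of dimension \<open>2 * b - 1\<close> over the
  complex projective space of dimension \<open>a - 1\<close>; the even degrees are those of the
  base, the odd ones those of the base shifted by the fibre.\<close>

definition quadric_degrees :: "nat \<Rightarrow> nat \<Rightarrow> nat \<Rightarrow> int \<Rightarrow> bool" where
  "quadric_degrees a b c j \<longleftrightarrow>
     even j \<and> 0 \<le> j \<and> j \<le> 2 * int a - 2 + 2 * int c \<or>
     odd j \<and> 2 * int b - 1 + 2 * int c \<le> j \<and> j \<le> 2 * int a + 2 * int b - 3 + 2 * int c"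

text \<open>Both runs of degrees advance at their upper end by one step of length 2, and these two
  new degrees are those of the relative homology.\<close>

lemma quadric_degrees_Suc:
  assumes "a < b"
  shows "quadric_degrees (Suc a) b c j \<longleftrightarrow> quadric_degrees a b c j \<or>
     j = 2 * int (a + c) \<or> j = 2 * int (a + c) + 2 * int b - 1"
proof (cases "even j")
  case True
  then obtain m where j: "j = 2 * m" by (elim evenE)
  have "2 * m \<noteq> 2 * int (a + c) + 2 * int b - 1" by presburger
  moreover have "2 * m \<le> 2 * (x + 1) - 2 + 2 * y \<longleftrightarrow> 2 * m \<le> 2 * x - 2 + 2 * y \<or> 2 * m = 2 * (x + y)"
    for x y :: int by presburger
  from this[of "int a" "int c"] have "2 * m \<le> 2 * int (Suc a) - 2 + 2 * int c \<longleftrightarrow>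
      2 * m \<le> 2 * int a - 2 + 2 * int c \<or> 2 * m = 2 * int (a + c)" by simp
  ultimately show ?thesis
    using j unfolding quadric_degrees_def by auto
next
  case False
  then obtain m where j: "j = 2 * m + 1" by (elim oddE)
  have "2 * m + 1 \<noteq> 2 * int (a + c)" by presburger
  moreover have "2 * m + 1 \<le> 2 * (x + 1) + 2 * y - 3 + 2 * z \<longleftrightarrow>
      2 * m + 1 \<le> 2 * x + 2 * y - 3 + 2 * z \<or> 2 * m + 1 = 2 * (x + z) + 2 * y - 1"
    for x y z :: int by presburger
  from this[of "int a" "int b" "int c"] have "2 * m + 1 \<le> 2 * int (Suc a) + 2 * int b - 3 + 2 * int c \<longleftrightarrow>
      2 * m + 1 \<le> 2 * int a + 2 * int b - 3 + 2 * int c \<or> 2 * m + 1 = 2 * int (a + c) + 2 * int b - 1"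
    by simp
  moreover have "2 * int b - 1 + 2 * int c \<le> 2 * int (a + c) + 2 * int b - 1" by simp
  ultimately show ?thesis
    using j unfolding quadric_degrees_def by auto
qed

text \<open>Each new degree exceeds all old ones of its parity. The predecessor of the new even
  degree is \<open>2 * (a + c) - 1\<close>, which lies below the old odd run exactly because
  \<open>a < b\<close>; the predecessor of the new odd degree lies above the old even run.\<close>

lemma quadric_degrees_separated:
  assumes "a < b" and j: "j = 2 * int (a + c) \<or> j = 2 * int (a + c) + 2 * int b - 1"
  shows "\<not> quadric_degrees a b c j \<and> \<not> quadric_degrees a b c (j - 1)"
  using j
proof
  assume "j = 2 * int (a + c)"
  then show ?thesis using assms(1) by (simp add: quadric_degrees_def)
next
  assume "j = 2 * int (a + c) + 2 * int b - 1"
  then show ?thesis using assms(1) by (simp add: quadric_degrees_def)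
qed

text \<open>Without positive coordinates the equation forces those in \<open>B\<close> to vanish.
  What remains is empty, or a punctured complex line whose orbits are classified by the modulus and
  form an open half line.\<close>

lemma homology_quadric_empty:
  assumes "finite B" "finite C" "B \<inter> C = {}" "card C \<le> 1"
  shows "Z_or_trivial (quadric_degrees 0 (card B) (card C) j)
           (homology_group j (top_of_set (outer ` quadric {} B C 0)))"
proof (cases "C = {}")
  case True
  have "quadric {} B C 0 = {}"
  proof (rule ccontr)
    assume "quadric {} B C 0 \<noteq> {}"
    then obtain z where z: "z \<in> quadric {} B C 0" by blast
    then have "sqn B z = 0" "z \<in> cspace B" by (auto simp: quadric_def sqn_def True)
    then have "z = (\<lambda>_. 0)" using assms(1) by (auto simp: sqn_eq_0 cspace_def)
    then show False using z by (simp add: quadric_def)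
  qed
  moreover have "\<not> quadric_degrees 0 (card B) (card C) j"
    using True by (auto simp: quadric_degrees_def)
  ultimately show ?thesis
    by (simp add: Z_or_trivial_def trivial_homology_group_empty)
next
  case False
  then have "card C \<noteq> 0" using assms(2) by simp
  then have "card C = 1" using assms(4) by linarith
  then obtain w where C: "C = {w}" by (auto simp: card_1_singleton_iff)
  have deg: "quadric_degrees 0 (card B) (card C) j \<longleftrightarrow> j = 0"
  proof (cases "even j")
    case False
    then have "j \<noteq> 0" by auto
    then show ?thesis using \<open>card C = 1\<close> False by (simp add: quadric_degrees_def)
  qed (use \<open>card C = 1\<close> in \<open>auto simp: quadric_degrees_def\<close>)
  have wB: "w \<notin> B" using assms C by auto
  have q: "z i = 0" if "z \<in> quadric {} B C 0" "i \<noteq> w" for z i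
  proof (cases "i \<in> B")
    case True
    have "sqn B z = 0" using that by (simp add: quadric_def sqn_def)
    then show ?thesis using True assms by (simp add: sqn_eq_0)
  next
    case False
    then show ?thesis using that C by (auto simp: quadric_def cspace_def)
  qed
  have qw: "z w \<noteq> 0" if "z \<in> quadric {} B C 0" for z
  proof
    assume "z w = 0"
    then have "z i = 0" for i using q[OF that] by (cases "i = w") auto
    then show False using that by (auto simp: quadric_def)
  qed
  let ?g = "\<lambda>r::real. \<lambda>i. if i = w then complex_of_real r else 0"
  have hom: "homeomorphism (outer ` quadric {} B C 0) {0<..}
     (\<lambda>h. cmod (representative h w)) (\<lambda>r. outer (?g r))"
  proof (rule homeomorphism_orbit_space(1)[where f = "\<lambda>z. cmod (z w)"])
    show "circle_invariant (quadric {} B C 0)" by (rule circle_invariant_quadric)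
    show "continuous_on (quadric {} B C 0) (\<lambda>z. cmod (z w))" by (intro continuous_intros)
    show "continuous_on {0<..} ?g"
    proof (rule continuous_on_coordinatewise_then_product)
      fix i show "continuous_on {0<..} (\<lambda>r. if i = w then complex_of_real r else 0)"
        by (cases "i = w") (auto intro!: continuous_intros)
    qed
    show "?g ` {0<..} \<subseteq> quadric {} B C 0"
    proof (rule image_subsetI)
      fix r :: real assume r: "r \<in> {0<..}"
      have "sqn B (?g r) = 0" using wB by (auto simp: sqn_def intro!: sum.neutral)
      moreover have "?g r w \<noteq> 0" using r by simp
      then have "?g r \<noteq> (\<lambda>_. 0)" by (metis)
      ultimately show "?g r \<in> quadric {} B C 0"
        using C by (auto simp: quadric_def cspace_def sqn_def)
    qed
    show "\<exists>c. cmod c = 1 \<and> ?g (cmod (z w)) = rot c z" if z: "z \<in> quadric {} B C 0" for z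
    proof (intro exI conjI)
      show "cmod (cnj (z w) / of_real (cmod (z w))) = 1" using cmod_phase[OF qw[OF z]] .
      have "z w * cnj (z w) = of_real (cmod (z w)) * of_real (cmod (z w))"
        by (metis complex_norm_square of_real_mult power2_eq_square)
      then show "?g (cmod (z w)) = rot (cnj (z w) / of_real (cmod (z w))) z"
        using q[OF z] qw[OF z] by (auto simp: rot_def fun_eq_iff mult.commute)
    qed
  qed (use qw in \<open>auto simp: rot_def norm_mult\<close>)
  have "homology_group j (top_of_set (outer ` quadric {} B C 0)) \<cong> homology_group j (top_of_set {0::real<..})"
    by (rule isomorphic_relative_homology_homeomorphism[OF hom]) auto
  then show ?thesis
    by (rule Z_or_trivial_iso) (use homology_half_line[of j] deg in auto)
qed

theorem homology_quadric:
  assumes "finite A" "finite B" "finite C" "A \<inter> B = {}" "A \<inter> C = {}" "B \<inter> C = {}"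
    and "card A \<le> card B" "card C \<le> 1" "B \<noteq> {}"
  shows "Z_or_trivial (quadric_degrees (card A) (card B) (card C) j)
           (homology_group j (top_of_set (outer ` quadric A B C 0)))"
  using assms
proof (induction A arbitrary: j rule: finite_induct)
  case empty
  then show ?case using homology_quadric_empty by auto
next
  case (insert k A)
  interpret disjoint_index_sets A B C k
    by unfold_locales (use insert in auto)
  have IH: "Z_or_trivial (quadric_degrees (card A) (card B) (card C) j)
      (homology_group j (top_of_set (outer ` quadric A B C 0)))" for j
    using insert.IH insert.prems insert.hyps by auto
  let ?X = "top_of_set (outer ` quadric (insert k A) B C 0)"
  let ?r = "\<lambda>j. j = 2 * int (card (A \<union> C)) \<or> j = 2 * int (card (A \<union> C)) + 2 * int (card B) - 1"
  have AC: "card (A \<union> C) = card A + card C"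
    using finite disjoint by (simp add: card_Un_disjoint)
  have sub: "subtopology ?X (outer ` source) = top_of_set (outer ` source)"
    by (simp add: subtopology_subtopology Int_absorb1 image_mono)
  \<comment> \<open>The coordinate being added is counted in the hypothesis on cardinalities, which
    turns it into the strict inequality needed to separate the degrees.\<close>
  have ab: "card A < card B" using insert by simp
  have "Z_or_trivial (quadric_degrees (card A) (card B) (card C) j \<or> ?r j) (homology_group j ?X)"
  proof (rule homology_separated_degrees)
    fix j
    have "homology_group j (top_of_set (outer ` source)) \<cong> homology_group j (top_of_set (outer ` target))"
      by (rule homotopy_equivalent_space_imp_isomorphic_homology_groups[OF homotopy_equivalent_source_target])
    then show "Z_or_trivial (quadric_degrees (card A) (card B) (card C) j)
        (homology_group j (subtopology ?X (outer ` source)))"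
      unfolding sub by (rule Z_or_trivial_iso) (use IH in auto)
    show "Z_or_trivial (?r j) (relative_homology_group j ?X (outer ` source))"
      by (rule relative_homology_whole_source) (use insert in auto)
    show "\<not> quadric_degrees (card A) (card B) (card C) j \<and> \<not> quadric_degrees (card A) (card B) (card C) (j - 1)"
      if "?r j"
      using quadric_degrees_separated[OF ab] that unfolding AC by blast
  qed
  moreover have "quadric_degrees (card A) (card B) (card C) j \<or> ?r j
     \<longleftrightarrow> quadric_degrees (card (insert k A)) (card B) (card C) j"
    using insert.hyps quadric_degrees_Suc[OF ab] unfolding AC by simp
  ultimately show ?case by simp
qed

section \<open>The nonzero levels\<close>

lemma topological_manifold_homeomorphic:
  assumes "X homeomorphic_space Y" "topological_manifold d Y"
  shows "topological_manifold d X"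
proof -
  obtain f g where fg: "homeomorphic_maps X Y f g"
    using assms(1) by (auto simp: homeomorphic_space_def)
  then have g: "homeomorphic_map Y X g"
    using homeomorphic_maps_map by blast
  show ?thesis
    unfolding topological_manifold_def
  proof (intro conjI ballI)
    show "Hausdorff_space X"
      using assms homeomorphic_Hausdorff_space by (auto simp: topological_manifold_def)
    have "open_map Y X g" "continuous_map Y X g" "g ` topspace Y = topspace X"
      using g by (simp_all add: homeomorphic_imp_open_map homeomorphic_imp_continuous_map homeomorphic_imp_surjective_map)
    then show "second_countable X"
      using assms(2) second_countable_open_map_image unfolding topological_manifold_def by blast
    fix x assume x: "x \<in> topspace X"
    then have "f x \<in> topspace Y" and gfx: "g (f x) = x"
      using fg by (auto simp: homeomorphic_maps_def continuous_map_def)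
    then obtain U V where UV: "openin Y U" "f x \<in> U" "openin (Euclidean_space d) V"
        "subtopology Y U homeomorphic_space subtopology (Euclidean_space d) V"
      using assms(2) unfolding topological_manifold_def by blast
    have UY: "U \<subseteq> topspace Y" by (rule openin_subset[OF UV(1)])
    have gU: "openin X (g ` U)"
      using \<open>open_map Y X g\<close> UV(1) by (simp add: open_map_def)
    have "homeomorphic_map (subtopology Y U) (subtopology X (g ` U)) g"
      by (rule homeomorphic_map_subtopologies[OF g]) (use UY openin_subset[OF gU] in auto)
    then have "subtopology X (g ` U) homeomorphic_space subtopology (Euclidean_space d) V"
      using UV(4) homeomorphic_map_imp_homeomorphic_space homeomorphic_space_sym homeomorphic_space_trans by blast
    moreover have "x \<in> g ` U" using UV(2) gfx by force
    ultimately show "\<exists>U V. openin X U \<and> x \<in> U \<and> openin (Euclidean_space d) V \<and>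
        subtopology X U homeomorphic_space subtopology (Euclidean_space d) V"
      using gU UV(3) by blast
  qed
qed

text \<open>Both properties come from the ambient product space, so the embedding by
  \<open>outer\<close> provides them for every orbit space.\<close>

lemma Hausdorff_second_countable_top_of_set:
  "Hausdorff_space (top_of_set (S :: (nat \<Rightarrow> real) set))" "second_countable (top_of_set S)"
proof -
  show "Hausdorff_space (top_of_set S)"
    by (intro Hausdorff_space_subtopology Hausdorff_space_euclidean)
  obtain \<B> :: "(nat \<Rightarrow> real) set set" where \<B>: "countable \<B>" "\<And>C. C \<in> \<B> \<Longrightarrow> open C"
    "\<And>S. open S \<Longrightarrow> \<exists>U. U \<subseteq> \<B> \<and> S = \<Union>U"
    by (rule univ_second_countable) blast
  then have "second_countable (euclidean :: (nat \<Rightarrow> real) topology)"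
    unfolding second_countable_def open_openin[symmetric]
  proof (intro exI[of _ \<B>] conjI ballI allI impI)
    fix U and x :: "nat \<Rightarrow> real" assume "open U \<and> x \<in> U"
    moreover from this obtain \<U> where "\<U> \<subseteq> \<B>" "U = \<Union>\<U>" using \<B>(3) by blast
    ultimately show "\<exists>V\<in>\<B>. x \<in> V \<and> V \<subseteq> U" by blast
  qed (use \<B> in auto)
  then show "second_countable (top_of_set S)"
    by (rule second_countable_subtopology)
qed

context disjoint_index_sets
begin

text \<open>A slice for the action: coordinate \<open>k\<close> is rotated to be positive and then
  dropped, since the equation of the level recovers it. The other coordinates are restricted only by
  the open condition that the radicand in \<open>hyper_unchart\<close> be positive.\<close>

definition "hyper_chart z = (\<lambda>i. if i \<in> A \<union> B \<union> C then z i * cnj (z k) / of_real (cmod (z k)) else 0)"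

definition "hyper_unchart a y = (\<lambda>i. if i = k then of_real (sqrt (sqn B y + a - sqn A y)) else y i :: complex)"

lemma homeomorphism_hyper_chart:
  "homeomorphism (outer ` {z \<in> quadric (insert k A) B C a. z k \<noteq> 0})
     {y \<in> cspace (A \<union> B \<union> C). sqn A y < sqn B y + a}
     (\<lambda>h. hyper_chart (representative h)) (\<lambda>y. outer (hyper_unchart a y))"
proof -
  let ?P = "{z \<in> quadric (insert k A) B C a. z k \<noteq> 0}"
  let ?D = "A \<union> B \<union> C"
  let ?Y = "{y \<in> cspace ?D. sqn A y < sqn B y + a}"
  have inv: "circle_invariant ?P"
    by (intro circle_invariant_coordinates circle_invariant_quadric)
  have cont: "continuous_on ?P hyper_chart"
    unfolding hyper_chart_def
  proof (rule continuous_on_coordinatewise_then_product)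
    fix i
    have "continuous_on ?P (\<lambda>z. z i * cnj (z k) / of_real (cmod (z k)))"
      by (intro continuous_intros) auto
    then show "continuous_on ?P (\<lambda>z. if i \<in> ?D then z i * cnj (z k) / of_real (cmod (z k)) else 0)"
      by (cases "i \<in> ?D") simp_all
  qed
  have sq: "sqn A (hyper_chart z) = sqn A z" "sqn B (hyper_chart z) = sqn B z"
      and split: "sqn A z + (cmod (z k))\<^sup>2 = sqn B z + a" if "z \<in> ?P" for z
  proof -
    show "sqn A (hyper_chart z) = sqn A z" "sqn B (hyper_chart z) = sqn B z"
      by (rule sqn_cong; use that in \<open>simp add: hyper_chart_def norm_mult norm_divide\<close>)+
    show "sqn A z + (cmod (z k))\<^sup>2 = sqn B z + a"
      using that finite disjoint by (simp add: quadric_def sqn_insert)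
  qed
  have im: "hyper_chart ` ?P \<subseteq> ?Y"
  proof (rule image_subsetI)
    fix z assume z: "z \<in> ?P"
    have "hyper_chart z \<in> cspace ?D" by (simp add: hyper_chart_def cspace_def)
    moreover have "0 < (cmod (z k))\<^sup>2" using z by simp
    then have "sqn A z < sqn B z + a" using split[OF z] by linarith
    ultimately show "hyper_chart z \<in> ?Y" by (simp add: sq[OF z])
  qed
  have rotc: "hyper_chart (rot c z) = hyper_chart z" if "cmod c = 1" for c z
  proof -
    have "c * cnj c = 1" using that by (simp add: complex_norm_square[symmetric])
    then show ?thesis
      using that by (simp add: hyper_chart_def rot_def norm_mult fun_eq_iff mult_ac
          flip: mult.assoc[of c "cnj c"])
  qed
  have contg: "continuous_on ?Y (hyper_unchart a)"
  proof (rule continuous_on_coordinatewise_then_product)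
    fix i show "continuous_on ?Y (\<lambda>y. hyper_unchart a y i)"
      unfolding hyper_unchart_def by (cases "i = k") (auto intro!: continuous_intros)
  qed
  have img: "hyper_unchart a ` ?Y \<subseteq> ?P"
  proof (rule image_subsetI)
    fix y assume y: "y \<in> ?Y"
    have s: "sqn A (hyper_unchart a y) = sqn A y" "sqn B (hyper_unchart a y) = sqn B y"
      by (rule sqn_cong; use disjoint in \<open>auto simp: hyper_unchart_def\<close>)+
    have k: "hyper_unchart a y k = of_real (sqrt (sqn B y + a - sqn A y))" by (simp add: hyper_unchart_def)
    have "sqn (insert k A) (hyper_unchart a y) = sqn B (hyper_unchart a y) + a"
      using y finite disjoint by (simp add: sqn_insert s k)
    moreover have nz: "hyper_unchart a y k \<noteq> 0" using y by (simp add: k)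
    moreover have "hyper_unchart a y \<in> cspace (insert k A \<union> B \<union> C)"
      using y by (auto simp: cspace_def hyper_unchart_def)
    moreover have "hyper_unchart a y \<noteq> (\<lambda>_. 0)" using nz by metis
    ultimately show "hyper_unchart a y \<in> ?P" by (simp add: quadric_def)
  qed
  have fg: "hyper_chart (hyper_unchart a y) = y" if y: "y \<in> ?Y" for y
  proof
    fix i
    have "i \<in> ?D \<Longrightarrow> i \<noteq> k" using disjoint by auto
    moreover have "0 < sqrt (sqn B y + a - sqn A y)" using y by simp
    ultimately show "hyper_chart (hyper_unchart a y) i = y i"
      using y by (cases "i \<in> ?D") (auto simp: hyper_chart_def hyper_unchart_def cspace_def)
  qed
  have gf: "\<exists>c. cmod c = 1 \<and> hyper_unchart a (hyper_chart z) = rot c z" if z: "z \<in> ?P" for z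
  proof (intro exI conjI)
    let ?c = "cnj (z k) / of_real (cmod (z k))"
    have zk: "z k \<noteq> 0" using z by simp
    show c: "cmod ?c = 1" using cmod_phase[OF zk] .
    have kk: "z k * cnj (z k) = of_real (cmod (z k)) * of_real (cmod (z k))"
      by (metis complex_norm_square of_real_mult power2_eq_square)
    have "sqn B z + a - sqn A z = (cmod (z k))\<^sup>2" using split[OF z] by simp
    then have s: "sqrt (sqn B (hyper_chart z) + a - sqn A (hyper_chart z)) = cmod (z k)"
      by (simp add: sq[OF z])
    show "hyper_unchart a (hyper_chart z) = rot ?c z"
    proof
      fix i
      consider "i = k" | "i \<in> ?D" "i \<noteq> k" | "i \<notin> ?D" "i \<noteq> k" by blast
      then show "hyper_unchart a (hyper_chart z) i = rot ?c z i"
      proof cases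
        case 1
        then show ?thesis using s kk zk by (simp add: hyper_unchart_def rot_def mult.commute)
      next
        case 2
        then show ?thesis by (simp add: hyper_unchart_def rot_def hyper_chart_def mult.commute)
      next
        case 3
        then show ?thesis using z by (simp add: hyper_unchart_def rot_def hyper_chart_def quadric_def cspace_def)
      qed
    qed
  qed
  show ?thesis
    by (rule homeomorphism_orbit_space(1)[OF inv cont im _ contg img]) (use rotc fg gf in blast)+
qed

end

text \<open>For \<open>a > 0\<close> the positive part of the form is positive, so every point has a
  nonzero coordinate in \<open>A\<close> and the slices at such coordinates cover the level. The
  dimension counts two real parameters for each coordinate other than \<open>k\<close>.\<close>

theorem topological_manifold_quadric:
  assumes "finite A" "finite B" "finite C" "A \<inter> B = {}" "A \<inter> C = {}" "B \<inter> C = {}" and a: "a > 0"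
  shows "topological_manifold (2 * (card A + card B + card C - 1)) (top_of_set (outer ` quadric A B C a))"
  unfolding topological_manifold_def
proof (intro conjI ballI Hausdorff_second_countable_top_of_set)
  let ?X = "top_of_set (outer ` quadric A B C a)" and ?d = "card A + card B + card C - 1"
  fix x assume "x \<in> topspace ?X"
  then obtain z where z: "z \<in> quadric A B C a" "x = outer z" by auto
  then have "0 < sqn A z" using a sqn_nonneg[of B z] by (simp add: quadric_def)
  then obtain k where k: "k \<in> A" "z k \<noteq> 0" using assms(1) by (auto simp: sqn_pos)
  interpret disjoint_index_sets "A - {k}" B C k
    by unfold_locales (use assms k in auto)
  have A: "insert k (A - {k}) = A" using k by auto
  let ?D = "A - {k} \<union> B \<union> C"
  have card: "card ?D = ?d"
  proof -
    have "(A - {k}) \<inter> B = {}" "(A - {k} \<union> B) \<inter> C = {}" using assms by auto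
    then have "card ?D = card (A - {k}) + card B + card C"
      using assms by (simp add: card_Un_disjoint)
    moreover have "0 < card A" using k assms(1) by (auto simp: card_gt_0_iff)
    ultimately show ?thesis using k by simp
  qed
  have "finite ?D" using assms by simp
  then obtain \<beta> where \<beta>: "bij_betw \<beta> {..<?d} ?D" using card obtain_enumeration by metis
  let ?U = "outer ` {z \<in> quadric A B C a. z k \<noteq> 0}"
  let ?Y = "{y \<in> cspace ?D. sqn (A - {k}) y < sqn B y + a}"
  let ?V = "realify \<beta> ?d ` ?Y"
  have r: "homeomorphism (cspace ?D) (rspace (2 * ?d)) (realify \<beta> ?d) (complexify \<beta> ?d)"
    by (rule homeomorphism_realify[OF \<beta>])
  have "homeomorphism ?Y ?V (realify \<beta> ?d) (complexify \<beta> ?d)"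
    by (rule homeomorphism_of_subsets[OF r]) auto
  then have "?U homeomorphic ?V"
    using homeomorphism_compose[OF homeomorphism_hyper_chart[of a]] unfolding A homeomorphic_def by blast
  then have hom: "top_of_set ?U homeomorphic_space top_of_set ?V"
    unfolding homeomorphic_def
    using homeomorphism_imp_homeomorphic_map homeomorphic_map_imp_homeomorphic_space by blast
  have V: "openin (top_of_set (rspace (2 * ?d))) ?V"
  proof (rule homeomorphism_imp_open_map[OF r])
    have "open {y. sqn (A - {k}) y < sqn B y + a}"
      by (intro open_Collect_less continuous_intros)
    then have "openin (top_of_set (cspace ?D)) (cspace ?D \<inter> {y. sqn (A - {k}) y < sqn B y + a})"
      by (rule openin_open_Int)
    then show "openin (top_of_set (cspace ?D)) ?Y" by (simp add: Collect_conj_eq)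
  qed
  have "openin ?X ?U"
    by (rule openin_outer_coordinates(1)[OF circle_invariant_quadric])
  moreover have "x \<in> ?U" using z k by auto
  moreover have "subtopology ?X ?U = top_of_set ?U"
    by (simp add: subtopology_subtopology Int_absorb1 image_mono)
  moreover have "subtopology (Euclidean_space (2 * ?d)) ?V = top_of_set ?V"
    using openin_imp_subset[OF V] by (simp add: Euclidean_space_eq_top_of_set subtopology_subtopology Int_absorb1)
  ultimately show "\<exists>U V. openin ?X U \<and> x \<in> U \<and> openin (Euclidean_space (2 * ?d)) V \<and>
      subtopology ?X U homeomorphic_space subtopology (Euclidean_space (2 * ?d)) V"
    using hom V by (intro exI[of _ ?U] exI[of _ ?V]) (simp add: Euclidean_space_eq_top_of_set)
qed

section \<open>Deformation of a nonzero level onto complex projective space\<close>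

definition csphere :: "nat set \<Rightarrow> (nat \<Rightarrow> complex) set" where
  "csphere A = {z \<in> cspace A. sqn A z = 1}"

lemma circle_invariant_csphere: "circle_invariant (csphere A)"
  by (auto simp: circle_invariant_def csphere_def cspace_rot sqn_rot) (simp add: sqn_def)

text \<open>The coordinates outside \<open>A\<close> are multiplied by \<open>t\<close> while those
  in \<open>A\<close> are rescaled to preserve the equation. As \<open>a > 0\<close>, the positive
  part never vanishes, so the rescaling is continuous; at \<open>t = 0\<close> it leaves the sphere
  of radius \<open>sqrt a\<close> in the coordinates of \<open>A\<close>.\<close>

lemma quadric_homotopy_equivalent_csphere:
  assumes fin: "finite A" and disj: "A \<inter> B = {}" and a: "a > 0"
  shows "top_of_set (outer ` quadric A B C a) homotopy_equivalent_space top_of_set (outer ` csphere A)"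
proof -
  define f where "f z = (\<lambda>i. if i \<in> A then z i / of_real (sqrt (sqn A z)) else 0)" for z :: "nat \<Rightarrow> complex"
  define g where "g z = (\<lambda>i. of_real (sqrt a) * z i)" for z :: "nat \<Rightarrow> complex"
  define h where "h p = (\<lambda>i. if i \<in> A then of_real (sqrt ((sqn B (snd p) * (fst p)\<^sup>2 + a) / sqn A (snd p))) * snd p i
      else of_real (fst p) * snd p i)" for p :: "real \<times> (nat \<Rightarrow> complex)"
  have pos: "0 < sqn A z" if "z \<in> quadric A B C a" for z
    using that a sqn_nonneg[of B z] by (simp add: quadric_def)
  have pos': "0 < sqn B z * t\<^sup>2 + a" for z t
    using a sqn_nonneg[of B z] by (simp add: add_nonneg_pos)
  show ?thesis
  proof (rule homotopy_equivalent_orbit_spaces[where f = f and g = g and h = h])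
    show "circle_invariant (quadric A B C a)" "circle_invariant (csphere A)"
      by (rule circle_invariant_quadric circle_invariant_csphere)+
    show "continuous_on (quadric A B C a) f"
    proof (rule continuous_on_coordinatewise_then_product)
      fix i
      have "continuous_on (quadric A B C a) (\<lambda>z. z i / of_real (sqrt (sqn A z)))"
        by (intro continuous_intros) (use pos in fastforce)
      then show "continuous_on (quadric A B C a) (\<lambda>z. f z i)"
        by (cases "i \<in> A") (simp_all add: f_def)
    qed
    show "f ` quadric A B C a \<subseteq> csphere A"
    proof (rule image_subsetI)
      fix z assume z: "z \<in> quadric A B C a"
      have "sqn A (f z) = (1 / sqrt (sqn A z))\<^sup>2 * sqn A z"
        by (rule sqn_scale) (use pos[OF z] in \<open>simp add: f_def norm_divide\<close>)
      then have "sqn A (f z) = 1" using pos[OF z] by (simp add: power_divide)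
      then show "f z \<in> csphere A" by (simp add: csphere_def cspace_def f_def)
    qed
    show "f (rot c z) = rot c (f z)" if "cmod c = 1" for c z
      using that unfolding f_def sqn_rot[OF that] by (auto simp: rot_def)
    show "continuous_on (csphere A) g"
      unfolding g_def by (intro continuous_on_coordinatewise_then_product continuous_intros)
    show "g ` csphere A \<subseteq> quadric A B C a"
    proof (rule image_subsetI)
      fix z assume z: "z \<in> csphere A"
      have s: "sqn S (g z) = a * sqn S z" for S
        using sqn_scale[of S "g z" "sqrt a" z] a by (simp add: g_def norm_mult)
      have "sqn B z = 0" using z disj by (auto simp: sqn_def csphere_def cspace_def intro!: sum.neutral)
      moreover have "g z \<noteq> (\<lambda>_. 0)"
      proof
        assume "g z = (\<lambda>_. 0)"
        then have "sqn A (g z) = 0" by (simp add: sqn_def)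
        then show False using z a s by (simp add: csphere_def)
      qed
      ultimately show "g z \<in> quadric A B C a"
        using z s by (auto simp: quadric_def csphere_def cspace_def g_def)
    qed
    show "g (rot c z) = rot c (g z)" for c z
      by (simp add: g_def rot_def mult.left_commute)
    show "f (g z) = z" if z: "z \<in> csphere A" for z
    proof
      fix i
      have "sqn A (g z) = a"
        using sqn_scale[of A "g z" "sqrt a" z] a z by (simp add: g_def norm_mult csphere_def)
      then have "f (g z) i = (if i \<in> A then g z i / of_real (sqrt a) else 0)"
        unfolding f_def by simp
      then show "f (g z) i = z i"
        using a z by (simp add: g_def csphere_def cspace_def)
    qed
    show "continuous_on ({0..1} \<times> quadric A B C a) h"
    proof (rule continuous_on_coordinatewise_then_product)
      fix i
      have "continuous_on ({0..1} \<times> quadric A B C a) (\<lambda>p. complex_of_real (sqrt ((sqn B (snd p) * (fst p)\<^sup>2 + a) / sqn A (snd p))) * snd p i)"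
        by (intro continuous_intros) (use pos in fastforce)
      moreover have "continuous_on ({0..1} \<times> quadric A B C a) (\<lambda>p. complex_of_real (fst p) * snd p i)"
        by (intro continuous_intros)
      ultimately show "continuous_on ({0..1} \<times> quadric A B C a) (\<lambda>p. h p i)"
        by (cases "i \<in> A") (simp_all add: h_def)
    qed
    show "h ` ({0..1} \<times> quadric A B C a) \<subseteq> quadric A B C a"
    proof clarify
      fix t z assume t: "t \<in> {0..1::real}" and z: "z \<in> quadric A B C a"
      have "sqn A (h (t, z)) = (sqrt ((sqn B z * t\<^sup>2 + a) / sqn A z))\<^sup>2 * sqn A z"
        by (rule sqn_scale) (use pos[OF z] less_imp_le[OF pos'] in \<open>simp add: h_def norm_mult\<close>)
      then have 1: "sqn A (h (t, z)) = sqn B z * t\<^sup>2 + a"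
        using pos[OF z] pos'[of z t] by simp
      have "sqn B (h (t, z)) = t\<^sup>2 * sqn B z"
        by (rule sqn_scale) (use disj t in \<open>auto simp: h_def norm_mult\<close>)
      then have "sqn A (h (t, z)) = sqn B (h (t, z)) + a" using 1 by simp
      moreover have "h (t, z) \<noteq> (\<lambda>_. 0)"
      proof
        assume "h (t, z) = (\<lambda>_. 0)"
        then have "sqn A (h (t, z)) = 0" by (simp add: sqn_def)
        then show False using 1 pos'[of z t] by simp
      qed
      ultimately show "h (t, z) \<in> quadric A B C a"
        using z by (auto simp: quadric_def cspace_def h_def)
    qed
    show "h (t, rot c z) = rot c (h (t, z))" if "cmod c = 1" for c t z
    proof
      fix i
      have "h (t, rot c z) i = c * h (t, z) i"
        unfolding h_def fst_conv snd_conv sqn_rot[OF that] by (simp add: rot_def)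
      then show "h (t, rot c z) i = rot c (h (t, z)) i" by (simp add: rot_def)
    qed
    show "h (0, z) = g (f z)" if z: "z \<in> quadric A B C a" for z
      by (auto simp: h_def f_def g_def real_sqrt_divide fun_eq_iff)
    show "h (1, z) = z" if z: "z \<in> quadric A B C a" for z
    proof
      fix i
      have "(sqn B z + a) / sqn A z = 1" using z pos[OF z] by (simp add: quadric_def)
      then show "h (1, z) i = z i" by (simp add: h_def)
    qed
  qed
qed

section \<open>The cell structure of complex projective space\<close>

text \<open>\<open>realify\<close> reads only the coordinates enumerated by \<open>\<beta>\<close>,
  so on a general vector the composite is a projection.\<close>

lemma complexify_realify:
  assumes "inj_on \<beta> {..<d}"
  shows "complexify \<beta> d (realify \<beta> d z) = (\<lambda>i. if i \<in> \<beta> ` {..<d} then z i else 0)"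
proof -
  let ?w = "\<lambda>i. if i \<in> \<beta> ` {..<d} then z i else 0"
  have "realify \<beta> d z = realify \<beta> d ?w"
  proof
    fix m show "realify \<beta> d z m = realify \<beta> d ?w m"
    proof (cases "m < 2 * d")
      case True
      then have "\<beta> (m div 2) \<in> \<beta> ` {..<d}" by auto
      then show ?thesis by (simp add: realify_def)
    qed (simp add: realify_def)
  qed
  moreover have "?w \<in> cspace (\<beta> ` {..<d})" by (simp add: cspace_def)
  moreover have "bij_betw \<beta> {..<d} (\<beta> ` {..<d})" using assms by (simp add: bij_betw_def)
  ultimately show ?thesis
    using homeomorphism_apply1[OF homeomorphism_realify[of \<beta> d "\<beta> ` {..<d}"], of ?w] by (simp only:)
qed

lemma unit_disk_eq: "unit_disk d = {x \<in> rspace d. (\<Sum>i<d. (x i)\<^sup>2) \<le> 1}"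
  and open_disk_eq: "open_disk d = {x \<in> rspace d. (\<Sum>i<d. (x i)\<^sup>2) < 1}"
  by (simp_all add: unit_disk_def open_disk_def Euclidean_space_eq_top_of_set)

locale enumerated_index_set =
  fixes A :: "nat set" and p :: nat and \<beta> :: "nat \<Rightarrow> nat"
  assumes enum: "bij_betw \<beta> {..<p} A"
begin

abbreviation "initial i \<equiv> \<beta> ` {..<i}"

text \<open>The disk as a hemisphere: its points fill the first \<open>i\<close> complex
  coordinates, and the next one is the nonnegative real number that completes them to a unit vector.
  It vanishes precisely on the boundary sphere.\<close>

definition cell_lift :: "nat \<Rightarrow> (nat \<Rightarrow> real) \<Rightarrow> nat \<Rightarrow> complex" where
  "cell_lift i x = (\<lambda>m. if m = \<beta> i then of_real (sqrt (1 - (\<Sum>l<2 * i. (x l)\<^sup>2))) else complexify \<beta> i x m)"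

definition cell_map :: "nat \<Rightarrow> (nat \<Rightarrow> real) \<Rightarrow> nat \<Rightarrow> real" where
  "cell_map i x = outer (cell_lift i x)"

text \<open>The unit vectors above an open Schubert cell of projective space, sorted by their last
  nonzero coordinate.\<close>

definition cell :: "nat \<Rightarrow> (nat \<Rightarrow> complex) set" where
  "cell i = {z \<in> csphere A. z (\<beta> i) \<noteq> 0 \<and> (\<forall>j. i < j \<longrightarrow> j < p \<longrightarrow> z (\<beta> j) = 0)}"

text \<open>Inverse to \<open>cell_lift\<close> up to phase: the last nonzero coordinate is rotated
  to be positive and the earlier ones are read off.\<close>

definition cell_coordinates :: "nat \<Rightarrow> (nat \<Rightarrow> complex) \<Rightarrow> nat \<Rightarrow> real" where
  "cell_coordinates i z = realify \<beta> i (rot (cnj (z (\<beta> i)) / of_real (cmod (z (\<beta> i)))) z)"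

lemma inj: "i \<le> p \<Longrightarrow> inj_on \<beta> {..<i}"
  using enum by (auto simp: bij_betw_def intro: inj_on_subset)

lemma bij_initial: "i \<le> p \<Longrightarrow> bij_betw \<beta> {..<i} (initial i)"
  using inj by (simp add: bij_betw_def)

lemma eq_iff: "i < p \<Longrightarrow> j < p \<Longrightarrow> \<beta> i = \<beta> j \<longleftrightarrow> i = j"
  using inj[of p] by (auto simp: inj_on_def)

lemma image: "\<beta> ` {..<p} = A"
  using enum by (simp add: bij_betw_def)

lemma mem: "i < p \<Longrightarrow> \<beta> i \<in> A"
  using image by auto

lemma finite_A: "finite A"
  using image by (metis finite_imageI finite_lessThan)

lemma not_initial: "i \<le> j \<Longrightarrow> j < p \<Longrightarrow> \<beta> j \<notin> initial i"
  using eq_iff by auto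

lemma mem_initial_iff: "i \<le> p \<Longrightarrow> m \<in> initial i \<Longrightarrow> m \<in> A"
  using image by auto

lemma circle_invariant_cell: "circle_invariant (cell i)"
  unfolding cell_def
  by (rule circle_invariant_Collect[OF circle_invariant_csphere]) (auto simp: rot_def)

lemma cell_lift_outside: "i < p \<Longrightarrow> m \<notin> initial i \<Longrightarrow> m \<noteq> \<beta> i \<Longrightarrow> cell_lift i x m = 0"
  by (simp add: cell_lift_def complexify_def)

lemma sqn_initial_Suc: "i < p \<Longrightarrow> sqn (initial (Suc i)) z = (cmod (z (\<beta> i)))\<^sup>2 + sqn (initial i) z"
  using not_initial[of i i] by (simp add: lessThan_Suc sqn_insert)

lemma sqn_supported:
  assumes "i \<le> p" "\<And>m. m \<in> A \<Longrightarrow> m \<notin> initial i \<Longrightarrow> z m = 0"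
  shows "sqn A z = sqn (initial i) z"
  unfolding sqn_def
  by (rule sum.mono_neutral_right) (use finite_A assms mem_initial_iff in auto)

lemma cell_lift_csphere:
  assumes i: "i < p" and x: "x \<in> unit_disk (2 * i)"
  shows "cell_lift i x \<in> csphere A"
proof -
  have c: "cell_lift i x \<in> cspace A"
    using i mem mem_initial_iff[of i] cell_lift_outside by (auto simp: cspace_def) (metis less_imp_le)
  have "sqn A (cell_lift i x) = sqn (initial (Suc i)) (cell_lift i x)"
    using i cell_lift_outside[OF i] by (intro sqn_supported) (auto simp: lessThan_Suc)
  also have "\<dots> = (cmod (cell_lift i x (\<beta> i)))\<^sup>2 + sqn (initial i) (cell_lift i x)"
    by (rule sqn_initial_Suc[OF i])
  also have "sqn (initial i) (cell_lift i x) = sqn (initial i) (complexify \<beta> i x)"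
  proof (rule sqn_cong)
    fix m assume "m \<in> initial i"
    then have "m \<noteq> \<beta> i" using not_initial[of i i] i by blast
    then show "cmod (cell_lift i x m) = cmod (complexify \<beta> i x m)" by (simp add: cell_lift_def)
  qed
  also have "\<dots> = (\<Sum>l<2 * i. (realify \<beta> i (complexify \<beta> i x) l)\<^sup>2)"
    using i by (intro sum_squares_realify[symmetric] bij_initial) simp
  also have "realify \<beta> i (complexify \<beta> i x) = x"
    using homeomorphism_apply2[OF homeomorphism_realify[OF bij_initial]] i x by (simp add: unit_disk_eq)
  also have "(cmod (cell_lift i x (\<beta> i)))\<^sup>2 = 1 - (\<Sum>l<2 * i. (x l)\<^sup>2)"
    using x by (simp add: cell_lift_def unit_disk_eq)
  finally show ?thesis using c by (simp add: csphere_def)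
qed

lemma cell_lift_top: "cell_lift i x (\<beta> i) = of_real (sqrt (1 - (\<Sum>l<2 * i. (x l)\<^sup>2)))"
  by (simp add: cell_lift_def)

lemma continuous_on_cell_lift: "continuous_on (unit_disk (2 * i)) (cell_lift i)"
proof (rule continuous_on_coordinatewise_then_product)
  fix m
  show "continuous_on (unit_disk (2 * i)) (\<lambda>x. cell_lift i x m)"
  proof (cases "m = \<beta> i")
    case True
    then show ?thesis
      unfolding cell_lift_def by (auto intro!: continuous_intros)
  next
    case False
    have "continuous_on (unit_disk (2 * i)) (\<lambda>x. complexify \<beta> i x m)"
      unfolding complexify_def Complex_eq
      by (cases "m \<in> initial i") (simp_all add: continuous_intros)
    then show ?thesis using False by (simp add: cell_lift_def)
  qed
qed

lemma continuous_on_cell_map: "continuous_on (unit_disk (2 * i)) (cell_map i)"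
  unfolding cell_map_def
  by (rule continuous_on_compose2[OF continuous_on_outer[of UNIV] continuous_on_cell_lift]) simp

lemma homeomorphism_cell:
  assumes i: "i < p"
  shows "homeomorphism (outer ` cell i) (open_disk (2 * i)) (\<lambda>h. cell_coordinates i (representative h)) (cell_map i)"
  unfolding cell_map_def
proof (rule homeomorphism_orbit_space(1))
  show "circle_invariant (cell i)" by (rule circle_invariant_cell)
  have sub: "open_disk (2 * i) \<subseteq> unit_disk (2 * i)" by (auto simp: open_disk_eq unit_disk_eq)
  show "continuous_on (open_disk (2 * i)) (cell_lift i)"
    using continuous_on_cell_lift sub by (rule continuous_on_subset)
  show "continuous_on (cell i) (cell_coordinates i)"
  proof (rule continuous_on_coordinatewise_then_product)
    fix m
    have c: "continuous_on (cell i) (\<lambda>z. cnj (z (\<beta> i)) / of_real (cmod (z (\<beta> i))) * z j)" for j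
      by (intro continuous_intros) (auto simp: cell_def)
    show "continuous_on (cell i) (\<lambda>z. cell_coordinates i z m)"
      unfolding cell_coordinates_def realify_def rot_def
      by (cases "m < 2 * i"; cases "even m")
        (simp_all only: if_True if_False continuous_on_Re[OF c] continuous_on_Im[OF c] continuous_on_const not_False_eq_True)
  qed
  have outside: "z m = 0" if "z \<in> cell i" "m \<notin> initial (Suc i)" for z m
  proof (cases "m \<in> A")
    case True
    then obtain j where j: "j < p" "m = \<beta> j" using image by auto
    then have "\<not> j < Suc i" using that(2) by blast
    then have "i < j" by simp
    then show ?thesis using that(1) j by (simp add: cell_def)
  next
    case False
    then show ?thesis using that by (simp add: cell_def csphere_def cspace_def)
  qed
  have norm: "(cmod (z (\<beta> i)))\<^sup>2 + sqn (initial i) z = 1" if "z \<in> cell i" for z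
  proof -
    have "sqn A z = sqn (initial (Suc i)) z"
      using i that outside by (intro sqn_supported) auto
    then show ?thesis using sqn_initial_Suc[OF i] that by (simp add: cell_def csphere_def)
  qed
  have sum: "(\<Sum>l<2 * i. (cell_coordinates i z l)\<^sup>2) = sqn (initial i) z" if z: "z \<in> cell i" for z
  proof -
    have "cmod (cnj (z (\<beta> i)) / of_real (cmod (z (\<beta> i)))) = 1"
      using z by (intro cmod_phase) (simp add: cell_def)
    then show ?thesis
      unfolding cell_coordinates_def using sum_squares_realify[OF bij_initial] i by (simp add: sqn_rot)
  qed
  show "cell_coordinates i ` cell i \<subseteq> open_disk (2 * i)"
  proof (rule image_subsetI)
    fix z assume z: "z \<in> cell i"
    then have "0 < (cmod (z (\<beta> i)))\<^sup>2" by (simp add: cell_def)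
    then have "(\<Sum>l<2 * i. (cell_coordinates i z l)\<^sup>2) < 1"
      using sum[OF z] norm[OF z] by linarith
    moreover have "cell_coordinates i z \<in> rspace (2 * i)"
      by (simp add: cell_coordinates_def realify_def rspace_def)
    ultimately show "cell_coordinates i z \<in> open_disk (2 * i)" by (simp add: open_disk_eq)
  qed
  show "cell_coordinates i (rot c z) = cell_coordinates i z" if c: "cmod c = 1" for c z
  proof -
    have "c * cnj c = 1" using c by (simp add: complex_norm_square[symmetric])
    then have "rot (cnj (rot c z (\<beta> i)) / of_real (cmod (rot c z (\<beta> i)))) (rot c z)
      = rot (cnj (z (\<beta> i)) / of_real (cmod (z (\<beta> i)))) z"
      using c by (simp add: rot_def norm_mult fun_eq_iff mult_ac flip: mult.assoc[of c "cnj c"])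
    then show ?thesis by (simp add: cell_coordinates_def)
  qed
  show "cell_lift i ` open_disk (2 * i) \<subseteq> cell i"
  proof (rule image_subsetI)
    fix x assume x: "x \<in> open_disk (2 * i)"
    have "cell_lift i x (\<beta> j) = 0" if "i < j" "j < p" for j
      using cell_lift_outside[OF i, of "\<beta> j"] not_initial[of i j] eq_iff[of i j] that i by simp
    moreover have "cell_lift i x (\<beta> i) \<noteq> 0" using x by (simp add: cell_lift_top open_disk_eq)
    ultimately show "cell_lift i x \<in> cell i"
      using cell_lift_csphere[OF i] sub x by (auto simp: cell_def)
  qed
  show "cell_coordinates i (cell_lift i x) = x" if x: "x \<in> open_disk (2 * i)" for x
  proof -
    have "0 < 1 - (\<Sum>l<2 * i. (x l)\<^sup>2)" using x by (simp add: open_disk_eq)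
    then have "cnj (cell_lift i x (\<beta> i)) / of_real (cmod (cell_lift i x (\<beta> i))) = 1"
      by (simp add: cell_lift_top)
    then have "cell_coordinates i (cell_lift i x) = realify \<beta> i (cell_lift i x)"
      by (simp add: cell_coordinates_def rot_def)
    \<comment> \<open>Only the first \<open>i\<close> coordinates are read, and there
      \<open>cell_lift\<close> agrees with \<open>complexify\<close>.\<close>
    also have "\<dots> = realify \<beta> i (complexify \<beta> i x)"
      using not_initial[of i i] i eq_iff by (auto simp: realify_def cell_lift_def fun_eq_iff)
    also have "\<dots> = x"
      using homeomorphism_apply2[OF homeomorphism_realify[OF bij_initial]] i x by (simp add: open_disk_eq)
    finally show ?thesis .
  qed
  show "\<exists>c. cmod c = 1 \<and> cell_lift i (cell_coordinates i z) = rot c z" if z: "z \<in> cell i" for z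
  proof (intro exI conjI)
    let ?c = "cnj (z (\<beta> i)) / of_real (cmod (z (\<beta> i)))"
    have nz: "z (\<beta> i) \<noteq> 0" using z by (simp add: cell_def)
    show "cmod ?c = 1" using cmod_phase[OF nz] .
    have kk: "z (\<beta> i) * cnj (z (\<beta> i)) = of_real (cmod (z (\<beta> i))) * of_real (cmod (z (\<beta> i)))"
      by (metis complex_norm_square of_real_mult power2_eq_square)
    have s: "1 - (\<Sum>l<2 * i. (cell_coordinates i z l)\<^sup>2) = (cmod (z (\<beta> i)))\<^sup>2"
      using sum[OF z] norm[OF z] by linarith
    show "cell_lift i (cell_coordinates i z) = rot ?c z"
    proof
      fix m
      consider "m = \<beta> i" | "m \<in> initial i" "m \<noteq> \<beta> i" | "m \<notin> initial i" "m \<noteq> \<beta> i" by blast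
      then show "cell_lift i (cell_coordinates i z) m = rot ?c z m"
      proof cases
        case 1
        then show ?thesis using s kk nz by (simp add: cell_lift_top rot_def mult.commute)
      next
        case 2
        then show ?thesis using complexify_realify[OF inj[of i]] i
          by (simp add: cell_lift_def cell_coordinates_def)
      next
        case 3
        then show ?thesis using outside[OF z, of m] cell_lift_outside[OF i]
          by (simp add: rot_def lessThan_Suc)
      qed
    qed
  qed
qed

lemma cell_image: "i < p \<Longrightarrow> cell_map i ` open_disk (2 * i) = outer ` cell i"
  using homeomorphism_image2[OF homeomorphism_cell] .

lemma csphere_eq_UN_cell: "csphere A = (\<Union>i<p. cell i)"
proof
  show "csphere A \<subseteq> (\<Union>i<p. cell i)"
  proof
    fix z assume z: "z \<in> csphere A"
    then have "0 < sqn A z" by (simp add: csphere_def)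
    then obtain m where "m \<in> A" "z m \<noteq> 0" using finite_A by (auto simp: sqn_pos)
    then obtain j where j: "j < p" "z (\<beta> j) \<noteq> 0" using image by auto
    define J where "J = {j. j < p \<and> z (\<beta> j) \<noteq> 0}"
    define m where "m = Max J"
    have J: "finite J" "J \<noteq> {}" using j by (auto simp: J_def)
    then have "m \<in> J" unfolding m_def by (rule Max_in)
    then have m: "m < p" "z (\<beta> m) \<noteq> 0" by (simp_all add: J_def)
    have "z (\<beta> l) = 0" if "m < l" "l < p" for l
    proof (rule ccontr)
      assume "z (\<beta> l) \<noteq> 0"
      then have "l \<in> J" using that by (simp add: J_def)
      then have "l \<le> m" using J unfolding m_def by simp
      then show False using that by simp
    qed
    then have "z \<in> cell m" using z m by (simp add: cell_def)
    then show "z \<in> (\<Union>i<p. cell i)" using m(1) by blast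
  qed
qed (auto simp: cell_def)

lemma cell_disjoint: "i < p \<Longrightarrow> j < p \<Longrightarrow> i \<noteq> j \<Longrightarrow> outer ` cell i \<inter> outer ` cell j = {}"
proof -
  assume "i < p" "j < p" "i \<noteq> j"
  then have "cell i \<inter> cell j = {}" by (auto simp: cell_def) (metis linorder_neqE_nat)
  then show ?thesis using outer_in_image_iff[OF circle_invariant_cell, of _ j] by fastforce
qed

theorem cw_structure_csphere:
  "cw_structure (top_of_set (outer ` csphere A)) {..<p} (\<lambda>i. 2 * i) cell_map"
proof -
  let ?X = "top_of_set (outer ` csphere A)"
  have sub: "open_disk d \<subseteq> unit_disk d" "unit_disk d \<subseteq> rspace d" for d
    by (auto simp: open_disk_eq unit_disk_eq)
  have tops: "subtopology (Euclidean_space d) (unit_disk d) = top_of_set (unit_disk d)"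
     "subtopology (Euclidean_space d) (open_disk d) = top_of_set (open_disk d)" for d
    using sub[of d] by (auto simp: Euclidean_space_eq_top_of_set subtopology_subtopology Int_absorb1)
  have im: "cell_map i ` unit_disk (2 * i) \<subseteq> outer ` csphere A" if "i < p" for i
    using cell_lift_csphere[OF that] by (auto simp: cell_map_def)
  have UN: "(\<Union>i<p. cell_map i ` open_disk (2 * i)) = outer ` csphere A"
    using cell_image by (auto simp: csphere_eq_UN_cell)
  show ?thesis
    unfolding cw_structure_def tops
  proof (intro conjI ballI allI impI)
    show "Hausdorff_space ?X" by (rule Hausdorff_second_countable_top_of_set)
    show "(\<Union>i<p. cell_map i ` open_disk (2 * i)) = topspace ?X" using UN by simp
    show "disjoint_family_on (\<lambda>i. cell_map i ` open_disk (2 * i)) {..<p}"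
      using cell_disjoint by (auto simp: disjoint_family_on_def cell_image)
  next
    fix i assume "i \<in> {..<p}"
    then have i: "i < p" by simp
    show "continuous_map (top_of_set (unit_disk (2 * i))) ?X (cell_map i)"
      using continuous_on_cell_map im[OF i] by (simp add: image_subset_iff_funcset)
    have "outer ` cell i \<subseteq> outer ` csphere A" by (auto simp: cell_def)
    then have "subtopology ?X (cell_map i ` open_disk (2 * i)) = top_of_set (outer ` cell i)"
      using cell_image[OF i] by (simp add: subtopology_subtopology Int_absorb1)
    then show "homeomorphic_map (top_of_set (open_disk (2 * i)))
        (subtopology ?X (cell_map i ` open_disk (2 * i))) (cell_map i)"
      using homeomorphism_imp_homeomorphic_map[OF homeomorphism_symD[OF homeomorphism_cell[OF i]]] by simp
    \<comment> \<open>On the boundary the coordinate \<open>\<beta> i\<close> of the lift vanishes,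
      so the last nonzero coordinate comes earlier.\<close>
    have "cell_map i ` (unit_disk (2 * i) - open_disk (2 * i)) \<subseteq> (\<Union>j<i. cell_map j ` open_disk (2 * j))"
    proof (rule image_subsetI)
      fix x assume x: "x \<in> unit_disk (2 * i) - open_disk (2 * i)"
      then have "(\<Sum>l<2 * i. (x l)\<^sup>2) = 1" by (auto simp: unit_disk_eq open_disk_eq)
      then have 0: "cell_lift i x (\<beta> i) = 0" by (simp add: cell_lift_top)
      have "cell_lift i x \<in> csphere A" using cell_lift_csphere[OF i] x by simp
      then obtain j where j: "j < p" "cell_lift i x \<in> cell j" using csphere_eq_UN_cell by auto
      then have "cell_lift i x (\<beta> j) \<noteq> 0" by (simp add: cell_def)
      then have "j < i"
        using 0 cell_lift_outside[OF i, of "\<beta> j" x] not_initial[of i j] j(1) by (metis leI)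
      then show "cell_map i x \<in> (\<Union>j<i. cell_map j ` open_disk (2 * j))"
        unfolding cell_map_def[of i] using j \<open>j < i\<close> cell_image[OF j(1)] by blast
    qed
    then show "\<exists>F. finite F \<and> F \<subseteq> {j \<in> {..<p}. 2 * j < 2 * i} \<and>
        cell_map i ` (unit_disk (2 * i) - open_disk (2 * i)) \<subseteq> (\<Union>j\<in>F. cell_map j ` open_disk (2 * j))"
      using i by (intro exI[of _ "{..<i}"]) auto
  next
    fix S assume S: "S \<subseteq> topspace ?X \<and> (\<forall>i\<in>{..<p}. closedin ?X (S \<inter> cell_map i ` unit_disk (2 * i)))"
    \<comment> \<open>There are finitely many cells, so the weak topology condition reduces to a
      finite union of closed sets.\<close>
    have "closedin ?X (\<Union>i\<in>{..<p}. S \<inter> cell_map i ` unit_disk (2 * i))"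
      using S by (intro closedin_Union) auto
    moreover have "(\<Union>i\<in>{..<p}. S \<inter> cell_map i ` unit_disk (2 * i)) = S"
    proof
      show "S \<subseteq> (\<Union>i\<in>{..<p}. S \<inter> cell_map i ` unit_disk (2 * i))"
      proof
        fix h assume h: "h \<in> S"
        then have "h \<in> (\<Union>i<p. cell_map i ` open_disk (2 * i))" using S UN by auto
        then show "h \<in> (\<Union>i\<in>{..<p}. S \<inter> cell_map i ` unit_disk (2 * i))"
          using h sub(1) by blast
      qed
    qed auto
    ultimately show "closedin ?X S" by simp
  qed
qed

end

section \<open>Quotient maps onto orbit spaces\<close>

text \<open>The nontrivial direction uses the local sections: if the vectors above \<open>U\<close>
  form an open set, then near an orbit in \<open>U\<close> the set \<open>U\<close> contains the
  open preimage of that set under \<open>local_section k\<close>.\<close>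

lemma quotient_map_outer:
  assumes A: "circle_invariant A"
  shows "quotient_map (top_of_set A) (top_of_set (outer ` A)) outer"
  unfolding quotient_map_def
proof (intro conjI allI impI)
  show "outer ` topspace (top_of_set A) = topspace (top_of_set (outer ` A))" by simp
  fix U assume "U \<subseteq> topspace (top_of_set (outer ` A))"
  then have U: "U \<subseteq> outer ` A" by simp
  let ?V = "{z \<in> topspace (top_of_set A). outer z \<in> U}"
  have V: "?V = {z \<in> A. outer z \<in> U}" by simp
  show "openin (top_of_set A) ?V \<longleftrightarrow> openin (top_of_set (outer ` A)) U"
  proof
    assume op: "openin (top_of_set A) ?V"
    show "openin (top_of_set (outer ` A)) U"
    proof (subst openin_subopen, intro ballI)
      fix h assume h: "h \<in> U"
      then obtain z where z: "z \<in> A" "h = outer z" using U by auto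
      have "z \<noteq> (\<lambda>_. 0)" using A z by (auto simp: circle_invariant_def)
      then obtain k where k: "z k \<noteq> 0" by (auto simp: fun_eq_iff)
      let ?T = "outer ` A \<inter> {h. entry h k k \<noteq> 0}"
      have T: "openin (top_of_set (outer ` A)) ?T"
        by (intro openin_open_Int open_entry_nonzero)
      have sec: "local_section k (outer z) \<in> A" "outer (local_section k (outer z)) = outer z"
        if "z \<in> A" "z k \<noteq> 0" for z
        using that A cmod_phase[of "z k"] by (auto simp: local_section_outer circle_invariant_rot outer_rot)
      have "openin (top_of_set ?T) (?T \<inter> local_section k -` ?V)"
      proof (rule continuous_openin_preimage)
        show "continuous_on ?T (local_section k)"
          by (rule continuous_on_subset[OF continuous_on_local_section]) auto
        show "local_section k \<in> ?T \<rightarrow> A" using sec by auto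
        show "openin (top_of_set A) ?V" by (rule op)
      qed
      then have "openin (top_of_set (outer ` A)) (?T \<inter> local_section k -` ?V)"
        using T openin_trans by blast
      moreover have "h \<in> ?T \<inter> local_section k -` ?V" using z k h sec by auto
      moreover have "?T \<inter> local_section k -` ?V \<subseteq> U" using sec by auto
      ultimately show "\<exists>T. openin (top_of_set (outer ` A)) T \<and> h \<in> T \<and> T \<subseteq> U" by blast
    qed
  next
    assume op: "openin (top_of_set (outer ` A)) U"
    have "openin (top_of_set A) (A \<inter> outer -` U)"
      by (rule continuous_openin_preimage[OF continuous_on_outer _ op]) auto
    moreover have "A \<inter> outer -` U = ?V" by auto
    ultimately show "openin (top_of_set A) ?V" by simp
  qed
qed

text \<open>Uniqueness of quotients: two quotient maps with the same fibres factor through each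
  other. Here it links the quotient by congruence to the matrix model.\<close>

lemma homeomorphic_maps_quotients:
  assumes q: "quotient_map X Y q" and r: "quotient_map X Z r"
    and qr: "\<And>x y. x \<in> topspace X \<Longrightarrow> y \<in> topspace X \<Longrightarrow> q x = q y \<longleftrightarrow> r x = r y"
  obtains f g where "homeomorphic_maps Y Z f g" "\<And>x. x \<in> topspace X \<Longrightarrow> f (q x) = r x"
proof -
  define f where "f y = r (SOME x. x \<in> topspace X \<and> q x = y)" for y
  define g where "g z = q (SOME x. x \<in> topspace X \<and> r x = z)" for z
  have f: "f (q x) = r x" if "x \<in> topspace X" for x
  proof -
    have "(SOME x'. x' \<in> topspace X \<and> q x' = q x) \<in> topspace X \<and> q (SOME x'. x' \<in> topspace X \<and> q x' = q x) = q x"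
      by (rule someI[of _ x]) (use that in simp)
    then show ?thesis unfolding f_def using qr that by blast
  qed
  have g: "g (r x) = q x" if "x \<in> topspace X" for x
  proof -
    have "(SOME x'. x' \<in> topspace X \<and> r x' = r x) \<in> topspace X \<and> r (SOME x'. x' \<in> topspace X \<and> r x' = r x) = r x"
      by (rule someI[of _ x]) (use that in simp)
    then show ?thesis unfolding g_def using qr that by blast
  qed
  have "continuous_map X Z (f \<circ> q)"
    by (rule continuous_map_eq[OF quotient_imp_continuous_map[OF r]]) (simp add: f)
  then have 1: "continuous_map Y Z f" by (rule continuous_compose_quotient_map[OF q])
  have "continuous_map X Y (g \<circ> r)"
    by (rule continuous_map_eq[OF quotient_imp_continuous_map[OF q]]) (simp add: g)
  then have 2: "continuous_map Z Y g" by (rule continuous_compose_quotient_map[OF r])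
  have "q ` topspace X = topspace Y" "r ` topspace X = topspace Z"
    using q r by (auto simp: quotient_map_def)
  then have "homeomorphic_maps Y Z f g"
    unfolding homeomorphic_maps_def using 1 2 f g by (auto simp del: image_eqI) (metis imageE)+
  then show ?thesis using f that by blast
qed

section \<open>The plane as the complex numbers\<close>

definition cpx :: "real^2 \<Rightarrow> complex" where
  "cpx v = Complex (v $ 1) (v $ 2)"

definition vec2 :: "complex \<Rightarrow> real^2" where
  "vec2 c = (\<chi> i. if i = 1 then Re c else Im c)"

lemma cpx_vec2 [simp]: "cpx (vec2 c) = c"
  by (simp add: cpx_def vec2_def)

lemma vec2_cpx [simp]: "vec2 (cpx v) = v"
  by (simp add: cpx_def vec2_def vec_eq_iff forall_2)

lemma cpx_eq_iff: "cpx v = cpx w \<longleftrightarrow> v = w"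
  by (metis vec2_cpx)

lemma linear_cpx: "linear cpx"
  by (rule linearI) (simp_all add: cpx_def complex_eq_iff)

lemma linear_vec2: "linear vec2"
  by (rule linearI) (simp_all add: vec2_def vec_eq_iff)

lemma norm_cpx: "cmod (cpx v) = norm v"
  by (simp add: cpx_def cmod_def norm_vec_def L2_set_def sum_2)

lemma dist_cpx: "dist v w = cmod (cpx v - cpx w)"
  by (simp add: dist_norm norm_cpx flip: linear_diff[OF linear_cpx])

text \<open>The linear part sends the standard basis to orthogonal unit vectors
  \<open>\<alpha>\<close> and \<open>\<beta>\<close> with positive determinant. This forces
  \<open>\<beta>\<close> to be \<open>\<alpha>\<close> times the imaginary unit, so the linear part
  is multiplication by \<open>\<alpha>\<close>.\<close>

lemma orientation_preserving_isometry_complex: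
  assumes "orientation_preserving_isometry f"
  obtains c d where "cmod c = 1" "\<And>v. cpx (f v) = c * cpx v + d"
proof -
  define L where "L = (\<lambda>v. f v - f 0)"
  have lin: "linear L" unfolding L_def by (rule orientation_preserving_isometry_linear[OF assms])
  have norm: "norm (L v) = norm v" for v
    using assms by (simp add: L_def orientation_preserving_isometry_def flip: dist_norm)
  define \<alpha> where "\<alpha> = cpx (L (axis 1 1))"
  define \<beta> where "\<beta> = cpx (L (axis 2 1))"
  have det: "0 < det (matrix L)"
    using assms by (simp add: orientation_preserving_isometry_def L_def)
  then have pos: "0 < Re \<alpha> * Im \<beta> - Re \<beta> * Im \<alpha>"
    by (simp add: det_2 matrix_def \<alpha>_def \<beta>_def cpx_def)
  have n1: "cmod \<alpha> = 1" "cmod \<beta> = 1"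
    by (simp_all add: \<alpha>_def \<beta>_def norm_cpx norm norm_axis_1)
  \<comment> \<open>Orthogonality is extracted from the length of the diagonal of the unit
    square.\<close>
  have "cmod (\<alpha> + \<beta>) = norm (axis 1 1 + axis 2 1 :: real^2)"
    using norm[of "axis 1 1 + axis 2 1"]
    by (simp add: \<alpha>_def \<beta>_def linear_add[OF lin] flip: linear_add[OF linear_cpx] norm_cpx)
  also have "\<dots> = sqrt 2"
    by (simp add: norm_vec_def L2_set_def sum_2 axis_def)
  finally have "(cmod (\<alpha> + \<beta>))\<^sup>2 = 2" by simp
  then have "(Re \<alpha> + Re \<beta>)\<^sup>2 + (Im \<alpha> + Im \<beta>)\<^sup>2 = 2" by (simp add: cmod_power2)
  moreover have s1: "(Re \<alpha>)\<^sup>2 + (Im \<alpha>)\<^sup>2 = 1" and s2: "(Re \<beta>)\<^sup>2 + (Im \<beta>)\<^sup>2 = 1"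
    using n1 cmod_power2[of \<alpha>] cmod_power2[of \<beta>] by simp_all
  ultimately have orth: "Re \<alpha> * Re \<beta> + Im \<alpha> * Im \<beta> = 0"
    by (simp add: power2_sum)
  let ?t = "Re \<alpha> * Im \<beta> - Re \<beta> * Im \<alpha>"
  \<comment> \<open>Lagrange's identity: with orthogonal unit vectors the determinant squares to
    1.\<close>
  have "?t\<^sup>2 + (Re \<alpha> * Re \<beta> + Im \<alpha> * Im \<beta>)\<^sup>2 = ((Re \<alpha>)\<^sup>2 + (Im \<alpha>)\<^sup>2) * ((Re \<beta>)\<^sup>2 + (Im \<beta>)\<^sup>2)"
    by (simp add: power2_eq_square algebra_simps)
  then have "?t\<^sup>2 = 1" using orth s1 s2 by simp
  then have t: "?t = 1" using pos by (simp add: power2_eq_1_iff)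
  \<comment> \<open>The left side expands to \<open>2 - 2 * ?t\<close>.\<close>
  have "(Re \<alpha> - Im \<beta>)\<^sup>2 + (Im \<alpha> + Re \<beta>)\<^sup>2 = 0"
    using s1 s2 t by (simp add: power2_eq_square algebra_simps)
  then have b: "Im \<beta> = Re \<alpha>" "Re \<beta> = - Im \<alpha>"
    by (simp_all add: sum_power2_eq_zero_iff)
  have "cpx (f v) = \<alpha> * cpx v + cpx (f 0)" for v
  proof -
    have "v = v $ 1 *\<^sub>R axis 1 1 + v $ 2 *\<^sub>R axis 2 1"
      by (simp add: vec_eq_iff forall_2 axis_def)
    then have "L v = L (v $ 1 *\<^sub>R axis 1 1 + v $ 2 *\<^sub>R axis 2 1)"
      by (rule arg_cong)
    also have "\<dots> = v $ 1 *\<^sub>R L (axis 1 1) + v $ 2 *\<^sub>R L (axis 2 1)"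
      by (simp only: linear_add[OF lin] linear_scale[OF lin])
    finally have "L v = v $ 1 *\<^sub>R L (axis 1 1) + v $ 2 *\<^sub>R L (axis 2 1)" .
    then have "cpx (L v) = v $ 1 *\<^sub>R \<alpha> + v $ 2 *\<^sub>R \<beta>"
      by (simp add: \<alpha>_def \<beta>_def linear_add[OF linear_cpx] linear_scale[OF linear_cpx])
    also have "\<dots> = \<alpha> * cpx v" using b by (simp add: complex_eq_iff cpx_def algebra_simps)
    finally show ?thesis by (simp add: L_def linear_diff[OF linear_cpx] algebra_simps)
  qed
  then show ?thesis using n1(1) that by blast
qed

lemma complex_orientation_preserving_isometry:
  assumes c: "cmod c = 1"
  shows "orientation_preserving_isometry (\<lambda>v. vec2 (c * cpx v + d))"
  unfolding orientation_preserving_isometry_def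
proof (intro conjI allI)
  fix x y
  have "c * cpx x + d - (c * cpx y + d) = c * (cpx x - cpx y)" by (simp add: algebra_simps)
  then show "dist (vec2 (c * cpx x + d)) (vec2 (c * cpx y + d)) = dist x y"
    using c by (simp add: dist_cpx norm_mult)
  have "(\<lambda>v. vec2 (c * cpx v + d) - vec2 (c * cpx 0 + d)) = (\<lambda>v. vec2 (c * cpx v))"
    by (simp add: linear_0[OF linear_cpx] flip: linear_diff[OF linear_vec2])
  moreover have "det (matrix (\<lambda>v. vec2 (c * cpx v))) = Re c * Re c + Im c * Im c"
    by (simp add: det_2 matrix_def vec2_def cpx_def axis_def)
  then have "det (matrix (\<lambda>v. vec2 (c * cpx v))) = (cmod c)\<^sup>2"
    by (simp only: cmod_power2) (simp add: power2_eq_square)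
  ultimately show "0 < det (matrix (\<lambda>v. vec2 (c * cpx v + d) - vec2 (c * cpx 0 + d)))"
    using c by simp
qed

section \<open>Fourier coordinates of polygons\<close>

locale polygons =
  fixes n :: nat
  assumes n: "n \<ge> 3"
begin

abbreviation "pos_modes \<equiv> {k. 0 < k \<and> 2 * k < n}"
abbreviation "neg_modes \<equiv> {k. n < 2 * k \<and> k < n}"
abbreviation "null_modes \<equiv> {k. 2 * k = n}"
abbreviation "modes \<equiv> {1..<n}"

lemma modes_eq: "pos_modes \<union> neg_modes \<union> null_modes = modes"
  using n by auto

lemma modes_disjoint: "pos_modes \<inter> neg_modes = {}" "pos_modes \<inter> null_modes = {}" "neg_modes \<inter> null_modes = {}"
  by auto

lemma modes_finite: "finite pos_modes" "finite neg_modes" "finite null_modes"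
  by (rule finite_subset[of _ "{..n}"], force, simp)+

definition wave :: "nat \<Rightarrow> nat \<Rightarrow> complex" where
  "wave k j = cis (2 * pi * real k * real j / real n)"

lemma wave_commute: "wave k j = wave j k"
  by (simp add: wave_def mult.assoc mult.commute[of "real k"])

lemma cmod_wave [simp]: "cmod (wave k j) = 1"
  by (simp add: wave_def)

lemma wave_0 [simp]: "wave 0 j = 1"
  by (simp add: wave_def)

text \<open>The cyclic shift of the vertices acts on mode \<open>k\<close> as the scalar
  \<open>wave k 1\<close>; its imaginary part becomes the weight of the mode in the area.\<close>

lemma wave_period: "wave k (Suc j mod n) = wave k j * wave k 1" if "j < n"
proof -
  have "wave k (Suc j mod n) = wave k (Suc j)"
  proof (cases "Suc j = n")
    case True
    have "2 * pi * real k * real (Suc j) / real n = 2 * pi * real k"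
      using True n by simp
    then have "wave k (Suc j) = cis (2 * pi * real k)" by (simp only: wave_def)
    also have "\<dots> = 1" by (rule cis_multiple_2pi) simp
    finally show ?thesis using True by (simp add: wave_def)
  next
    case False
    then show ?thesis using that by simp
  qed
  also have "\<dots> = wave k j * wave k 1"
    unfolding wave_def cis_mult by (rule arg_cong[where f = cis]) (use n in \<open>simp add: field_simps\<close>)
  finally show ?thesis .
qed

lemma wave_orthogonal:
  assumes "k < n" "l < n"
  shows "(\<Sum>j<n. wave l j * cnj (wave k j)) = (if l = k then of_nat n else 0)"
proof (cases "l = k")
  case True
  have "wave k j * cnj (wave k j) = 1" for j
    by (metis cmod_wave complex_norm_square mult_1 of_real_1 power2_eq_square)
  then show ?thesis using True by simp
next
  case False
  define x where "x = cis (2 * pi * (real l - real k) / real n)"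
  have summand: "wave l j * cnj (wave k j) = x ^ j" for j
    unfolding wave_def x_def cis_cnj cis_mult Complex.DeMoivre by (rule arg_cong[where f = cis]) (use n in \<open>simp add: field_simps\<close>)
  have "x ^ n = cis (2 * pi * (real l - real k))"
    unfolding x_def Complex.DeMoivre using n by (intro arg_cong[where f = cis]) simp
  also have "\<dots> = 1" by (rule cis_multiple_2pi) simp
  finally have xn: "x ^ n = 1" .
  have "x \<noteq> 1"
  proof
    assume "x = 1"
    then have "cos (2 * pi * (real l - real k) / real n) = 1"
      by (simp add: x_def complex_eq_iff)
    then obtain m :: int where "2 * pi * (real l - real k) / real n = of_int m * 2 * pi"
      unfolding cos_one_2pi_int by blast
    then have "(2 * pi) * ((real l - real k) / real n) = (2 * pi) * of_int m" by (simp add: mult_ac)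
    then have "(real l - real k) / real n = of_int m"
      by (rule mult_left_cancel[THEN iffD1, rotated]) simp
    then have "real l - real k = of_int m * real n" using n by (simp add: field_simps)
    then have "real_of_int (int l - int k) = real_of_int (m * int n)" by simp
    then have m: "int l - int k = m * int n" unfolding of_int_eq_iff .
    \<comment> \<open>A nonzero multiple of \<open>n\<close> is too large to be a difference of two
      indices below \<open>n\<close>.\<close>
    then have "m \<noteq> 0" using False by auto
    then have "int n \<le> \<bar>m * int n\<bar>" using mult_right_mono[of 1 "\<bar>m\<bar>" "int n"] by (simp add: abs_mult)
    then show False using m assms by linarith
  qed
  then show ?thesis
    using False xn by (simp add: summand geometric_sum)
qed

text \<open>Normalizes the coefficients of the area form to \<open>1\<close>, \<open>-1\<close> and \<open>0\<close>.\<close>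

definition mode_scale :: "nat \<Rightarrow> real" where
  "mode_scale k = (if 2 * k = n then 1 else sqrt (2 / (real n * \<bar>sin (2 * pi * real k / real n)\<bar>)))"

lemma sin_mode:
  "k \<in> pos_modes \<Longrightarrow> 0 < sin (2 * pi * real k / real n)"
  "k \<in> neg_modes \<Longrightarrow> sin (2 * pi * real k / real n) < 0"
  "k \<in> null_modes \<Longrightarrow> sin (2 * pi * real k / real n) = 0"
proof -
  assume k: "k \<in> pos_modes"
  then have "real (2 * k) < real n" by (simp only: of_nat_less_iff) simp
  then have "2 * pi * real k / real n < pi" using n by (simp add: field_simps)
  moreover have "0 < 2 * pi * real k / real n" using k n by simp
  ultimately show "0 < sin (2 * pi * real k / real n)" by (intro sin_gt_zero)
next
  assume k: "k \<in> neg_modes"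
  then have "real n < real (2 * k)" by (simp only: of_nat_less_iff) simp
  then have "pi < 2 * pi * real k / real n" using n by (simp add: field_simps)
  moreover have "2 * pi * real k / real n < 2 * pi" using k n by (simp add: field_simps)
  ultimately show "sin (2 * pi * real k / real n) < 0" by (intro sin_lt_zero)
next
  assume "k \<in> null_modes"
  then have "2 * pi * real k / real n = pi" using n by (auto simp: field_simps)
  then show "sin (2 * pi * real k / real n) = 0" by simp
qed

lemma mode_scale_pos: "k \<in> modes \<Longrightarrow> 0 < mode_scale k"
proof -
  assume "k \<in> modes"
  then have "k \<in> pos_modes \<or> k \<in> neg_modes \<or> 2 * k = n" by auto
  then show ?thesis
  proof (cases "2 * k = n")
    case False
    then have "sin (2 * pi * real k / real n) \<noteq> 0"
      using \<open>k \<in> pos_modes \<or> k \<in> neg_modes \<or> 2 * k = n\<close> sin_mode(1,2)[of k] by auto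
    then have "0 < 2 / (real n * \<bar>sin (2 * pi * real k / real n)\<bar>)" using n by simp
    then show ?thesis using False by (simp add: mode_scale_def)
  qed (simp add: mode_scale_def)
qed

lemma mode_scale_nonzero: "k \<in> modes \<Longrightarrow> mode_scale k \<noteq> 0"
  using mode_scale_pos[of k] by simp

lemma weight_sgn: "real n * (sqrt (2 / (real n * \<bar>x\<bar>)))\<^sup>2 * x = 2 * sgn x"
proof -
  have "(sqrt (2 / (real n * \<bar>x\<bar>)))\<^sup>2 = 2 / (real n * \<bar>x\<bar>)" by (rule real_sqrt_pow2) simp
  then show ?thesis using n by (simp add: sgn_if)
qed

lemma mode_weight:
  "k \<in> pos_modes \<Longrightarrow> real n * (mode_scale k)\<^sup>2 * sin (2 * pi * real k / real n) = 2"
  "k \<in> neg_modes \<Longrightarrow> real n * (mode_scale k)\<^sup>2 * sin (2 * pi * real k / real n) = - 2"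
  "k \<in> null_modes \<Longrightarrow> real n * (mode_scale k)\<^sup>2 * sin (2 * pi * real k / real n) = 0"
  using sin_mode[of k] weight_sgn[of "sin (2 * pi * real k / real n)"] by (auto simp: mode_scale_def)

definition coefficient :: "nat \<Rightarrow> (nat \<Rightarrow> real^2) \<Rightarrow> complex" where
  "coefficient k p = (\<Sum>j<n. cpx (p j) * cnj (wave k j)) / of_nat n"

text \<open>Mode 0 is the barycentre of the vertices. Leaving it out divides by translations, and
  rotations then act as the circle \<open>rot\<close>.\<close>

definition coordinates :: "(nat \<Rightarrow> real^2) \<Rightarrow> nat \<Rightarrow> complex" where
  "coordinates p = (\<lambda>k. if k \<in> modes then coefficient k p / of_real (mode_scale k) else 0)"

text \<open>Fourier synthesis with barycentre at the origin: a section of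
  \<open>coordinates\<close>.\<close>

definition polygon :: "(nat \<Rightarrow> complex) \<Rightarrow> nat \<Rightarrow> real^2" where
  "polygon z = (\<lambda>j\<in>{..<n}. vec2 (\<Sum>k\<in>modes. of_real (mode_scale k) * z k * wave k j))"

lemma cpx_polygon: "j < n \<Longrightarrow> cpx (polygon z j) = (\<Sum>k\<in>modes. of_real (mode_scale k) * z k * wave k j)"
  by (simp add: polygon_def)

lemma coefficient_polygon:
  assumes "l < n"
  shows "coefficient l (polygon z) = (if l = 0 then 0 else of_real (mode_scale l) * z l)"
proof -
  have "(\<Sum>j<n. cpx (polygon z j) * cnj (wave l j))
      = (\<Sum>j<n. \<Sum>k\<in>modes. of_real (mode_scale k) * z k * (wave k j * cnj (wave l j)))"
    by (intro sum.cong refl) (simp add: cpx_polygon sum_distrib_right mult.assoc)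
  also have "\<dots> = (\<Sum>k\<in>modes. of_real (mode_scale k) * z k * (\<Sum>j<n. wave k j * cnj (wave l j)))"
    by (subst sum.swap) (simp add: sum_distrib_left)
  also have "\<dots> = (\<Sum>k\<in>modes. if k = l then of_real (mode_scale l) * z l * of_nat n else 0)"
    by (intro sum.cong refl) (use assms in \<open>simp add: wave_orthogonal\<close>)
  also have "\<dots> = (if l = 0 then 0 else of_real (mode_scale l) * z l * of_nat n)"
    using assms by (simp add: sum.delta)
  finally show ?thesis using n by (simp add: coefficient_def)
qed

lemma coordinates_polygon: "z \<in> cspace modes \<Longrightarrow> coordinates (polygon z) = z"
proof
  fix k assume z: "z \<in> cspace modes"
  show "coordinates (polygon z) k = z k"
  proof (cases "k \<in> modes")
    case True
    then show ?thesis using mode_scale_pos[OF True] by (simp add: coordinates_def coefficient_polygon)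
  next
    case False
    then show ?thesis using z by (simp only: coordinates_def cspace_def) auto
  qed
qed

text \<open>Because \<open>wave\<close> is symmetric in mode and vertex, orthogonality over the
  vertices also serves for the sum over the modes.\<close>

lemma fourier_inversion:
  assumes "j < n"
  shows "cpx (p j) = (\<Sum>k<n. coefficient k p * wave k j)"
proof -
  have "(\<Sum>k<n. coefficient k p * wave k j)
      = (\<Sum>k<n. \<Sum>i<n. cpx (p i) * (wave j k * cnj (wave i k)) / of_nat n)"
    unfolding coefficient_def sum_distrib_right sum_divide_distrib
  proof (intro sum.cong refl)
    fix k i
    show "cpx (p i) * cnj (wave k i) / of_nat n * wave k j = cpx (p i) * (wave j k * cnj (wave i k)) / of_nat n"
      by (simp add: wave_commute[of k j] wave_commute[of k i])
  qed
  also have "\<dots> = (\<Sum>i<n. cpx (p i) * (\<Sum>k<n. wave j k * cnj (wave i k)) / of_nat n)"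
    by (subst sum.swap) (simp add: sum_distrib_left sum_divide_distrib)
  also have "\<dots> = (\<Sum>i<n. if i = j then cpx (p j) else 0)"
    by (intro sum.cong refl) (use assms n in \<open>auto simp: wave_orthogonal\<close>)
  also have "\<dots> = cpx (p j)" using assms by simp
  finally show ?thesis by simp
qed

lemma cpx_eq_coordinates:
  assumes "j < n"
  shows "cpx (p j) = coefficient 0 p + (\<Sum>k\<in>modes. of_real (mode_scale k) * coordinates p k * wave k j)"
proof -
  have "{..<n} = insert 0 modes" using n by auto
  then have "cpx (p j) = coefficient 0 p + (\<Sum>k\<in>modes. coefficient k p * wave k j)"
    using fourier_inversion[OF assms, of p] by simp
  also have "(\<Sum>k\<in>modes. coefficient k p * wave k j) = (\<Sum>k\<in>modes. of_real (mode_scale k) * coordinates p k * wave k j)"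
  proof (intro sum.cong refl)
    fix k assume "k \<in> modes"
    then show "coefficient k p * wave k j = of_real (mode_scale k) * coordinates p k * wave k j"
      using mode_scale_nonzero[of k] by (simp add: coordinates_def)
  qed
  finally show ?thesis .
qed

lemma cpx_polygon_coordinates: "j < n \<Longrightarrow> cpx (p j) = coefficient 0 p + cpx (polygon (coordinates p) j)"
  using cpx_eq_coordinates cpx_polygon by simp

lemma coefficient_affine:
  assumes "\<And>j. j < n \<Longrightarrow> cpx (q j) = c * cpx (p j) + d" "k \<in> modes"
  shows "coefficient k q = c * coefficient k p"
proof -
  \<comment> \<open>Orthogonality to mode 0 removes the translation part.\<close>
  have "(\<Sum>j<n. cnj (wave k j)) = 0"
    using wave_orthogonal[of k 0] assms(2) by simp
  moreover have "(\<Sum>j<n. cpx (q j) * cnj (wave k j))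
      = c * (\<Sum>j<n. cpx (p j) * cnj (wave k j)) + d * (\<Sum>j<n. cnj (wave k j))"
    unfolding sum_distrib_left sum.distrib[symmetric]
    by (intro sum.cong refl) (simp add: assms(1) algebra_simps)
  ultimately show ?thesis by (simp add: coefficient_def)
qed

lemma coordinates_affine:
  assumes "\<And>j. j < n \<Longrightarrow> cpx (q j) = c * cpx (p j) + d"
  shows "coordinates q = rot c (coordinates p)"
  using coefficient_affine[OF assms] by (auto simp: coordinates_def rot_def fun_eq_iff)

abbreviation "nonzero \<equiv> cspace modes - {\<lambda>_. 0}"

lemma circle_invariant_nonzero: "circle_invariant nonzero"
  by (auto simp: circle_invariant_def cspace_rot rot_eq_0)

lemma coordinates_in_nonzero:
  assumes "p \<in> vertex_tuples n"
  shows "coordinates p \<in> nonzero"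
proof -
  have "coordinates p \<noteq> (\<lambda>_. 0)"
  proof
    assume "coordinates p = (\<lambda>_. 0)"
    then have "cpx (p j) = coefficient 0 p" if "j < n" for j
      using cpx_eq_coordinates[OF that, of p] by simp
    then have "p i = p j" if "i < n" "j < n" for i j
      using that by (metis cpx_eq_iff)
    then show False using assms by (auto simp: vertex_tuples_def)
  qed
  then show ?thesis by (auto simp: coordinates_def cspace_def)
qed

lemma polygon_in_vertex_tuples:
  assumes "z \<in> nonzero"
  shows "polygon z \<in> vertex_tuples n"
proof -
  have "\<exists>i<n. \<exists>j<n. polygon z i \<noteq> polygon z j"
  proof (rule ccontr)
    assume *: "\<not> ?thesis"
    \<comment> \<open>A constant polygon is its own image under an affine map with factor 0, so
      \<open>coordinates_affine\<close> makes all its coordinates vanish.\<close>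
    have "cpx (polygon z j) = 0 * cpx (polygon z j) + cpx (polygon z 0)" if "j < n" for j
      using * that n by (metis add_0 less_le_trans mult_zero_left zero_less_numeral)
    then have "coordinates (polygon z) = rot 0 (coordinates (polygon z))"
      by (rule coordinates_affine)
    then have "z = rot 0 z" using coordinates_polygon[of z] assms by simp
    then show False using assms by (simp add: rot_def)
  qed
  then show ?thesis by (auto simp: vertex_tuples_def polygon_def)
qed

text \<open>An isometry acts on the modes other than 0 through its rotation factor alone;
  conversely, a common phase extends to an isometry once the barycentres are matched.\<close>

lemma polygon_rel_iff:
  assumes p: "p \<in> vertex_tuples n" and q: "q \<in> vertex_tuples n"
  shows "(p, q) \<in> polygon_rel n \<longleftrightarrow> outer (coordinates p) = outer (coordinates q)"
proof
  assume "(p, q) \<in> polygon_rel n"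
  then obtain f where f: "orientation_preserving_isometry f" "\<And>i. i < n \<Longrightarrow> q i = f (p i)"
    by (auto simp: polygon_rel_def)
  obtain c d where cd: "cmod c = 1" "\<And>v. cpx (f v) = c * cpx v + d"
    using orientation_preserving_isometry_complex[OF f(1)] by blast
  have "coordinates q = rot c (coordinates p)"
    by (rule coordinates_affine) (simp add: f cd)
  then show "outer (coordinates p) = outer (coordinates q)"
    using outer_rot[OF cd(1)] by simp
next
  assume "outer (coordinates p) = outer (coordinates q)"
  then obtain c where c: "cmod c = 1" "coordinates q = rot c (coordinates p)"
    using outer_eq_iff by blast
  \<comment> \<open>The translation that carries the rotated barycentre of \<open>p\<close> to that
    of \<open>q\<close>.\<close>
  let ?d = "coefficient 0 q - c * coefficient 0 p"
  have "q j = vec2 (c * cpx (p j) + ?d)" if "j < n" for j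
  proof -
    have "cpx (q j) = c * cpx (p j) + ?d"
      unfolding cpx_eq_coordinates[OF that] c(2)
      by (simp add: rot_def algebra_simps sum_distrib_left)
    then show ?thesis by (metis vec2_cpx)
  qed
  then show "(p, q) \<in> polygon_rel n"
    using complex_orientation_preserving_isometry[OF c(1), of ?d] p q
    unfolding polygon_rel_def by blast
qed

text \<open>\<open>polygon\<close> is a continuous section of \<open>coordinates\<close>, and a map
  with a continuous section is a quotient map; composing with \<open>outer\<close> preserves this
  property.\<close>

lemma quotient_map_polygon_coordinates:
  "quotient_map (subtopology (product_topology (\<lambda>_. euclidean) {..<n}) (vertex_tuples n))
     (top_of_set (outer ` nonzero)) (outer \<circ> coordinates)"
proof (rule quotient_map_compose)
  let ?X = "subtopology (product_topology (\<lambda>_. euclidean :: (real^2) topology) {..<n}) (vertex_tuples n)"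
  have top: "topspace ?X = vertex_tuples n"
    by (auto simp: vertex_tuples_def)
  have "retraction_maps ?X (top_of_set nonzero) coordinates polygon"
    unfolding retraction_maps_def
  proof (intro conjI ballI)
    have proj: "continuous_map ?X euclidean (\<lambda>p. p j)" if "j < n" for j
      by (rule continuous_map_from_subtopology) (use that in \<open>auto intro: continuous_map_product_projection\<close>)
    have lin: "continuous_on UNIV (\<lambda>v. cpx v * w)" for w
      by (intro continuous_on_mult linear_continuous_on linear_conv_bounded_linear[THEN iffD1] linear_cpx continuous_on_const)
    have summand: "continuous_map ?X euclidean (\<lambda>p. cpx (p j) * w)" if "j < n" for j w
      using continuous_map_compose[OF proj[OF that], of euclidean "\<lambda>v. cpx v * w"] lin by (simp add: o_def)
    have coord: "continuous_map ?X euclidean (\<lambda>p. coordinates p k)" for k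
    proof (cases "k \<in> modes")
      case True
      let ?w = "\<lambda>j. cnj (wave k j) / of_nat n / of_real (mode_scale k)"
      have "continuous_map ?X euclidean (\<lambda>p. \<Sum>j<n. cpx (p j) * ?w j)"
        by (intro continuous_map_sum summand) auto
      moreover have "(\<lambda>p. \<Sum>j<n. cpx (p j) * ?w j) = (\<lambda>p. coordinates p k)"
        using True by (simp add: coordinates_def coefficient_def sum_divide_distrib)
      ultimately show ?thesis by simp
    next
      case False
      then have "(\<lambda>p. coordinates p k) = (\<lambda>p. 0)" by (auto simp: coordinates_def)
      then show ?thesis by simp
    qed
    have "continuous_map ?X (product_topology (\<lambda>_. euclidean) UNIV) coordinates"
      using coord by (simp add: continuous_map_componentwise_UNIV)
    then show "continuous_map ?X (top_of_set nonzero) coordinates"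
      using coordinates_in_nonzero top by (auto simp: continuous_map_in_subtopology euclidean_product_topology)
    have "continuous_on nonzero (\<lambda>z. polygon z j)" if "j < n" for j
    proof -
      have "continuous_on nonzero (\<lambda>z. \<Sum>k\<in>modes. of_real (mode_scale k) * z k * wave k j)"
        by (intro continuous_intros)
      moreover have "continuous_on UNIV vec2"
        by (intro linear_continuous_on linear_conv_bounded_linear[THEN iffD1] linear_vec2)
      ultimately show ?thesis
        using that by (auto simp: polygon_def intro: continuous_on_compose2)
    qed
    then show "continuous_map (top_of_set nonzero) ?X polygon"
      unfolding continuous_map_in_subtopology continuous_map_componentwise
      using polygon_in_vertex_tuples by (auto simp: polygon_def)
    show "coordinates (polygon z) = z" if "z \<in> topspace (top_of_set nonzero)" for z
      using that coordinates_polygon by simp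
  qed
  then show "quotient_map ?X (top_of_set nonzero) coordinates"
    by (intro retraction_imp_quotient_map) (auto simp: retraction_map_def)
qed (rule quotient_map_outer[OF circle_invariant_nonzero])

text \<open>Congruence classes and matrices are quotients of the same vertex tuples with the same
  fibres. The homeomorphism is restricted for an arbitrary property, so that it applies to area
  alone and to area together with perimeter.\<close>

theorem polygon_subspace_homeomorphic:
  assumes PQ: "\<And>p. p \<in> vertex_tuples n \<Longrightarrow> P p \<longleftrightarrow> Q (coordinates p)"
  shows "subtopology (polygon_space n) {polygon_rel n `` {p} |p. p \<in> vertex_tuples n \<and> P p}
    homeomorphic_space top_of_set (outer ` {z \<in> nonzero. Q z})"
proof -
  let ?X = "subtopology (product_topology (\<lambda>_. euclidean :: (real^2) topology) {..<n}) (vertex_tuples n)"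
  have top: "topspace ?X = vertex_tuples n"
    by (auto simp: vertex_tuples_def)
  let ?q = "\<lambda>p. polygon_rel n `` {p}" and ?r = "outer \<circ> coordinates"
  have q: "quotient_map ?X (polygon_space n) ?q"
    unfolding polygon_space_def by (rule quotient_map_quotient_topology)
  have qr: "?q p = ?q p' \<longleftrightarrow> ?r p = ?r p'" if "p \<in> topspace ?X" "p' \<in> topspace ?X" for p p'
    using that polygon_rel_iff[of p p'] eq_equiv_class_iff[OF equiv_polygon_rel, of p n p'] unfolding top by simp
  obtain f g where fg: "homeomorphic_maps (polygon_space n) (top_of_set (outer ` nonzero)) f g"
    and f: "\<And>p. p \<in> vertex_tuples n \<Longrightarrow> f (?q p) = outer (coordinates p)"
    using homeomorphic_maps_quotients[OF q quotient_map_polygon_coordinates qr] unfolding top o_apply by blast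
  let ?S = "{?q p |p. p \<in> vertex_tuples n \<and> P p}" and ?T = "outer ` {z \<in> nonzero. Q z}"
  have S: "?S \<subseteq> topspace (polygon_space n)"
    using q unfolding quotient_map_def top by blast
  have "f ` ?S = ?T"
  proof
    show "f ` ?S \<subseteq> ?T"
    proof (rule image_subsetI)
      fix c assume "c \<in> ?S"
      then obtain p where p: "p \<in> vertex_tuples n" "P p" "c = ?q p" by blast
      then show "f c \<in> ?T"
        using f[OF p(1)] PQ[OF p(1)] coordinates_in_nonzero[OF p(1)] by simp
    qed
    show "?T \<subseteq> f ` ?S"
    proof (rule image_subsetI)
      fix z assume "z \<in> {z \<in> nonzero. Q z}"
      then have z: "z \<in> cspace modes" "Q z" "z \<noteq> (\<lambda>_. 0)" by simp_all
      then have v: "polygon z \<in> vertex_tuples n" by (intro polygon_in_vertex_tuples) simp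
      have "f (?q (polygon z)) = outer z"
        using f[OF v] coordinates_polygon[OF z(1)] by simp
      moreover have "P (polygon z)" using PQ[OF v] coordinates_polygon[OF z(1)] z by simp
      ultimately show "outer z \<in> f ` ?S" using v by (intro rev_image_eqI[of "?q (polygon z)"]) (blast, simp)
    qed
  qed
  moreover have "topspace (polygon_space n) \<inter> ?S = ?S" "topspace (top_of_set (outer ` nonzero)) \<inter> ?T = ?T"
    using S by auto
  ultimately have "f ` (topspace (polygon_space n) \<inter> ?S) = topspace (top_of_set (outer ` nonzero)) \<inter> ?T"
    by (simp only:)
  from homeomorphic_maps_subtopologies[OF fg this]
  have "subtopology (polygon_space n) ?S homeomorphic_space subtopology (top_of_set (outer ` nonzero)) ?T"
    by (rule homeomorphic_maps_imp_homeomorphic_space)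
  moreover have "?T \<subseteq> outer ` nonzero" by blast
  then have "subtopology (top_of_set (outer ` nonzero)) ?T = top_of_set ?T"
    by (simp only: subtopology_subtopology Int_absorb1)
  ultimately show ?thesis by simp
qed

text \<open>Twice the area is the imaginary part of the Hermitian product of the vertex sequence
  with its shift. The Fourier basis diagonalizes this product, and \<open>mode_scale\<close> was
  chosen to normalize the resulting weights.\<close>

lemma oriented_area_coordinates:
  assumes "p \<in> vertex_tuples n"
  shows "oriented_area n p = sqn pos_modes (coordinates p) - sqn neg_modes (coordinates p)"
proof -
  let ?c = "\<lambda>k. coefficient k p"
  have succ: "cpx (p (Suc j mod n)) = (\<Sum>l<n. ?c l * wave l 1 * wave l j)" if "j < n" for j
  proof -
    have "Suc j mod n < n" using n by simp
    then show ?thesis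
      using fourier_inversion[of "Suc j mod n" p] wave_period[OF that] by (simp add: mult_ac)
  qed
  have "(\<Sum>j<n. cnj (cpx (p j)) * cpx (p (Suc j mod n)))
     = (\<Sum>j<n. \<Sum>k<n. \<Sum>l<n. cnj (?c k) * ?c l * wave l 1 * (wave l j * cnj (wave k j)))"
  proof (intro sum.cong refl)
    fix j assume "j \<in> {..<n}"
    then have j: "j < n" by simp
    show "cnj (cpx (p j)) * cpx (p (Suc j mod n))
       = (\<Sum>k<n. \<Sum>l<n. cnj (?c k) * ?c l * wave l 1 * (wave l j * cnj (wave k j)))"
      unfolding succ[OF j] unfolding fourier_inversion[OF j] cnj_sum sum_product
      by (intro sum.cong refl) (simp add: mult_ac)
  qed
  also have "\<dots> = (\<Sum>k<n. \<Sum>j<n. \<Sum>l<n. cnj (?c k) * ?c l * wave l 1 * (wave l j * cnj (wave k j)))"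
    by (rule sum.swap)
  also have "\<dots> = (\<Sum>k<n. \<Sum>l<n. \<Sum>j<n. cnj (?c k) * ?c l * wave l 1 * (wave l j * cnj (wave k j)))"
    by (intro sum.cong refl sum.swap)
  also have "\<dots> = (\<Sum>k<n. \<Sum>l<n. cnj (?c k) * ?c l * wave l 1 * (if l = k then of_nat n else 0))"
    by (intro sum.cong refl) (simp add: wave_orthogonal flip: sum_distrib_left)
  also have "\<dots> = (\<Sum>k<n. cnj (?c k) * ?c k * wave k 1 * of_nat n)"
    by (intro sum.cong refl) (simp add: if_distrib cong: if_cong)
  also have "\<dots> = (\<Sum>k<n. of_real (real n * (cmod (?c k))\<^sup>2) * wave k 1)"
  proof (intro sum.cong refl)
    fix k
    have "cnj (?c k) * ?c k = of_real ((cmod (?c k))\<^sup>2)" by (metis complex_norm_square mult.commute)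
    then show "cnj (?c k) * ?c k * wave k 1 * of_nat n = of_real (real n * (cmod (?c k))\<^sup>2) * wave k 1"
      by simp
  qed
  finally have eq: "(\<Sum>j<n. cnj (cpx (p j)) * cpx (p (Suc j mod n)))
     = (\<Sum>k<n. of_real (real n * (cmod (?c k))\<^sup>2) * wave k 1)" .
  \<comment> \<open>The imaginary part of \<open>cnj v * w\<close> is the determinant of the plane
    vectors \<open>v\<close> and \<open>w\<close>.\<close>
  have "2 * oriented_area n p = Im (\<Sum>j<n. cnj (cpx (p j)) * cpx (p (Suc j mod n)))"
    by (simp add: oriented_area_def cpx_def Im_sum algebra_simps)
  also have "\<dots> = (\<Sum>k<n. real n * (cmod (?c k))\<^sup>2 * sin (2 * pi * real k / real n))"
    unfolding eq Im_sum by (intro sum.cong refl) (simp add: wave_def)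
  \<comment> \<open>Mode 0 drops out because its sine is 0, in accordance with translation
    invariance.\<close>
  also have "\<dots> = (\<Sum>k\<in>modes. real n * (cmod (?c k))\<^sup>2 * sin (2 * pi * real k / real n))"
    by (rule sum.mono_neutral_right) (auto simp: not_le less_Suc0)
  also have "\<dots> = (\<Sum>k\<in>modes. real n * (mode_scale k)\<^sup>2 * sin (2 * pi * real k / real n) * (cmod (coordinates p k))\<^sup>2)"
  proof (intro sum.cong refl)
    fix k assume k: "k \<in> modes"
    then have "?c k = of_real (mode_scale k) * coordinates p k"
      using mode_scale_pos[OF k] by (simp add: coordinates_def)
    then show "real n * (cmod (?c k))\<^sup>2 * sin (2 * pi * real k / real n)
      = real n * (mode_scale k)\<^sup>2 * sin (2 * pi * real k / real n) * (cmod (coordinates p k))\<^sup>2"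
      by (simp add: norm_mult power_mult_distrib)
  qed
  also have "\<dots> = 2 * sqn pos_modes (coordinates p) - 2 * sqn neg_modes (coordinates p)"
  proof -
    have "sum h modes = sum h pos_modes + sum h neg_modes + sum h null_modes" for h :: "nat \<Rightarrow> real"
    proof -
      have "(pos_modes \<union> neg_modes) \<inter> null_modes = {}" by auto
      then show ?thesis
        unfolding modes_eq[symmetric] using modes_finite modes_disjoint by (simp add: sum.union_disjoint)
    qed
    then show ?thesis by (simp add: mode_weight sqn_def sum_distrib_left sum_negf)
  qed
  finally show ?thesis by simp
qed

lemma perimeter_coordinates:
  assumes "p \<in> vertex_tuples n"
  shows "perimeter n p = perimeter n (polygon (coordinates p))"
  unfolding perimeter_def
proof (intro sum.cong refl)
  fix j assume "j \<in> {..<n}"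
  then have "j < n" "Suc j mod n < n" using n by auto
  then show "dist (p j) (p (Suc j mod n)) = dist (polygon (coordinates p) j) (polygon (coordinates p) (Suc j mod n))"
    using cpx_polygon_coordinates[of _ p] by (simp add: dist_cpx)
qed

end

section \<open>Mode counts and the statements for polygons\<close>

context polygons
begin

text \<open>Counts the positive modes and, by the reflection of \<open>k\<close> to
  \<open>n - k\<close>, also the negative ones.\<close>

definition half :: nat where "half = (n - 1) div 2"

lemma card_modes: "card pos_modes = half" "card neg_modes = half" "card null_modes = n - 1 - 2 * half"
proof -
  have "pos_modes = {1..half}" unfolding half_def by auto
  then show "card pos_modes = half" by simp
  have "neg_modes = {n - half..<n}" unfolding half_def by auto
  then show "card neg_modes = half" by (simp add: half_def)
  have "even n \<Longrightarrow> null_modes = {n div 2}" "odd n \<Longrightarrow> null_modes = {}" by auto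
  then show "card null_modes = n - 1 - 2 * half"
    using n by (cases "even n") (auto simp: half_def elim!: evenE oddE)
qed

lemma half_pos: "1 \<le> half"
  using n by (simp add: half_def)

lemma half_le: "2 * half \<le> n - 1"
  by (simp add: half_def)

lemma card_null_le: "n - 1 - 2 * half \<le> 1"
proof -
  have "n - 1 = 2 * half + (n - 1) mod 2" "(n - 1) mod 2 < 2" unfolding half_def by simp_all
  then show ?thesis by linarith
qed

lemma area_space_homeomorphic:
  "area_space n a homeomorphic_space top_of_set (outer ` quadric pos_modes neg_modes null_modes a)"
proof -
  have "area_space n a homeomorphic_space
      top_of_set (outer ` {z \<in> nonzero. sqn pos_modes z - sqn neg_modes z = a})"
    unfolding area_space_def
    by (rule polygon_subspace_homeomorphic) (simp add: oriented_area_coordinates)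
  moreover have "{z \<in> nonzero. sqn pos_modes z - sqn neg_modes z = a} = quadric pos_modes neg_modes null_modes a"
    unfolding quadric_def modes_eq by auto
  ultimately show ?thesis by simp
qed

lemma nonzero_area:
  assumes "a \<noteq> 0"
  shows "topological_manifold (2 * n - 4) (area_space n a)"
    and "\<exists>(K :: (nat \<Rightarrow> real) topology) (I :: nat set) d \<Phi>.
           cw_structure K I d \<Phi> \<and>
           area_space n a homotopy_equivalent_space K \<and>
           bij_betw d I {k. even k \<and> k \<le> 2 * ((n + 1) div 2) - 4}"
proof -
  obtain A B where AB: "finite A" "finite B" "A \<inter> B = {}" "A \<inter> null_modes = {}" "B \<inter> null_modes = {}"
      "card A = half" "card B = half"
    and hom: "area_space n a homeomorphic_space top_of_set (outer ` quadric A B null_modes \<bar>a\<bar>)"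
  proof (cases "0 < a")
    case True
    then have "area_space n a homeomorphic_space top_of_set (outer ` quadric pos_modes neg_modes null_modes \<bar>a\<bar>)"
      using area_space_homeomorphic[of a] by (simp only: abs_of_pos)
    then show ?thesis
      by (rule that[OF modes_finite(1,2) modes_disjoint card_modes(1,2)])
  next
    case False
    \<comment> \<open>Changing the sign of the form exchanges the two kinds of modes and reduces
      negative areas to positive ones.\<close>
    then have "quadric pos_modes neg_modes null_modes a = quadric neg_modes pos_modes null_modes \<bar>a\<bar>"
      unfolding quadric_swap[of neg_modes pos_modes null_modes a, symmetric] by (simp only: abs_of_nonpos not_less)
    then have "area_space n a homeomorphic_space top_of_set (outer ` quadric neg_modes pos_modes null_modes \<bar>a\<bar>)"
      using area_space_homeomorphic[of a] by (simp only:)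
    moreover have "neg_modes \<inter> pos_modes = {}" using modes_disjoint(1) by (simp only: Int_commute)
    ultimately show ?thesis
      using that[OF modes_finite(2,1) _ modes_disjoint(3,2) card_modes(2,1)] by blast
  qed
  have pos: "0 < \<bar>a\<bar>" using assms by simp
  have "topological_manifold (2 * (card A + card B + card null_modes - 1))
      (top_of_set (outer ` quadric A B null_modes \<bar>a\<bar>))"
    by (rule topological_manifold_quadric) (use AB modes_finite pos in auto)
  moreover have "2 * (card A + card B + card null_modes - 1) = 2 * n - 4"
    using AB card_modes half_pos half_le by simp
  ultimately show "topological_manifold (2 * n - 4) (area_space n a)"
    using topological_manifold_homeomorphic[OF hom] by simp
  obtain \<beta> where "bij_betw \<beta> {..<half} A" using obtain_enumeration[OF AB(1)] AB(6) by metis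
  then interpret enumerated_index_set A half \<beta> by unfold_locales
  have "area_space n a homotopy_equivalent_space top_of_set (outer ` csphere A)"
    using homeomorphic_imp_homotopy_equivalent_space[OF hom]
      quadric_homotopy_equivalent_csphere[OF AB(1,3) pos, of null_modes]
    by (rule homotopy_eqv_trans)
  moreover have "bij_betw (\<lambda>i. 2 * i) {..<half} {k. even k \<and> k \<le> 2 * ((n + 1) div 2) - 4}"
  proof -
    \<comment> \<open>The projective space of \<open>half\<close> homogeneous coordinates has
      complex dimension \<open>half - 1\<close>.\<close>
    have "2 * ((n + 1) div 2) - 4 = 2 * (half - 1)" using n unfolding half_def by presburger
    then have "{k. even k \<and> k \<le> 2 * ((n + 1) div 2) - 4} = (\<lambda>i. 2 * i) ` {..<half}"
      using half_pos by (auto simp: image_iff elim!: evenE)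
    then show ?thesis by (auto simp: bij_betw_def inj_on_def)
  qed
  ultimately show "\<exists>(K :: (nat \<Rightarrow> real) topology) (I :: nat set) d \<Phi>.
           cw_structure K I d \<Phi> \<and>
           area_space n a homotopy_equivalent_space K \<and>
           bij_betw d I {k. even k \<and> k \<le> 2 * ((n + 1) div 2) - 4}"
    using cw_structure_csphere by blast
qed

lemma homology_area_0: "Z_or_trivial (quadric_degrees half half (n - 1 - 2 * half) j) (homology_group j (area_space n 0))"
proof -
  have Z: "Z_or_trivial (quadric_degrees (card pos_modes) (card neg_modes) (card null_modes) j)
     (homology_group j (top_of_set (outer ` quadric pos_modes neg_modes null_modes 0)))"
  proof (rule homology_quadric)
    show "neg_modes \<noteq> {}" using card_modes(2) half_pos by (metis card.empty not_one_le_zero)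
  qed (use modes_finite modes_disjoint card_null_le in \<open>auto simp: card_modes\<close>)
  show ?thesis
    by (rule Z_or_trivial_iso[OF homeomorphic_space_imp_isomorphic_homology_groups[OF area_space_homeomorphic[of 0]]
          Z[unfolded card_modes]]) simp_all
qed

text \<open>The bounds differ only by rounding. For odd \<open>n\<close> the bound
  \<open>n - 2\<close> is odd and thus one too large for even degrees; for even \<open>n\<close>,
  where a null mode is present, it is even and one too small for odd degrees.\<close>

lemma zero_area_homology_eq:
  "zero_area_homology n j = (if quadric_degrees half half (n - 1 - 2 * half) j then integer_group else singleton_group 0)"
proof -
  have "n = 2 * half + 1 \<and> n - 1 - 2 * half = 0 \<or> n = 2 * half + 2 \<and> n - 1 - 2 * half = 1"
  proof -
    have "n = 2 * half + (n - 1) mod 2 + 1" using n unfolding half_def by simp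
    moreover have "(n - 1) mod 2 = 0 \<or> (n - 1) mod 2 = 1" by auto
    ultimately show ?thesis by auto
  qed
  then show ?thesis
  proof (elim disjE conjE)
    assume odd: "n = 2 * half + 1" "n - 1 - 2 * half = 0"
    have "even j \<Longrightarrow> j \<le> 2 * x - 1 \<longleftrightarrow> j \<le> 2 * x - 2" for x :: int by presburger
    from this[of "int half"] show ?thesis
      unfolding zero_area_homology_def quadric_degrees_def odd(2) by (subst (1 2 3) odd(1)) auto
  next
    assume even: "n = 2 * half + 2" "n - 1 - 2 * half = 1"
    have "odd j \<Longrightarrow> 2 * x \<le> j \<longleftrightarrow> 2 * x + 1 \<le> j" for x :: int by presburger
    from this[of "int half"] show ?thesis
      unfolding zero_area_homology_def quadric_degrees_def even(2) by (subst (1 2 3) even(1)) auto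
  qed
qed

section \<open>The perimeter as radial coordinate on the null cone\<close>

definition perim :: "(nat \<Rightarrow> complex) \<Rightarrow> real" where
  "perim z = perimeter n (polygon z)"

lemma perim_eq: "perim z = (\<Sum>j<n. cmod ((\<Sum>k\<in>modes. of_real (mode_scale k) * z k * wave k j)
    - (\<Sum>k\<in>modes. of_real (mode_scale k) * z k * wave k (Suc j mod n))))"
  unfolding perim_def perimeter_def using n
  by (intro sum.cong refl) (simp add: dist_cpx cpx_polygon)

text \<open>A complex factor covers both uses: homogeneity for positive reals and invariance for
  phases.\<close>

lemma perim_scale: "perim (\<lambda>k. c * z k) = cmod c * perim z"
proof -
  have inner: "(\<Sum>k\<in>modes. of_real (mode_scale k) * (c * z k) * wave k j)
     = c * (\<Sum>k\<in>modes. of_real (mode_scale k) * z k * wave k j)" for j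
    by (simp add: sum_distrib_left mult_ac)
  show ?thesis
    unfolding perim_eq inner
    by (simp only: right_diff_distrib[symmetric] norm_mult sum_distrib_left[symmetric, where r = "cmod c"])
qed

lemma continuous_on_perim: "continuous_on S perim"
  unfolding perim_eq by (intro continuous_intros)

lemma perim_pos:
  assumes "z \<in> nonzero"
  shows "0 < perim z"
proof -
  define p where "p = polygon z"
  have sum: "perim z = (\<Sum>j<n. dist (p j) (p (Suc j mod n)))"
    by (simp only: perim_def perimeter_def p_def)
  have "perim z \<noteq> 0"
  proof
    assume "perim z = 0"
    then have *: "\<forall>j\<in>{..<n}. dist (p j) (p (Suc j mod n)) = 0"
      unfolding sum by (subst (asm) sum_nonneg_eq_0_iff) (rule finite_lessThan zero_le_dist | assumption)+
    have eq: "p j = p (Suc j mod n)" if "j < n" for j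
      using bspec[OF *, of j] that by simp
    have p0: "p j = p 0" if "j < n" for j
      using that
    proof (induction j)
      case (Suc j)
      then show ?case using eq[of j] by simp
    qed simp
    have "p \<in> vertex_tuples n"
      unfolding p_def using assms by (rule polygon_in_vertex_tuples)
    then obtain i j where ij: "i < n" "j < n" "p i \<noteq> p j"
      unfolding vertex_tuples_def by blast
    then show False using p0[OF ij(1)] p0[OF ij(2)] by simp
  qed
  moreover have "0 \<le> perim z" unfolding sum by (rule sum_nonneg) simp
  ultimately show ?thesis by simp
qed

abbreviation "null_cone \<equiv> quadric pos_modes neg_modes null_modes 0"

lemma null_cone_nonzero: "null_cone \<subseteq> nonzero"
  unfolding quadric_def modes_eq by auto

lemma null_cone_scale: "r \<noteq> 0 \<Longrightarrow> z \<in> null_cone \<Longrightarrow> (\<lambda>k. of_real r * z k) \<in> null_cone"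
proof -
  assume r: "r \<noteq> 0" and z: "z \<in> null_cone"
  have "sqn D (\<lambda>k. of_real r * z k) = r\<^sup>2 * sqn D z" for D
    using sqn_scale[of D "\<lambda>k. of_real r * z k" "\<bar>r\<bar>" z] by (simp add: norm_mult)
  then show ?thesis using r z by (auto simp: quadric_def cspace_def fun_eq_iff)
qed

lemma perimeter_area_space_homeomorphic:
  "perimeter_area_space n \<pi> 0 homeomorphic_space top_of_set (outer ` {z \<in> null_cone. perim z = \<pi>})"
proof -
  have "perimeter_area_space n \<pi> 0 homeomorphic_space
      top_of_set (outer ` {z \<in> nonzero. perim z = \<pi> \<and> sqn pos_modes z - sqn neg_modes z = 0})"
    unfolding perimeter_area_space_def
    by (rule polygon_subspace_homeomorphic)
      (simp only: oriented_area_coordinates perim_def perimeter_coordinates[symmetric])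
  moreover have "{z \<in> nonzero. perim z = \<pi> \<and> sqn pos_modes z - sqn neg_modes z = 0} = {z \<in> null_cone. perim z = \<pi>}"
    unfolding quadric_def modes_eq by auto
  ultimately show ?thesis by simp
qed

text \<open>The zero level is closed under nonzero real scaling. An orbit is recorded by its
  rescaling to perimeter \<open>\<pi>\<close> together with its original perimeter, and scaling back
  by the quotient of the two is the inverse.\<close>

lemma homeomorphism_null_cone:
  assumes \<pi>: "\<pi> > 0"
  shows "\<exists>F G. homeomorphism (outer ` null_cone) (outer ` {z \<in> null_cone. perim z = \<pi>} \<times> {0::real<..}) F G"
proof -
  let ?S = "{z \<in> null_cone. perim z = \<pi>}"
  define scl where "scl r z = (\<lambda>k. of_real r * z k)" for r :: real and z :: "nat \<Rightarrow> complex"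
  define F where "F h = (outer (scl (\<pi> / perim (representative h)) (representative h)), perim (representative h))" for h
  define G where "G p = outer (scl (snd p / \<pi>) (representative (fst p)))" for p :: "(nat \<Rightarrow> real) \<times> real"
  have inv: "circle_invariant null_cone" by (rule circle_invariant_quadric)
  have perim_rot: "perim (rot c z) = perim z" if "cmod c = 1" for c z
    using perim_scale[of c z] that by (simp add: rot_def)
  have invS: "circle_invariant ?S"
    by (rule circle_invariant_Collect[OF inv]) (simp add: perim_rot)
  have pp: "0 < perim z" if "z \<in> null_cone" for z
    using that null_cone_nonzero perim_pos by blast
  have scl_rot: "outer (scl r (rot c z)) = outer (scl r z)" if "cmod c = 1" for r c z
  proof -
    have "scl r (rot c z) = rot c (scl r z)" by (simp add: scl_def rot_def mult.left_commute)
    then show ?thesis using outer_rot[OF that] by simp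
  qed
  have F: "F (outer z) = (outer (scl (\<pi> / perim z) z), perim z)" for z
    by (rule representative_outer[of z]) (simp add: F_def scl_rot perim_rot)
  have G: "G (outer z, r) = outer (scl (r / \<pi>) z)" for z r
    by (rule representative_outer[of z]) (simp add: G_def scl_rot)
  have perim_scl: "perim (scl r z) = \<bar>r\<bar> * perim z" for r z
    using perim_scale[of "of_real r" z] by (simp add: scl_def)
  have scl_in: "scl r z \<in> null_cone" if "z \<in> null_cone" "r \<noteq> 0" for r z
    using null_cone_scale[OF that(2,1)] by (simp add: scl_def)
  have scl_scl: "scl r (scl t z) = scl (r * t) z" for r t z
    by (simp add: scl_def mult.assoc)
  have scl_1: "scl 1 z = z" for z by (simp add: scl_def)
  have "homeomorphism (outer ` null_cone) (outer ` ?S \<times> {0<..}) F G"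
  proof (rule homeomorphismI)
    have "continuous_on null_cone (\<lambda>z. scl (\<pi> / perim z) z)"
      unfolding scl_def
      by (intro continuous_on_coordinatewise_then_product continuous_intros continuous_on_perim)
        (use pp in fastforce)
    then have "continuous_on null_cone (\<lambda>z. (outer (scl (\<pi> / perim z) z), perim z))"
      by (intro continuous_on_Pair continuous_on_perim continuous_on_compose2[OF continuous_on_outer[of UNIV]]) auto
    then show "continuous_on (outer ` null_cone) F"
      by (intro continuous_on_descend[OF inv]) (simp add: F)
    have "continuous_on ({0<..} \<times> ?S) (\<lambda>p. scl (fst p / \<pi>) (snd p))"
      unfolding scl_def
      by (intro continuous_on_coordinatewise_then_product continuous_intros) (use \<pi> in simp)
    then have "continuous_on ({0<..} \<times> ?S) (\<lambda>p. outer (scl (fst p / \<pi>) (snd p)))"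
      by (intro continuous_on_compose2[OF continuous_on_outer[of UNIV]]) auto
    \<comment> \<open>The factors are swapped because \<open>continuous_on_descend_param\<close>
      expects the parameter first.\<close>
    then have "continuous_on ({0<..} \<times> outer ` ?S) (\<lambda>p. G (snd p, fst p))"
      by (intro continuous_on_descend_param[OF invS]) (simp add: G)
    then have "continuous_on (outer ` ?S \<times> {0<..}) (\<lambda>q. (\<lambda>p. G (snd p, fst p)) (snd q, fst q))"
      by (rule continuous_on_compose2)
        (auto intro!: continuous_on_Pair continuous_on_fst continuous_on_snd continuous_on_id)
    then show "continuous_on (outer ` ?S \<times> {0<..}) G" by simp
    show "F ` outer ` null_cone \<subseteq> outer ` ?S \<times> {0<..}"
    proof (intro image_subsetI, elim imageE)
      fix h z assume z: "z \<in> null_cone" "h = outer z"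
      have "scl (\<pi> / perim z) z \<in> ?S"
        using z pp[OF z(1)] \<pi> scl_in[OF z(1)] by (simp add: perim_scl)
      then show "F h \<in> outer ` ?S \<times> {0<..}" using pp[OF z(1)] unfolding z(2) F by blast
    qed
    show "G ` (outer ` ?S \<times> {0<..}) \<subseteq> outer ` null_cone"
    proof (intro image_subsetI)
      fix q assume "q \<in> outer ` ?S \<times> {0::real<..}"
      then obtain z r where z: "z \<in> ?S" "0 < r" "q = (outer z, r)" by blast
      then show "G q \<in> outer ` null_cone" using scl_in[of z "r / \<pi>"] \<pi> unfolding z(3) G by simp
    qed
    show "G (F h) = h" if "h \<in> outer ` null_cone" for h
    proof -
      from that obtain z where z: "z \<in> null_cone" "h = outer z" by blast
      then show ?thesis using pp[OF z(1)] \<pi> by (simp add: F G scl_scl scl_1)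
    qed
    show "F (G q) = q" if "q \<in> outer ` ?S \<times> {0<..}" for q
    proof -
      from that obtain z r where z: "z \<in> ?S" "0 < r" "q = (outer z, r)" by blast
      then have "perim z = \<pi>" by simp
      then show ?thesis using z(2) \<pi> unfolding z(3) by (simp add: F G scl_scl perim_scl scl_1)
    qed
  qed
  then show ?thesis by blast
qed

lemma zero_area:
  assumes \<pi>: "\<pi> > 0"
  shows "area_space n 0 homeomorphic_space prod_topology (perimeter_area_space n \<pi> 0) (top_of_set {(0::real)<..})"
    and "homology_group j (area_space n 0) \<cong> homology_group j (perimeter_area_space n \<pi> 0)"
proof -
  let ?S = "{z \<in> null_cone. perim z = \<pi>}"
  obtain F G where hom: "homeomorphism (outer ` null_cone) (outer ` ?S \<times> {0::real<..}) F G"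
    using homeomorphism_null_cone[OF \<pi>] by blast
  have 1: "top_of_set (outer ` null_cone) homeomorphic_space top_of_set (outer ` ?S \<times> {0::real<..})"
    using homeomorphism_imp_homeomorphic_map[OF hom] by (rule homeomorphic_map_imp_homeomorphic_space)
  have 2: "prod_topology (top_of_set (outer ` ?S)) (top_of_set {0::real<..})
      homeomorphic_space prod_topology (perimeter_area_space n \<pi> 0) (top_of_set {0::real<..})"
    using perimeter_area_space_homeomorphic[of \<pi>] homeomorphic_space_sym homeomorphic_space_refl
    by (intro homeomorphic_space_prod_topology) blast+
  have "area_space n 0 homeomorphic_space prod_topology (top_of_set (outer ` ?S)) (top_of_set {0::real<..})"
    using homeomorphic_space_trans[OF area_space_homeomorphic[of 0] 1] unfolding prod_topology_top_of_set .
  then show "area_space n 0 homeomorphic_space prod_topology (perimeter_area_space n \<pi> 0) (top_of_set {(0::real)<..})"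
    using 2 by (rule homeomorphic_space_trans)
  have pos: "0 < 1 - t + t * x" if "0 \<le> t" "t \<le> 1" "0 < x" for t x :: real
    using that by (cases "t = 0") (auto intro!: add_nonneg_pos)
  \<comment> \<open>The factor of positive reals contracts to 1 along straight lines.\<close>
  have "homology_group j (top_of_set (outer ` ?S \<times> {0::real<..})) \<cong> homology_group j (top_of_set (outer ` ?S))"
  proof (rule isomorphic_homology_homotopy_equivalence[where f = fst and g = "\<lambda>h. (h, 1)"
        and h = "\<lambda>(t, (h, x)). (h, 1 - t + t * x)" and k = snd])
    show "continuous_on ({0..1::real} \<times> outer ` ?S \<times> {0::real<..}) (\<lambda>(t, (h, x)). (h, 1 - t + t * x))"
      unfolding case_prod_unfold
      by (intro continuous_on_Pair continuous_on_add continuous_on_diff continuous_on_mult continuous_on_const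
          continuous_on_fst continuous_on_snd continuous_on_id)
    show "(\<lambda>(t, (h, x)). (h, 1 - t + t * x)) ` ({0..1::real} \<times> outer ` ?S \<times> {0::real<..}) \<subseteq> outer ` ?S \<times> {0<..}"
    proof (rule image_subsetI)
      fix q assume "q \<in> {0..1::real} \<times> outer ` ?S \<times> {0::real<..}"
      then obtain t h x where "q = (t, h, x)" "t \<in> {0..1}" "h \<in> outer ` ?S" "0 < x" by blast
      then show "(\<lambda>(t, (h, x)). (h, 1 - t + t * x)) q \<in> outer ` ?S \<times> {0<..}" using pos[of t x] by simp
    qed
  qed (force intro!: continuous_on_Pair continuous_on_fst continuous_on_snd continuous_on_id continuous_on_const)+
  then have "homology_group j (area_space n 0) \<cong> homology_group j (top_of_set (outer ` ?S))"
    using homeomorphic_space_imp_isomorphic_homology_groups[OF homeomorphic_space_trans[OF area_space_homeomorphic[of 0] 1]]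
      iso_trans by blast
  moreover have "homology_group j (top_of_set (outer ` ?S)) \<cong> homology_group j (perimeter_area_space n \<pi> 0)"
    using perimeter_area_space_homeomorphic[of \<pi>] homeomorphic_space_sym
      homeomorphic_space_imp_isomorphic_homology_groups by blast
  ultimately show "homology_group j (area_space n 0) \<cong> homology_group j (perimeter_area_space n \<pi> 0)"
    by (rule iso_trans)
qed

lemma homology_zero_area:
  assumes "\<pi> > 0"
  shows "homology_group j (area_space n 0) \<cong> zero_area_homology n j"
    and "homology_group j (perimeter_area_space n \<pi> 0) \<cong> zero_area_homology n j"
proof -
  show 1: "homology_group j (area_space n 0) \<cong> zero_area_homology n j"
    unfolding zero_area_homology_eq by (rule Z_or_trivial_imp_iso[OF homology_area_0]) simp
  show "homology_group j (perimeter_area_space n \<pi> 0) \<cong> zero_area_homology n j"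
    using group.iso_sym[OF group_relative_homology_group zero_area(2)[OF assms]] 1 by (rule iso_trans)
qed

end

theorem theorem5:
  fixes n :: nat
  assumes "n \<ge> 3"
  shows
    "(\<forall>a::real. a \<noteq> 0 \<longrightarrow>
        topological_manifold (2 * n - 4) (area_space n a) \<and>
        (\<exists>(K :: (nat \<Rightarrow> real) topology) (I :: nat set) d \<Phi>.
           cw_structure K I d \<Phi> \<and>
           area_space n a homotopy_equivalent_space K \<and>
           bij_betw d I {k. even k \<and> k \<le> 2 * ((n + 1) div 2) - 4})) \<and>
     (\<forall>\<pi>::real. \<pi> > 0 \<longrightarrow>
        area_space n 0 homeomorphic_space
          prod_topology (perimeter_area_space n \<pi> 0) (top_of_set {(0::real)<..}) \<and>
        (\<forall>j::int.
           homology_group j (area_space n 0) \<cong> homology_group j (perimeter_area_space n \<pi> 0) \<and>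
           homology_group j (area_space n 0) \<cong> zero_area_homology n j \<and>
           homology_group j (perimeter_area_space n \<pi> 0) \<cong> zero_area_homology n j))"
proof -
  interpret polygons n by unfold_locales (rule assms)
  show ?thesis
    using nonzero_area zero_area homology_zero_area by blast
qed

end
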